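(* (i) If $\Lambda\subset\mathbb{D}$ is a separated sequence for which $D^+(\Lambda)<1$, then there exists $A=A(\Lambda)\in H^\infty_2$ such that the differential equation $f''+Af=0$ admits a non-trivial solution $f$ (analytic in $\mathbb{D}$) which vanishes at all points of $\Lambda$. (ii) Conversely, if $A\in H^\infty_2$ and $f$ is a non-trivial solution of $f''+Af=0$ in $\mathbb{D}$ whose zero-sequence is $\Lambda\subset\mathbb{D}$, then $\Lambda$ is separated, and $\Lambda$ contains at most one point if $\lVert A\rVert_{H^\infty_2}\leq 1$, while otherwise (i.e. if $\lVert A\rVert_{H^\infty_2}>1$) $$D^+(\Lambda) \leq (2\pi+1) \left(1-\frac{2\lVert A\rVert_{H^\infty_2}^{1/2}}{\lVert A\rVert_{H^\infty_2}+1} \right)^{1/2} \left( 1 - \left(1-\frac{2\lVert A\rVert_{H^\infty_2}^{1/2}}{\lVert A\rVert_{H^\infty_2}+1} \right)^{1/2} \right)^{-2}.$$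
   Context: $\mathbb{D}$ is the open unit disc of $\mathbb{C}$ and $\mathcal{H}(\mathbb{D})$ is the set of analytic functions in $\mathbb{D}$. $H^\infty_2$ is the set of $A\in\mathcal{H}(\mathbb{D})$ with $\lVert A\rVert_{H^\infty_2}=\sup_{z\in\mathbb{D}}(1-|z|^2)^2|A(z)|<\infty$. A solution $f$ of $f''+Af=0$ is non-trivial if $f\not\equiv 0$. The pseudo-hyperbolic distance is $\varrho(z,w)=|z-w|/|1-\overline{z}w|$ for $z,w\in\mathbb{D}$, and $\Delta(\zeta,r)=\{z\in\mathbb{D}:\varrho(z,\zeta)<r\}$ for $\zeta\in\mathbb{D}$, $0<r<1$. A (finite or infinite) sequence $\Lambda=\{z_n\}\subset\mathbb{D}$ is separated if there is a constant $\delta=\delta(\Lambda)>0$ such that $\varrho(z_n,z_k)>\delta$ for all $n\neq k$. Let $n(\Lambda,\zeta,r)$ be the number of points of $\Lambda$ lying in $\Delta(\zeta,r)$. The upper uniform density of $\Lambda$ is $$D^+(\Lambda)=\limsup_{r\to1^-}\left(\log\frac{1}{1-r}\right)^{-1}\sup_{\zeta\in\mathbb{D}}\int_0^r n(\Lambda,\zeta,s)\,ds.$$ *)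

theory Defs
  imports "HOL-Complex_Analysis.Complex_Analysis"
begin

definition Hinf2_norm :: "(complex \<Rightarrow> complex) \<Rightarrow> real" where
  "Hinf2_norm A = (SUP z\<in>ball 0 1. (1 - (cmod z)\<^sup>2)\<^sup>2 * cmod (A z))"

definition Hinf2 :: "(complex \<Rightarrow> complex) set" where
  "Hinf2 = {A. A holomorphic_on ball 0 1 \<and>
     bdd_above ((\<lambda>z. (1 - (cmod z)\<^sup>2)\<^sup>2 * cmod (A z)) ` ball 0 1)}"

definition nontrivial_solution :: "(complex \<Rightarrow> complex) \<Rightarrow> (complex \<Rightarrow> complex) \<Rightarrow> bool" where
  "nontrivial_solution A f \<longleftrightarrow>
     f holomorphic_on ball 0 1 \<and>
     (\<forall>z\<in>ball 0 1. deriv (deriv f) z + A z * f z = 0) \<and>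
     (\<exists>z\<in>ball 0 1. f z \<noteq> 0)"

definition pseudohyp :: "complex \<Rightarrow> complex \<Rightarrow> real" where
  "pseudohyp z w = cmod (z - w) / cmod (1 - cnj z * w)"

definition pseudohyp_disc :: "complex \<Rightarrow> real \<Rightarrow> complex set" where
  "pseudohyp_disc \<zeta> r = {z \<in> ball 0 1. pseudohyp z \<zeta> < r}"

text \<open>
  A finite or infinite sequence of complex numbers is a pair of an index set \<open>I \<subseteq> \<nat>\<close>
  and a function \<open>z\<close>, of which only the values on \<open>I\<close> matter. Repetitions are allowed
  and count with their multiplicity.
\<close>

definition separated :: "nat set \<Rightarrow> (nat \<Rightarrow> complex) \<Rightarrow> bool" where
  "separated I z \<longleftrightarrow> z ` I \<subseteq> ball 0 1 \<and>
     (\<exists>\<delta>>0. \<forall>n\<in>I. \<forall>k\<in>I. n \<noteq> k \<longrightarrow> pseudohyp (z n) (z k) > \<delta>)"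

text \<open>The counting function takes the value \<open>\<infinity>\<close> if infinitely many terms lie in the disc.\<close>

definition disc_count :: "nat set \<Rightarrow> (nat \<Rightarrow> complex) \<Rightarrow> complex \<Rightarrow> real \<Rightarrow> ennreal" where
  "disc_count I z \<zeta> r = emeasure (count_space UNIV) {n\<in>I. z n \<in> pseudohyp_disc \<zeta> r}"

definition upper_density :: "nat set \<Rightarrow> (nat \<Rightarrow> complex) \<Rightarrow> ennreal" where
  "upper_density I z = Limsup (at_left 1) (\<lambda>r::real.
     (SUP \<zeta>\<in>ball 0 1. \<integral>\<^sup>+ s\<in>{0..r}. disc_count I z \<zeta> s \<partial>lborel) / ennreal (ln (1 / (1 - r))))"

text \<open>
  Every zero in the disc is listed as often as its multiplicity, and nothing else is listed
  (\<open>zorder f w = 0\<close> if \<open>f w \<noteq> 0\<close>). Meant for \<open>f\<close> analytic and not identically zero in the disc.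
\<close>

definition zero_sequence :: "(complex \<Rightarrow> complex) \<Rightarrow> nat set \<Rightarrow> (nat \<Rightarrow> complex) \<Rightarrow> bool" where
  "zero_sequence f I z \<longleftrightarrow> z ` I \<subseteq> ball 0 1 \<and>
     (\<forall>w\<in>ball 0 1. finite {n\<in>I. z n = w} \<and> int (card {n\<in>I. z n = w}) = zorder f w)"

end

theory Submission
  imports Defs
begin

text \<open>
  (i) Write \<open>r\<^sub>n = |z\<^sub>n|\<close>. The solution is sought in the form \<open>f = g e\<^sup>h\<close>, where \<open>g\<close> has simple zeros exactly at
  the points of \<open>\<Lambda>\<close>. Then \<open>A = - (g'' + 2 g' h') / g - h'' - (h')\<^sup>2\<close> is analytic as soon as
  \<open>h' = - g'' / (2 g')\<close> on \<open>\<Lambda>\<close>, and it lies in \<open>H\<^sup>\<infinity>\<^sub>2\<close> if \<open>h' = O(1 / (1 - |x|))\<close> and \<open>g\<close> behaves regularly.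
  For \<open>g\<close> take the product of the Blaschke factors of \<open>\<Lambda>\<close>, each multiplied by the exponential of
  \<open>(1 - r\<^sub>n\<^sup>2) / 2 * (1 + s\<^sub>n cnj z\<^sub>n x) / (1 - s\<^sub>n cnj z\<^sub>n x)\<close>, that is, of a Poisson-type kernel centred at \<open>s\<^sub>n z\<^sub>n\<close>
  instead of \<open>z\<^sub>n\<close>: \<open>1 - s\<^sub>n\<close> is the power of \<open>1 / \<beta>\<close> between \<open>Q (1 - r\<^sub>n)\<close> and
  \<open>\<beta> Q (1 - r\<^sub>n)\<close>, with \<open>Q\<close> large and \<open>\<beta>\<close> much larger. Then
  \<open>log |g|\<close> is, up to a bounded error and the logarithm of the distance to \<open>\<Lambda>\<close>, a positive weight \<open>\<Phi>\<close>.
  The points with a given \<open>s\<^sub>n\<close> contribute to \<open>\<Phi>\<close> at most \<open>p log \<beta>\<close> with \<open>p < 1\<close>, because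
  \<open>D\<^sup>+(\<Lambda>) < 1\<close> controls the sums of \<open>(r - \<rho>(z\<^sub>n, \<zeta>))\<^sup>+\<close> for \<open>\<zeta> = s\<^sub>n x\<close>. Hence
  \<open>\<Phi>(x) - \<Phi>(w) \<le> p log (|1 - cnj w x| / (1 - |x|)) + O(1)\<close>, and since \<open>p < 1\<close> an explicit
  interpolation series converges to a suitable \<open>h'\<close>.

  (ii) A solution with zeros at \<open>\<plusminus>b\<close>, \<open>b < N\<^sup>-\<^sup>1\<^sup>/\<^sup>2\<close>, is excluded by a Sturm comparison, where
  \<open>N = max 1 \<parallel>A\<parallel>\<close>; by conformal invariance the pseudo-hyperbolic discs of radius \<open>q = N\<^sup>-\<^sup>1\<^sup>/\<^sup>2\<close> about the zeros
  are pairwise disjoint. Integrating \<open>1 / (1 - |z|\<^sup>2)\<close> over them shows that \<open>D\<^sup>+(\<Lambda>)\<close> is at most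
  \<open>3 / 4 * (q\<^sup>-\<^sup>2 - q\<^sup>2)\<close> plus any positive number, which is below the asserted bound.
\<close>

section \<open>The pseudo-hyperbolic metric\<close>

text \<open>In (i) the sum of \<open>1 - |z_n|\<close> may diverge; only the sum of the squares is
  sure to converge. Each Blaschke factor therefore needs an exponential that cancels its first-order
  deviation from 1, and the price is the weight \<open>\<Phi>\<close>. Growth of
  \<open>\<Phi>\<close> with exponent \<open>p\<close> costs \<open>p\<close> in the decay of the
  interpolation series, which has exactly one to spare. The shifts \<open>s_n\<close> are quantised
  so that all points of one layer are seen from the same \<open>\<zeta> = s x\<close>; a single use
  of the density hypothesis then bounds the layer by roughly \<open>p ln \<beta>\<close> plus a
  constant that does not depend on \<open>\<beta>\<close>. About
  \<open>ln (|1 - cnj w x| / (1 - |x|)) / ln \<beta>\<close> layers distinguish \<open>x\<close>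
  from \<open>w\<close>, so a large \<open>\<beta>\<close> makes the constants harmless. In (ii)
  there is slack. The integral of \<open>1 / (1 - |z|\<^sup>2)\<close> is estimated by dyadic rings,
  which replaces the natural logarithm by the one to base 2 and turns a factor 1/2 into 3/4; the
  constant \<open>2 \<pi> + 1\<close> leaves room for that.\<close>

lemma cmod_one_minus_cnj_mult_ge:
  assumes "cmod z \<le> 1" "cmod w \<le> 1"
  shows "cmod (1 - cnj z * w) \<ge> 1 - cmod z" "cmod (1 - cnj z * w) \<ge> 1 - cmod w"
proof -
  have "cmod (1 - cnj z * w) \<ge> 1 - cmod z * cmod w"
    using norm_triangle_ineq2[of 1 "cnj z * w"] by (simp add: norm_mult)
  moreover have "cmod z * cmod w \<le> cmod z" "cmod z * cmod w \<le> cmod w"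
    using assms by (simp_all add: mult_left_le mult_right_le_one_le mult_left_le_one_le)
  ultimately show "cmod (1 - cnj z * w) \<ge> 1 - cmod z" "cmod (1 - cnj z * w) \<ge> 1 - cmod w"
    by linarith+
qed

lemma cmod_one_minus_cnj_mult_pos:
  assumes "cmod z < 1" "cmod w < 1"
  shows "cmod (1 - cnj z * w) > 0"
  using cmod_one_minus_cnj_mult_ge(1)[of z w] assms by linarith

lemma cmod_one_minus_cnj_mult_le_2:
  assumes "cmod z < 1" "cmod w < 1"
  shows "cmod (1 - cnj z * w) \<le> 2"
proof -
  have "cmod (1 - cnj z * w) \<le> 1 + cmod z * cmod w"
    using norm_triangle_ineq4[of 1 "cnj z * w"] by (simp add: norm_mult)
  moreover have "cmod z * cmod w \<le> 1"
    using assms by (simp add: mult_le_one)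
  ultimately show ?thesis by linarith
qed

lemma cmod_one_minus_cnj_mult_commute: "cmod (1 - cnj z * w) = cmod (1 - cnj w * z)"
proof -
  have "1 - cnj w * z = cnj (1 - cnj z * w)"
    by (simp add: mult.commute)
  then show ?thesis
    by (simp only: complex_mod_cnj)
qed

lemma cmod_one_minus_cnj_mult_sq:
  "(cmod (1 - cnj z * w))\<^sup>2 = (cmod (z - w))\<^sup>2 + (1 - (cmod z)\<^sup>2) * (1 - (cmod w)\<^sup>2)"
  unfolding cmod_power2 by (simp add: power2_eq_square algebra_simps)

lemma pseudohyp_nonneg: "pseudohyp z w \<ge> 0"
  by (simp add: pseudohyp_def)

lemma pseudohyp_commute: "pseudohyp z w = pseudohyp w z"
  unfolding pseudohyp_def using cmod_one_minus_cnj_mult_commute[of z w] norm_minus_commute[of z w] by simp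

lemma one_minus_pseudohyp_sq:
  assumes "cmod z < 1" "cmod w < 1"
  shows "1 - (pseudohyp z w)\<^sup>2 = (1 - (cmod z)\<^sup>2) * (1 - (cmod w)\<^sup>2) / (cmod (1 - cnj z * w))\<^sup>2"
  using cmod_one_minus_cnj_mult_sq[of z w] cmod_one_minus_cnj_mult_pos[OF assms]
  by (simp add: pseudohyp_def power_divide field_simps)

lemma one_minus_cmod_sq_pos: "cmod z < 1 \<Longrightarrow> 1 - (cmod z)\<^sup>2 > 0"
  by (simp add: abs_square_less_1)

lemma pseudohyp_less_1:
  assumes "cmod z < 1" "cmod w < 1"
  shows "pseudohyp z w < 1"
proof -
  have "1 - (pseudohyp z w)\<^sup>2 > 0"
    unfolding one_minus_pseudohyp_sq[OF assms]
    using assms cmod_one_minus_cnj_mult_pos[OF assms]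
    by (intro divide_pos_pos mult_pos_pos one_minus_cmod_sq_pos zero_less_power)
  then show ?thesis
    using pseudohyp_nonneg[of z w] abs_square_less_1[of "pseudohyp z w"] by simp
qed

lemma cmod_diff_le:
  assumes "cmod z < 1" "cmod w < 1"
  shows "cmod (z - w) \<le> cmod (1 - cnj z * w)"
  using pseudohyp_less_1[OF assms] cmod_one_minus_cnj_mult_pos[OF assms]
  by (simp add: pseudohyp_def field_simps)

lemma pseudohyp_eq_0_iff:
  assumes "cmod z < 1" "cmod w < 1"
  shows "pseudohyp z w = 0 \<longleftrightarrow> z = w"
  using cmod_one_minus_cnj_mult_pos[OF assms] by (simp add: pseudohyp_def)

text \<open>The disc automorphism that carries \<open>a\<close> to 0.\<close>

definition moebius :: "complex \<Rightarrow> complex \<Rightarrow> complex" where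
  "moebius a z = (z - a) / (1 - cnj a * z)"

lemma cmod_moebius: "cmod (moebius a z) = pseudohyp z a"
  unfolding moebius_def pseudohyp_def norm_divide
  using cmod_one_minus_cnj_mult_commute[of a z] by simp

lemma moebius_in_disc: "cmod a < 1 \<Longrightarrow> cmod z < 1 \<Longrightarrow> cmod (moebius a z) < 1"
  by (simp add: cmod_moebius pseudohyp_less_1)

lemma pseudohyp_moebius:
  assumes "cmod a < 1" "cmod z < 1" "cmod w < 1"
  shows "pseudohyp (moebius a z) (moebius a w) = pseudohyp z w"
proof -
  have nz: "1 - cnj a * z \<noteq> 0" "1 - cnj a * w \<noteq> 0" "1 - a * cnj z \<noteq> 0" "1 - cnj z * w \<noteq> 0"
    using cmod_one_minus_cnj_mult_pos[of a z] cmod_one_minus_cnj_mult_pos[of a w]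
      cmod_one_minus_cnj_mult_pos[of z a] cmod_one_minus_cnj_mult_pos[of z w] assms
    by (auto simp: mult.commute)
  have aa: "1 - a * cnj a \<noteq> 0"
    using cmod_one_minus_cnj_mult_pos[of a a] assms by (auto simp: mult.commute)
  have 1: "moebius a z - moebius a w = (z - w) * (1 - a * cnj a) / ((1 - cnj a * z) * (1 - cnj a * w))"
    unfolding moebius_def using nz by (simp add: field_simps)
  have 2: "1 - cnj (moebius a z) * moebius a w =
      (1 - cnj z * w) * (1 - a * cnj a) / ((1 - a * cnj z) * (1 - cnj a * w))"
  proof -
    have "1 - cnj (moebius a z) * moebius a w =
        ((1 - a * cnj z) * (1 - cnj a * w) - (cnj z - cnj a) * (w - a)) / ((1 - a * cnj z) * (1 - cnj a * w))"
    proof -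
      have gen: "1 - x / p * (y / q) = (p * q - x * y) / (p * q)" if "p \<noteq> 0" "q \<noteq> 0" for x y p q :: complex
        using that by (simp add: field_simps)
      show ?thesis
        using gen[OF nz(3) nz(2)] by (simp add: moebius_def)
    qed
    also have "(1 - a * cnj z) * (1 - cnj a * w) - (cnj z - cnj a) * (w - a) = (1 - cnj z * w) * (1 - a * cnj a)"
      by (simp add: algebra_simps)
    finally show ?thesis .
  qed
  have 3: "cmod (1 - a * cnj z) = cmod (1 - cnj a * z)"
    using cmod_one_minus_cnj_mult_commute[of a z] by (simp add: mult.commute)
  show ?thesis
    unfolding pseudohyp_def 1 2 norm_mult norm_divide 3 using nz aa by (simp add: divide_simps)
qed

text \<open>With \<open>v\<close> moved to the origin, the distances to \<open>v\<close> become
  moduli \<open>a\<close> and \<open>b\<close>, and the denominator in the formula for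
  \<open>1 - \<rho>\<^sup>2\<close> is at most \<open>1 + a b\<close>. The sharp form is what makes
  discs of radius \<open>q\<close> disjoint when their centres are at distance at least
  \<open>2 q / (1 + q\<^sup>2)\<close>.\<close>

lemma pseudohyp_triangle_strong:
  assumes "cmod z < 1" "cmod w < 1" "cmod v < 1"
  shows "pseudohyp z w \<le> (pseudohyp z v + pseudohyp w v) / (1 + pseudohyp z v * pseudohyp w v)"
proof -
  define a b where "a = cmod (moebius v z)" and "b = cmod (moebius v w)"
  have a1: "0 \<le> a" "a < 1" and b1: "0 \<le> b" "b < 1"
    using moebius_in_disc assms by (auto simp: a_def b_def)
  define d where "d = cmod (1 - cnj (moebius v z) * moebius v w)"
  have d: "0 < d" "d \<le> 1 + a * b"
  proof -
    show "0 < d"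
      unfolding d_def using cmod_one_minus_cnj_mult_pos a1 b1 by (simp add: a_def b_def)
    have "d \<le> cmod 1 + cmod (cnj (moebius v z) * moebius v w)"
      unfolding d_def by (rule norm_triangle_ineq4)
    then show "d \<le> 1 + a * b"
      by (simp add: a_def b_def norm_mult)
  qed
  have pos: "1 + a * b > 0"
    using a1 b1 by (simp add: add_pos_nonneg)
  then have "1 - ((a + b) / (1 + a * b))\<^sup>2 = ((1 + a * b)\<^sup>2 - (a + b)\<^sup>2) / (1 + a * b)\<^sup>2"
    by (simp add: power_divide diff_divide_distrib)
  also have "(1 + a * b)\<^sup>2 - (a + b)\<^sup>2 = (1 - a\<^sup>2) * (1 - b\<^sup>2)"
    by (simp add: power2_eq_square algebra_simps)
  also have "(1 - a\<^sup>2) * (1 - b\<^sup>2) / (1 + a * b)\<^sup>2 \<le> (1 - a\<^sup>2) * (1 - b\<^sup>2) / d\<^sup>2"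
    using a1 b1 d pos by (intro divide_left_mono mult_nonneg_nonneg power_mono mult_pos_pos zero_less_power)
      (auto simp: power_le_one)
  also have "\<dots> = 1 - (pseudohyp z w)\<^sup>2"
    using one_minus_pseudohyp_sq[of "moebius v z" "moebius v w"] a1 b1 pseudohyp_moebius[of v z w] assms
    by (simp add: a_def b_def d_def)
  finally have "(pseudohyp z w)\<^sup>2 \<le> ((a + b) / (1 + a * b))\<^sup>2"
    by simp
  then have "pseudohyp z w \<le> (a + b) / (1 + a * b)"
    using a1 b1 by (elim power2_le_imp_le) auto
  then show ?thesis
    by (simp add: a_def b_def cmod_moebius)
qed

lemma pseudohyp_triangle:
  assumes "cmod z < 1" "cmod w < 1" "cmod v < 1"
  shows "pseudohyp z w \<le> pseudohyp z v + pseudohyp v w"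
proof -
  have "(pseudohyp z v + pseudohyp w v) / (1 + pseudohyp z v * pseudohyp w v)
      \<le> (pseudohyp z v + pseudohyp w v) / 1"
    by (intro divide_left_mono) (auto simp: pseudohyp_nonneg intro!: add_pos_nonneg)
  then show ?thesis
    using pseudohyp_triangle_strong[OF assms] pseudohyp_commute[of w v] by simp
qed

section \<open>Zeros of solutions are separated\<close>

text \<open>The bound \<open>N\<close> is a parameter of its own because a conformal change of
  variable replaces the coefficient but preserves its bound.\<close>

definition disc_ode :: "real \<Rightarrow> (complex \<Rightarrow> complex) \<Rightarrow> (complex \<Rightarrow> complex) \<Rightarrow> bool" where
  "disc_ode N A f \<longleftrightarrow> f holomorphic_on ball 0 1 \<and>
     (\<forall>z\<in>ball 0 1. deriv (deriv f) z + A z * f z = 0) \<and>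
     (\<forall>z\<in>ball 0 1. (1 - (cmod z)\<^sup>2)\<^sup>2 * cmod (A z) \<le> N)"

section \<open>Conformal invariance of the equation\<close>

lemma moebius_inverse:
  assumes "cmod a < 1" "cmod w < 1"
  shows "(moebius a w + a) / (1 + cnj a * moebius a w) = w"
proof -
  have nz: "1 - cnj a * w \<noteq> 0" "1 - cnj a * a \<noteq> 0"
    using cmod_one_minus_cnj_mult_pos[of a w] cmod_one_minus_cnj_mult_pos[of a a] assms by auto
  have "moebius a w + a = w * (1 - cnj a * a) / (1 - cnj a * w)"
    unfolding moebius_def using nz by (simp add: field_simps)
  moreover have "1 + cnj a * moebius a w = (1 - cnj a * a) / (1 - cnj a * w)"
    unfolding moebius_def using nz by (simp add: field_simps)
  ultimately show ?thesis
    using nz by simp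
qed

text \<open>Up to a constant, the factor \<open>m\<close> in \<open>g = m (f o \<phi>)\<close> is
  \<open>\<phi>'\<close> to the power -1/2. This gives
  \<open>g'' + (A o \<phi>) \<phi>'\<^sup>2 g = 0\<close> without a further term, since the
  Schwarzian derivative of a Moebius map vanishes. The bound survives because
  \<open>(1 - |z|\<^sup>2) |\<phi>'| = 1 - |\<phi>|\<^sup>2\<close>.\<close>

lemma disc_ode_moebius:
  fixes f :: "complex \<Rightarrow> complex"
  assumes f: "disc_ode N A f" and a: "cmod a < 1" and u: "cmod u = 1"
  defines "\<phi> \<equiv> \<lambda>z. (u * z + a) / (1 + cnj a * u * z)"
  shows "\<exists>B g. disc_ode N B g \<and> (\<forall>z. cmod z < 1 \<longrightarrow> f (\<phi> z) = 0 \<longrightarrow> g z = 0) \<and>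
    ((\<forall>z\<in>ball 0 1. g z = 0) \<longrightarrow> (\<forall>z\<in>ball 0 1. f z = 0))"
proof -
  define m where "m = (\<lambda>z. 1 + cnj a * u * z)"
  define D where "D = u * (1 - a * cnj a)"
  define g where "g = (\<lambda>z. m z * f (\<phi> z))"
  define B where "B = (\<lambda>z. D\<^sup>2 * A (\<phi> z) / m z ^ 4)"
  have uz: "cmod (u * z) = cmod z" for z
    by (simp add: norm_mult u)
  have m: "m z \<noteq> 0" if "cmod z < 1" for z
    using cmod_one_minus_cnj_mult_pos[of "- a" "u * z"] a that uz[of z] by (auto simp: m_def mult.assoc)
  have cmod_phi: "cmod (\<phi> z) = pseudohyp (u * z) (- a)" for z
    by (simp flip: cmod_moebius add: moebius_def \<phi>_def mult.assoc)
  have phi: "cmod (\<phi> z) < 1" if "cmod z < 1" for z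
    unfolding cmod_phi using that uz a by (intro pseudohyp_less_1) auto
  have cmod_D: "cmod D = 1 - (cmod a)\<^sup>2"
  proof -
    have "1 - a * cnj a = of_real (1 - (cmod a)\<^sup>2)"
      by (simp only: of_real_diff of_real_1 complex_norm_square)
    then have "cmod D = \<bar>1 - (cmod a)\<^sup>2\<bar>"
      unfolding D_def norm_mult u by (simp only: norm_of_real mult_1)
    then show ?thesis
      using one_minus_cmod_sq_pos[OF a] by simp
  qed
  have phi_D: "1 - (cmod (\<phi> z))\<^sup>2 = cmod D * (1 - (cmod z)\<^sup>2) / (cmod (m z))\<^sup>2" if "cmod z < 1" for z
  proof -
    have "cmod (1 - cnj (u * z) * - a) = cmod (m z)"
      using cmod_one_minus_cnj_mult_commute[of "u * z" "- a"] by (simp add: m_def mult.assoc)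
    then show ?thesis
      unfolding cmod_phi cmod_D
      using one_minus_pseudohyp_sq[of "u * z" "- a"] a that uz[of z] by (simp add: mult.commute)
  qed
  have hf: "f holomorphic_on ball 0 1" and hf': "deriv f holomorphic_on ball 0 1"
    using f by (auto simp: disc_ode_def intro!: holomorphic_deriv)
  have df: "(f has_field_derivative deriv f w) (at w)"
    "(deriv f has_field_derivative deriv (deriv f) w) (at w)" if "cmod w < 1" for w
    using that by (auto intro!: holomorphic_derivI[OF hf] holomorphic_derivI[OF hf'])
  have dphi: "(\<phi> has_field_derivative D / (m z)\<^sup>2) (at z)" if "cmod z < 1" for z
  proof -
    have eq: "u * m z - (u * z + a) * (cnj a * u) = D"
      by (simp add: D_def m_def algebra_simps)
    have "(\<phi> has_field_derivative (u * m z - (u * z + a) * (cnj a * u)) / (m z * m z)) (at z)"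
      using m[OF that] unfolding \<phi>_def m_def by (auto intro!: derivative_eq_intros)
    then show ?thesis
      unfolding eq by (simp add: power2_eq_square)
  qed
  have dg: "(g has_field_derivative cnj a * u * f (\<phi> z) + D * deriv f (\<phi> z) / m z) (at z)"
    if "cmod z < 1" for z
  proof -
    have "(m has_field_derivative cnj a * u) (at z)"
      unfolding m_def by (auto intro!: derivative_eq_intros)
    from DERIV_mult[OF this DERIV_chain2[OF df(1)[OF phi[OF that]] dphi[OF that]]] m[OF that]
    show ?thesis
      by (simp add: g_def power2_eq_square field_simps)
  qed
  have dg': "((\<lambda>z. cnj a * u * f (\<phi> z) + D * deriv f (\<phi> z) / m z) has_field_derivative
      D\<^sup>2 * deriv (deriv f) (\<phi> z) / m z ^ 3) (at z)" if "cmod z < 1" for z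
  proof -
    have 1: "(m has_field_derivative cnj a * u) (at z)"
      unfolding m_def by (auto intro!: derivative_eq_intros)
    have "((\<lambda>z. cnj a * u * f (\<phi> z) + D * deriv f (\<phi> z) / m z) has_field_derivative
      cnj a * u * (deriv f (\<phi> z) * (D / (m z)\<^sup>2)) +
      ((D * (deriv (deriv f) (\<phi> z) * (D / (m z)\<^sup>2))) * m z - D * deriv f (\<phi> z) * (cnj a * u)) / (m z * m z)) (at z)"
      using m[OF that]
      by (intro DERIV_add DERIV_cmult DERIV_divide 1 DERIV_chain2[OF df(1)[OF phi[OF that]] dphi[OF that]]
          DERIV_chain2[OF df(2)[OF phi[OF that]] dphi[OF that]])
    moreover have "cnj a * u * (deriv f (\<phi> z) * (D / (m z)\<^sup>2)) +
      ((D * (deriv (deriv f) (\<phi> z) * (D / (m z)\<^sup>2))) * m z - D * deriv f (\<phi> z) * (cnj a * u)) / (m z * m z)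
      = D\<^sup>2 * deriv (deriv f) (\<phi> z) / m z ^ 3"
      using m[OF that] by (simp add: power2_eq_square power3_eq_cube field_simps)
    ultimately show ?thesis by simp
  qed
  have deriv_g: "deriv g z = cnj a * u * f (\<phi> z) + D * deriv f (\<phi> z) / m z" if "z \<in> ball 0 1" for z
    using DERIV_imp_deriv[OF dg] that by simp
  have ddg: "deriv (deriv g) z = D\<^sup>2 * deriv (deriv f) (\<phi> z) / m z ^ 3" if "z \<in> ball 0 1" for z
    using that by (intro DERIV_imp_deriv has_field_derivative_transform_within_open[OF dg' open_ball that])
      (auto simp: deriv_g)
  have ode: "deriv (deriv g) z + B z * g z = 0" if "z \<in> ball 0 1" for z
  proof -
    have "deriv (deriv f) (\<phi> z) = - A (\<phi> z) * f (\<phi> z)"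
      using f phi[of z] that by (auto simp: disc_ode_def eq_neg_iff_add_eq_0)
    moreover have "B z * g z = D\<^sup>2 * (A (\<phi> z) * f (\<phi> z)) / m z ^ 3"
      using m[of z] that by (simp add: B_def g_def power_numeral_reduce)
    ultimately show ?thesis
      unfolding ddg[OF that] by simp
  qed
  have bound: "(1 - (cmod z)\<^sup>2)\<^sup>2 * cmod (B z) \<le> N" if "z \<in> ball 0 1" for z
  proof -
    have "(1 - (cmod z)\<^sup>2)\<^sup>2 * cmod (B z) = (cmod D * (1 - (cmod z)\<^sup>2) / (cmod (m z))\<^sup>2)\<^sup>2 * cmod (A (\<phi> z))"
      by (simp add: B_def norm_mult norm_divide norm_power power_mult_distrib power_divide flip: power_mult)
    also have "\<dots> = (1 - (cmod (\<phi> z))\<^sup>2)\<^sup>2 * cmod (A (\<phi> z))"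
      using phi_D that by simp
    also have "\<dots> \<le> N"
      using f phi that by (auto simp: disc_ode_def)
    finally show ?thesis .
  qed
  have "g holomorphic_on ball 0 1"
    unfolding holomorphic_on_open[OF open_ball]
  proof (intro ballI exI)
    show "(g has_field_derivative cnj a * u * f (\<phi> z) + D * deriv f (\<phi> z) / m z) (at z)"
      if "z \<in> ball 0 1" for z
      using dg that by simp
  qed
  with ode bound have "disc_ode N B g"
    by (auto simp: disc_ode_def)
  moreover have "g z = 0" if "f (\<phi> z) = 0" for z
    using that by (simp add: g_def)
  moreover have "f w = 0" if g0: "\<forall>z\<in>ball 0 1. g z = 0" and w: "w \<in> ball 0 1" for w
  proof -
    define z where "z = cnj u * moebius a w"
    have uu: "u * cnj u = 1"
      using u by (simp add: complex_norm_square[symmetric])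
    have z: "cmod z < 1"
      using moebius_in_disc[OF a, of w] w by (simp add: z_def norm_mult u)
    have uz': "u * z = moebius a w"
      by (simp add: z_def uu flip: mult.assoc)
    have "\<phi> z = w"
      using moebius_inverse[OF a, of w] w by (simp add: \<phi>_def mult.assoc uz')
    moreover have "f (\<phi> z) = 0"
      using g0 z m[OF z] by (auto simp: g_def)
    ultimately show ?thesis by simp
  qed
  ultimately show ?thesis
    by blast
qed


text \<open>
  The function \<open>p x = - N x / (1 - N x\<^sup>2)\<close> is the logarithmic derivative of \<open>v = sqrt (1 - N x\<^sup>2)\<close>,
  which solves \<open>v'' + N v / (1 - N x\<^sup>2)\<^sup>2 = 0\<close>. Along a solution \<open>y\<close>, the Picone-type expression
  \<open>Re (cnj y y') - p |y|\<^sup>2\<close> is nondecreasing, so it vanishes between two zeros of \<open>y\<close>.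
\<close>

lemma disc_ode_symmetric_zeros:
  assumes f: "disc_ode N A f" and N: "N \<ge> 1" and b: "0 < b" "N * b\<^sup>2 < 1"
    and zeros: "f (of_real b) = 0" "f (of_real (- b)) = 0"
  shows "\<forall>z\<in>ball 0 1. f z = 0"
proof -
  define p where "p = (\<lambda>x::real. - N * x / (1 - N * x\<^sup>2))"
  define Y1 where "Y1 = (\<lambda>x::real. Re (f (of_real x)))"
  define Y2 where "Y2 = (\<lambda>x::real. Im (f (of_real x)))"
  define Z1 where "Z1 = (\<lambda>x::real. Re (deriv f (of_real x)))"
  define Z2 where "Z2 = (\<lambda>x::real. Im (deriv f (of_real x)))"
  define W where "W = (\<lambda>x::real. deriv (deriv f) (of_real x))"
  have hf: "f holomorphic_on ball 0 1" and hf': "deriv f holomorphic_on ball 0 1"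
    using f by (auto simp: disc_ode_def intro!: holomorphic_deriv)
  have range: "N * x\<^sup>2 < 1" "x\<^sup>2 < 1" "\<bar>x\<bar> < 1" if "x \<in> {-b..b}" for x
  proof -
    have "x\<^sup>2 \<le> b\<^sup>2"
      using that by (intro abs_le_square_iff[THEN iffD1]) auto
    then have "N * x\<^sup>2 \<le> N * b\<^sup>2"
      using N by (intro mult_left_mono) auto
    then show 1: "N * x\<^sup>2 < 1" using b by simp
    have "1 * x\<^sup>2 \<le> N * x\<^sup>2" using N by (intro mult_right_mono) auto
    then show "x\<^sup>2 < 1" using 1 by simp
    then show "\<bar>x\<bar> < 1" by (simp add: abs_square_less_1)
  qed
  have dY: "(Y1 has_real_derivative Z1 x) (at x)" "(Y2 has_real_derivative Z2 x) (at x)"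
    "(Z1 has_real_derivative Re (W x)) (at x)" "(Z2 has_real_derivative Im (W x)) (at x)"
    if "x \<in> {-b..b}" for x
  proof -
    have x: "complex_of_real x \<in> ball 0 1"
      using range(3)[OF that] by simp
    have 1: "((\<lambda>x. f (of_real x)) has_vector_derivative deriv f (of_real x)) (at x)"
      by (rule has_vector_derivative_real_field) (rule holomorphic_derivI[OF hf open_ball x])
    have 2: "((\<lambda>x. deriv f (of_real x)) has_vector_derivative W x) (at x)"
      unfolding W_def by (rule has_vector_derivative_real_field) (rule holomorphic_derivI[OF hf' open_ball x])
    show "(Y1 has_real_derivative Z1 x) (at x)" "(Y2 has_real_derivative Z2 x) (at x)"
      "(Z1 has_real_derivative Re (W x)) (at x)" "(Z2 has_real_derivative Im (W x)) (at x)"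
      unfolding Y1_def Y2_def Z1_def Z2_def has_real_derivative_iff_has_vector_derivative
      using bounded_linear.has_vector_derivative[OF bounded_linear_Re 1]
        bounded_linear.has_vector_derivative[OF bounded_linear_Im 1]
        bounded_linear.has_vector_derivative[OF bounded_linear_Re 2]
        bounded_linear.has_vector_derivative[OF bounded_linear_Im 2] by simp_all
  qed
  have dp: "(p has_real_derivative - (p x)\<^sup>2 - N / (1 - N * x\<^sup>2)\<^sup>2) (at x)" if "x \<in> {-b..b}" for x
  proof -
    have nz: "1 - N * x\<^sup>2 \<noteq> 0"
      using range(1)[OF that] by simp
    have "(p has_real_derivative ((- N) * (1 - N * x\<^sup>2) - (- N * x) * (- (N * (2 * x)))) / ((1 - N * x\<^sup>2) * (1 - N * x\<^sup>2))) (at x)"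
      unfolding p_def using nz by (intro DERIV_divide) (auto intro!: derivative_eq_intros)
    moreover have "((- N) * (1 - N * x\<^sup>2) - (- N * x) * (- (N * (2 * x)))) / ((1 - N * x\<^sup>2) * (1 - N * x\<^sup>2))
        = - (p x)\<^sup>2 - N / (1 - N * x\<^sup>2)\<^sup>2"
    proof -
      have "- (p x)\<^sup>2 - N / (1 - N * x\<^sup>2)\<^sup>2 = (- (N * x)\<^sup>2 - N) / (1 - N * x\<^sup>2)\<^sup>2"
        unfolding p_def by (simp add: power_divide diff_divide_distrib)
      moreover have "(- N) * (1 - N * x\<^sup>2) - (- N * x) * (- (N * (2 * x))) = - (N * x)\<^sup>2 - N"
        by (simp add: power2_eq_square algebra_simps)
      ultimately show ?thesis
        by (simp add: power2_eq_square)
    qed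
    ultimately show ?thesis by simp
  qed
  define Q where "Q = (\<lambda>x. Y1 x * Z1 x + Y2 x * Z2 x - p x * ((Y1 x)\<^sup>2 + (Y2 x)\<^sup>2))"
  define Q' where "Q' = (\<lambda>x. (Z1 x)\<^sup>2 + (Z2 x)\<^sup>2 + (Y1 x * Re (W x) + Y2 x * Im (W x))
      + ((p x)\<^sup>2 + N / (1 - N * x\<^sup>2)\<^sup>2) * ((Y1 x)\<^sup>2 + (Y2 x)\<^sup>2) - 2 * p x * (Y1 x * Z1 x + Y2 x * Z2 x))"
  have dQ: "(Q has_real_derivative Q' x) (at x)" if "x \<in> {-b..b}" for x
    unfolding Q_def
    by (rule derivative_eq_intros dY[OF that] dp[OF that] refl)+
       (simp add: Q'_def power2_eq_square algebra_simps)
  \<comment> \<open>Completing the square, \<open>Q'\<close> is the sum of the two squares plus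
    \<open>(N / (1 - N x\<^sup>2)\<^sup>2 - Re A) |y|\<^sup>2\<close>. The last term is nonnegative
    because \<open>N \<ge> 1\<close> makes the comparison coefficient dominate
    \<open>N / (1 - x\<^sup>2)\<^sup>2\<close>.\<close>
  have Q'_ge: "Q' x \<ge> (Z1 x - p x * Y1 x)\<^sup>2 + (Z2 x - p x * Y2 x)\<^sup>2" if "x \<in> {-b..b}" for x
  proof -
    let ?A = "A (of_real x)" and ?y = "f (of_real x)"
    have x: "complex_of_real x \<in> ball 0 1"
      using range(3)[OF that] by simp
    have "W x = - ?A * ?y"
      using f x by (simp add: disc_ode_def W_def eq_neg_iff_add_eq_0)
    then have "Y1 x * Re (W x) + Y2 x * Im (W x) = - Re ?A * ((Y1 x)\<^sup>2 + (Y2 x)\<^sup>2)"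
      by (simp add: Y1_def Y2_def power2_eq_square algebra_simps)
    moreover have "cmod ?A \<le> N / (1 - N * x\<^sup>2)\<^sup>2"
    proof -
      have "(1 - x\<^sup>2)\<^sup>2 * cmod ?A \<le> N"
        using f x unfolding disc_ode_def by fastforce
      then have "cmod ?A \<le> N / (1 - x\<^sup>2)\<^sup>2"
        using range(2)[OF that] by (simp add: field_simps)
      also have "\<dots> \<le> N / (1 - N * x\<^sup>2)\<^sup>2"
        using N range[OF that] mult_right_mono[OF N, of "x\<^sup>2"]
        by (intro divide_left_mono power_mono mult_pos_pos zero_less_power) auto
      finally show ?thesis .
    qed
    moreover have "- Re ?A \<ge> - cmod ?A"
      using abs_Re_le_cmod[of ?A] by linarith
    ultimately have "Y1 x * Re (W x) + Y2 x * Im (W x) \<ge> - (N / (1 - N * x\<^sup>2)\<^sup>2) * ((Y1 x)\<^sup>2 + (Y2 x)\<^sup>2)"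
      by (simp only: ) (intro mult_right_mono, auto)
    then show ?thesis
      unfolding Q'_def by (simp add: power2_eq_square algebra_simps)
  qed
  have Q_mono: "Q x \<le> Q y" if "-b \<le> x" "x \<le> y" "y \<le> b" for x y
  proof (rule DERIV_nonneg_imp_nondecreasing[OF that(2)])
    fix t assume "x \<le> t" "t \<le> y"
    with that have t: "t \<in> {-b..b}" by auto
    have "Q' t \<ge> 0"
      using Q'_ge[OF t] by (smt (verit) zero_le_power2)
    with dQ[OF t] show "\<exists>y. (Q has_real_derivative y) (at t) \<and> 0 \<le> y" by blast
  qed
  have Q_ends: "Q b = 0" "Q (- b) = 0"
    using zeros by (simp_all add: Q_def Y1_def Y2_def)
  have Q0: "Q x = 0" if "x \<in> {-b..b}" for x
    using Q_mono[of "-b" x] Q_mono[of x b] Q_ends that by auto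
  \<comment> \<open>Constancy of \<open>Q\<close> forces equality in the estimate of
    \<open>Q'\<close>, so both squares vanish and \<open>y' = p y\<close>, the equation that
    \<open>v\<close> satisfies.\<close>
  have eq: "Z1 x = p x * Y1 x" "Z2 x = p x * Y2 x" if "x \<in> {-b<..<b}" for x
  proof -
    have "(Q has_real_derivative 0) (at x)"
      by (rule has_field_derivative_transform_within_open[OF _ open_greaterThanLessThan that, of "\<lambda>_. 0"])
         (auto simp: Q0)
    with dQ[of x] have "Q' x = 0"
      using that DERIV_unique by fastforce
    with Q'_ge[of x] that have "(Z1 x - p x * Y1 x)\<^sup>2 + (Z2 x - p x * Y2 x)\<^sup>2 \<le> 0"
      by auto
    then show "Z1 x = p x * Y1 x" "Z2 x = p x * Y2 x"
      by (auto simp: sum_power2_le_zero_iff)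
  qed
  define v where "v = (\<lambda>x. sqrt (1 - N * x\<^sup>2))"
  have v: "v x > 0" "(v has_real_derivative p x * v x) (at x)" if "x \<in> {-b..b}" for x
  proof -
    have pos: "1 - N * x\<^sup>2 > 0"
      using range(1)[OF that] by simp
    then show "v x > 0" by (simp add: v_def)
    have "(v has_real_derivative (- (N * (2 * x))) * (inverse (sqrt (1 - N * x\<^sup>2)) / 2)) (at x)"
      unfolding v_def using pos by (auto intro!: derivative_eq_intros)
    moreover have "(- (N * (2 * x))) * (inverse (sqrt (1 - N * x\<^sup>2)) / 2) = p x * v x"
      using pos by (simp add: p_def v_def field_simps real_sqrt_mult_self flip: real_sqrt_mult)
    ultimately show "(v has_real_derivative p x * v x) (at x)" by simp
  qed
  \<comment> \<open>By \<open>N b\<^sup>2 < 1\<close> the function \<open>v\<close> is positive up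
    to the end points, so \<open>Y / v\<close> is constant on the whole interval and takes the value
    0 at \<open>-b\<close>.\<close>
  have vanish: "Y x = 0" if Y: "\<And>x. x \<in> {-b..b} \<Longrightarrow> (Y has_real_derivative Z x) (at x)"
    "\<And>x. x \<in> {-b<..<b} \<Longrightarrow> Z x = p x * Y x" "Y (- b) = 0" and x: "x \<in> {-b..b}" for Y Z x
  proof -
    have "Y x / v x = Y (- b) / v (- b)"
    proof (rule DERIV_isconst2[where a = "-b" and b = b])
      show "- b < b" using b by simp
      have "((\<lambda>x. Y x / v x) has_real_derivative (Z x * v x - Y x * (p x * v x)) / (v x * v x)) (at x)"
        if "x \<in> {-b..b}" for x
        using v(1)[OF that] by (intro DERIV_divide Y(1) v(2) that) auto
      note d = this
      show "continuous_on {- b..b} (\<lambda>x. Y x / v x)"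
        by (intro continuous_at_imp_continuous_on ballI DERIV_isCont[OF d])
      show "((\<lambda>x. Y x / v x) has_real_derivative 0) (at x)" if "- b < x" "x < b" for x
        using d[of x] Y(2)[of x] that by simp
    qed (use x in auto)
    then show ?thesis
      using Y(3) v(1)[OF x] by simp
  qed
  have Y0: "f (of_real x) = 0" if "x \<in> {-b..b}" for x
  proof -
    have "Y1 x = 0"
      by (rule vanish[OF dY(1) eq(1) _ that]) (use zeros in \<open>simp_all add: Y1_def\<close>)
    moreover have "Y2 x = 0"
      by (rule vanish[OF dY(2) eq(2) _ that]) (use zeros in \<open>simp_all add: Y2_def\<close>)
    ultimately show ?thesis
      by (simp add: Y1_def Y2_def complex_eq_iff)
  qed
  have lim: "0 islimpt (complex_of_real ` {0<..b})"
    unfolding islimpt_sequential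
  proof (intro exI conjI allI)
    fix n :: nat
    show "complex_of_real (b / of_nat (Suc n)) \<in> complex_of_real ` {0<..b} - {0}"
    proof -
      have "b / of_nat (Suc n) \<in> {0<..b}"
        using b by (auto simp: field_simps)
      then show ?thesis
        using b by (intro DiffI imageI) (auto simp del: of_nat_Suc)
    qed
    show "(\<lambda>n. complex_of_real (b / of_nat (Suc n))) \<longlonglongrightarrow> 0"
      unfolding of_real_0[symmetric, where 'a = complex] tendsto_of_real_iff
      by (rule LIMSEQ_Suc[OF lim_const_over_n])
  qed
  show ?thesis
  proof
    fix z :: complex assume "z \<in> ball 0 1"
    then show "f z = 0"
      by (intro analytic_continuation[OF hf _ _ _ _ lim, of z])
         (use range(3)[of b] b Y0 in auto)
  qed
qed


text \<open>One automorphism takes \<open>z1\<close> to 0 and \<open>z2\<close> to a point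
  \<open>c > 0\<close>; a second one takes the hyperbolic midpoint \<open>b\<close> of 0 and
  \<open>c\<close> to 0, so that the zeros become \<open>-b\<close> and \<open>b\<close>. Here
  \<open>2 b / (1 + b\<^sup>2) = c\<close>, and the critical value \<open>b = 1 / sqrt N\<close> of
  the symmetric case corresponds to \<open>c = 2 sqrt N / (N + 1)\<close>.\<close>

lemma disc_ode_zeros_far:
  assumes f: "disc_ode N A f" and N: "N \<ge> 1" and nz: "\<exists>z\<in>ball 0 1. f z \<noteq> 0"
    and z: "cmod z1 < 1" "cmod z2 < 1" "z1 \<noteq> z2" "f z1 = 0" "f z2 = 0"
  shows "pseudohyp z1 z2 \<ge> 2 * sqrt N / (N + 1)"
proof (rule ccontr)
  assume less: "\<not> ?thesis"
  define c where "c = pseudohyp z1 z2"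
  have c: "0 < c" "c < 1"
    using pseudohyp_less_1[OF z(1,2)] pseudohyp_eq_0_iff[OF z(1,2)] z(3) pseudohyp_nonneg[of z1 z2]
    by (auto simp: c_def less_le)
  \<comment> \<open>The root in \<open>[0, 1]\<close> of the quadratic equation
    \<open>2 b / (1 + b\<^sup>2) = c\<close> is
    \<open>b = (1 - sqrt (1 - c\<^sup>2)) / c\<close>.\<close>
  define w where "w = sqrt (1 - c\<^sup>2)"
  define b where "b = (1 - w) / c"
  have w2: "w\<^sup>2 = 1 - c\<^sup>2"
    using c by (simp add: w_def power_le_one)
  have w: "0 < w" "w < 1"
    using c by (simp_all add: w_def abs_square_less_1)
  have b2: "b\<^sup>2 = (1 - w) / (1 + w)"
  proof -
    have "c\<^sup>2 = (1 - w) * (1 + w)"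
      using w2 by (simp add: power2_eq_square algebra_simps)
    then have "b\<^sup>2 = ((1 - w) * (1 - w)) / ((1 - w) * (1 + w))"
      unfolding b_def power_divide by (simp add: power2_eq_square)
    then show ?thesis
      using w by simp
  qed
  have b: "b > 0" "b < 1"
  proof -
    show "b > 0" using w c by (simp add: b_def)
    have "b\<^sup>2 < 1"
      unfolding b2 using w by simp
    then show "b < 1"
      by (simp add: abs_square_less_1)
  qed
  have bc: "2 * b / (1 + b\<^sup>2) = c"
  proof -
    have "1 + b\<^sup>2 = 2 / (1 + w)"
      unfolding b2 using w by (simp add: field_simps)
    then have "2 * b / (1 + b\<^sup>2) = 2 * b / (2 / (1 + w))"
      by (rule arg_cong)
    also have "\<dots> = b * (1 + w)"
      by simp
    also have "\<dots> = ((1 - w) * (1 + w)) / c"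
      unfolding b_def by simp
    also have "(1 - w) * (1 + w) = 1 - w\<^sup>2"
      by (simp add: power2_eq_square algebra_simps)
    also have "(1 - w\<^sup>2) / c = c"
      unfolding w2 using c by (simp add: power2_eq_square)
    finally show ?thesis .
  qed
  \<comment> \<open>The function \<open>2 x / (1 + x\<^sup>2)\<close> increases on
    \<open>[0, 1]\<close> and equals \<open>2 sqrt N / (N + 1)\<close> at
    \<open>x = 1 / sqrt N\<close>. The product \<open>(sqrt N * b - 1) * (sqrt N - b)\<close>
    carries out this comparison at \<open>b\<close>.\<close>
  have Nb: "N * b\<^sup>2 < 1"
  proof (rule ccontr)
    assume "\<not> N * b\<^sup>2 < 1"
    then have "1 \<le> (sqrt N * b)\<^sup>2"
      using N by (simp add: power_mult_distrib)
    then have "1\<^sup>2 \<le> (sqrt N * b)\<^sup>2"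
      by simp
    then have "1 \<le> sqrt N * b"
      by (rule power2_le_imp_le) (use N b in auto)
    moreover have "b \<le> sqrt N"
      using N b real_sqrt_ge_one[OF N] by linarith
    ultimately have "0 \<le> (sqrt N * b - 1) * (sqrt N - b)"
      by simp
    also have "\<dots> = b * (N + 1) - sqrt N * (1 + b\<^sup>2)"
      using N by (simp add: power2_eq_square algebra_simps)
    finally have "2 * sqrt N * (1 + b\<^sup>2) \<le> 2 * b * (N + 1)" by simp
    then have "2 * sqrt N / (N + 1) \<le> 2 * b / (1 + b\<^sup>2)"
    proof -
      have "1 + b\<^sup>2 > 0"
        by (simp add: add_pos_nonneg)
      with \<open>2 * sqrt N * (1 + b\<^sup>2) \<le> 2 * b * (N + 1)\<close> show ?thesis
        using N by (subst frac_le_eq) (auto simp: divide_le_0_iff)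
    qed
    with less bc show False by (simp add: c_def)
  qed
  define u where "u = moebius z1 z2 / of_real c"
  have u: "cmod u = 1"
    using c cmod_moebius[of z1 z2] pseudohyp_commute[of z1 z2] by (simp add: u_def norm_divide c_def)
  obtain B g where g: "disc_ode N B g"
    "\<forall>z. cmod z < 1 \<longrightarrow> f ((u * z + z1) / (1 + cnj z1 * u * z)) = 0 \<longrightarrow> g z = 0"
    "(\<forall>z\<in>ball 0 1. g z = 0) \<longrightarrow> (\<forall>z\<in>ball 0 1. f z = 0)"
    using disc_ode_moebius[OF f z(1) u] by blast
  have uc: "u * of_real c = moebius z1 z2"
    using c by (simp add: u_def)
  have g0: "g 0 = 0"
    using g(2)[rule_format, of 0] z by simp
  have gc: "g (of_real c) = 0"
    using c z moebius_inverse[OF z(1,2)] by (intro g(2)[rule_format]) (auto simp: mult.assoc uc)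
  obtain B' h where h: "disc_ode N B' h"
    "\<forall>z. cmod z < 1 \<longrightarrow> g ((1 * z + of_real b) / (1 + cnj (of_real b) * 1 * z)) = 0 \<longrightarrow> h z = 0"
    "(\<forall>z\<in>ball 0 1. h z = 0) \<longrightarrow> (\<forall>z\<in>ball 0 1. g z = 0)"
  proof -
    have "cmod (of_real b) < 1" "cmod 1 = 1"
      using b by simp_all
    from disc_ode_moebius[OF g(1) this] show ?thesis
      using that by blast
  qed
  have eqc: "(1 * complex_of_real b + of_real b) / (1 + cnj (of_real b) * 1 * of_real b) = of_real c"
    unfolding bc[symmetric] by (simp add: power2_eq_square)
  have eq0: "(1 * complex_of_real (- b) + of_real b) / (1 + cnj (of_real b) * 1 * of_real (- b)) = 0"
    by simp
  have "h (of_real b) = 0"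
    by (rule h(2)[rule_format]) (use b gc in \<open>simp_all only: eqc\<close>, simp)
  moreover have "h (of_real (- b)) = 0"
    by (rule h(2)[rule_format]) (use b g0 in \<open>simp_all only: eq0\<close>, simp)
  ultimately have "\<forall>z\<in>ball 0 1. h z = 0"
    by (intro disc_ode_symmetric_zeros[OF h(1) N b(1) Nb])
  with h(3) g(3) nz show False by blast
qed

text \<open>Uniqueness for the initial value problem: by the Leibniz rule the equation expresses the
  derivative of order \<open>n + 2\<close> through those of order at most \<open>n\<close>, so a
  double zero makes every derivative vanish there. It is needed because terms of a zero sequence are
  repeated according to multiplicity.\<close>

lemma disc_ode_zero_simple:
  assumes f: "disc_ode N A f" and A: "A holomorphic_on ball 0 1"
    and nz: "\<exists>z\<in>ball 0 1. f z \<noteq> 0" and w: "w \<in> ball 0 1" "f w = 0"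
  shows "deriv f w \<noteq> 0"
proof
  assume d: "deriv f w = 0"
  have hf: "f holomorphic_on ball 0 1"
    using f by (simp add: disc_ode_def)
  have rec: "(deriv ^^ (n + 2)) f w = - (\<Sum>i=0..n. of_nat (n choose i) * (deriv ^^ i) A w * (deriv ^^ (n - i)) f w)" for n
  proof -
    have "(deriv ^^ (n + 2)) f w = (deriv ^^ n) (deriv (deriv f)) w"
      by (simp only: funpow_add o_apply) (simp add: numeral_2_eq_2)
    also have "\<dots> = (deriv ^^ n) (\<lambda>z. - (A z * f z)) w"
    proof (rule higher_deriv_transform_within_open[of _ "ball 0 1"])
      show "deriv (deriv f) z = - (A z * f z)" if "z \<in> ball 0 1" for z
        using f that by (simp add: disc_ode_def eq_neg_iff_add_eq_0)
    qed (use hf A w in \<open>auto intro!: holomorphic_intros holomorphic_deriv\<close>)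
    also have "\<dots> = - (deriv ^^ n) (\<lambda>z. A z * f z) w"
      using hf A w by (intro higher_deriv_uminus[of _ "ball 0 1"]) (auto intro!: holomorphic_intros)
    also have "(deriv ^^ n) (\<lambda>z. A z * f z) w = (\<Sum>i=0..n. of_nat (n choose i) * (deriv ^^ i) A w * (deriv ^^ (n - i)) f w)"
      by (rule higher_deriv_mult[OF A hf open_ball w(1)])
    finally show ?thesis .
  qed
  have "(deriv ^^ n) f w = 0" for n
  proof (induction n rule: less_induct)
    case (less n)
    consider "n = 0" | "n = 1" | m where "n = m + 2"
      by (metis One_nat_def add_2_eq_Suc' not0_implies_Suc)
    then show ?case
    proof cases
      case 3
      show ?thesis
        unfolding 3 rec using less 3 by (simp add: sum.neutral)
    qed (use w d in auto)
  qed
  then have "f z = 0" if "z \<in> ball 0 1" for z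
    using holomorphic_fun_eq_0_on_connected[OF hf open_ball connected_ball _ w(1) that] by simp
  with nz show False by blast
qed

section \<open>The density of a hyperbolic packing\<close>

text \<open>
  \<open>ball (disc_centre q a) (disc_radius q a)\<close> is the pseudo-hyperbolic disc of radius \<open>q\<close> about \<open>a\<close>.
\<close>

definition disc_centre :: "real \<Rightarrow> complex \<Rightarrow> complex" where
  "disc_centre q a = of_real ((1 - q\<^sup>2) / (1 - q\<^sup>2 * (cmod a)\<^sup>2)) * a"

definition disc_radius :: "real \<Rightarrow> complex \<Rightarrow> real" where
  "disc_radius q a = q * (1 - (cmod a)\<^sup>2) / (1 - q\<^sup>2 * (cmod a)\<^sup>2)"

context
  fixes q :: real and a :: complex
  assumes q: "0 < q" "q < 1" and a: "cmod a < 1"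
begin

lemma disc_denominator_pos: "0 < 1 - q\<^sup>2 * (cmod a)\<^sup>2" "0 < 1 - q\<^sup>2" "0 < 1 - (cmod a)\<^sup>2"
proof -
  show 1: "0 < 1 - q\<^sup>2" using q by (simp add: abs_square_less_1)
  show 2: "0 < 1 - (cmod a)\<^sup>2" using a by (simp add: abs_square_less_1)
  have "q\<^sup>2 * (cmod a)\<^sup>2 \<le> q\<^sup>2 * 1"
    using 2 by (intro mult_left_mono) auto
  then show "0 < 1 - q\<^sup>2 * (cmod a)\<^sup>2" using 1 by simp
qed

lemma disc_radius_ge: "disc_radius q a \<ge> q * (1 - (cmod a)\<^sup>2)"
proof -
  have "q * (1 - (cmod a)\<^sup>2) / 1 \<le> q * (1 - (cmod a)\<^sup>2) / (1 - q\<^sup>2 * (cmod a)\<^sup>2)"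
    using q disc_denominator_pos by (intro divide_left_mono) auto
  then show ?thesis by (simp add: disc_radius_def)
qed

lemma cmod_disc_centre: "cmod (disc_centre q a) = (1 - q\<^sup>2) * cmod a / (1 - q\<^sup>2 * (cmod a)\<^sup>2)"
  unfolding disc_centre_def norm_mult norm_of_real using disc_denominator_pos by simp

text \<open>The radius on the right is the modulus of the point farthest from 0; the triangle
  inequality is exact there because this point lies on the ray through \<open>a\<close>.\<close>

lemma disc_subset_ball:
  "ball (disc_centre q a) (disc_radius q a) \<subseteq> ball 0 ((cmod a + q) / (1 + q * cmod a))"
proof
  fix z assume "z \<in> ball (disc_centre q a) (disc_radius q a)"
  then have "cmod z < cmod (disc_centre q a) + disc_radius q a"
    using norm_triangle_sub[of z "disc_centre q a"] by (simp add: dist_norm norm_minus_commute)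
  also have "\<dots> = ((1 - q\<^sup>2) * cmod a + q * (1 - (cmod a)\<^sup>2)) / (1 - q\<^sup>2 * (cmod a)\<^sup>2)"
    unfolding cmod_disc_centre disc_radius_def by (simp add: add_divide_distrib)
  also have "(1 - q\<^sup>2) * cmod a + q * (1 - (cmod a)\<^sup>2) = (cmod a + q) * (1 - q * cmod a)"
    by (simp add: power2_eq_square algebra_simps)
  also have "1 - q\<^sup>2 * (cmod a)\<^sup>2 = (1 + q * cmod a) * (1 - q * cmod a)"
    by (simp add: power2_eq_square algebra_simps)
  also have "(cmod a + q) * (1 - q * cmod a) / ((1 + q * cmod a) * (1 - q * cmod a)) = (cmod a + q) / (1 + q * cmod a)"
  proof -
    have "q * cmod a < 1 * 1"
      using q a by (intro mult_strict_mono') auto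
    then show ?thesis by simp
  qed
  finally show "z \<in> ball 0 ((cmod a + q) / (1 + q * cmod a))"
    by simp
qed

text \<open>With \<open>k = 1 - q\<^sup>2 |a|\<^sup>2\<close>, centre \<open>c\<close> and radius
  \<open>R\<close>, the quadratic forms agree: \<open>k (|z - c|\<^sup>2 - R\<^sup>2) = |z -
  a|\<^sup>2 - q\<^sup>2 |1 - cnj z a|\<^sup>2\<close>.\<close>

lemma pseudohyp_less_of_mem_disc:
  assumes "z \<in> ball (disc_centre q a) (disc_radius q a)" "cmod z < 1"
  shows "pseudohyp z a < q"
proof -
  define k where "k = 1 - q\<^sup>2 * (cmod a)\<^sup>2"
  define t where "t = (1 - q\<^sup>2) / k"
  have k: "k > 0" using disc_denominator_pos by (simp add: k_def)
  have kt: "k * t = 1 - q\<^sup>2" using k by (simp add: t_def)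
  have kR: "k * disc_radius q a = q * (1 - (cmod a)\<^sup>2)"
    using k by (simp add: disc_radius_def flip: k_def)
  have "k * (k * ((cmod (z - of_real t * a))\<^sup>2 - (disc_radius q a)\<^sup>2)) =
      k * k * (cmod z)\<^sup>2 - 2 * k * (k * t) * Re (cnj a * z) + (k * t)\<^sup>2 * (cmod a)\<^sup>2 - (k * disc_radius q a)\<^sup>2"
    unfolding cmod_power2 by (simp add: power2_eq_square algebra_simps)
  also have "\<dots> = k * (k * (cmod z)\<^sup>2 - 2 * (1 - q\<^sup>2) * Re (cnj a * z) + (cmod a)\<^sup>2 - q\<^sup>2)"
    unfolding kt kR by (simp add: k_def power2_eq_square algebra_simps)
  also have "k * (cmod z)\<^sup>2 - 2 * (1 - q\<^sup>2) * Re (cnj a * z) + (cmod a)\<^sup>2 - q\<^sup>2 =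
      (cmod (z - a))\<^sup>2 - q\<^sup>2 * (cmod (1 - cnj z * a))\<^sup>2"
    unfolding cmod_power2 k_def by (simp add: power2_eq_square algebra_simps)
  finally have eq: "k * ((cmod (z - of_real t * a))\<^sup>2 - (disc_radius q a)\<^sup>2) =
      (cmod (z - a))\<^sup>2 - q\<^sup>2 * (cmod (1 - cnj z * a))\<^sup>2"
    using k by simp
  have "cmod (z - of_real t * a) < disc_radius q a"
    using assms(1) by (simp add: disc_centre_def dist_norm norm_minus_commute t_def k_def)
  then have "(cmod (z - of_real t * a))\<^sup>2 < (disc_radius q a)\<^sup>2"
    by (intro power_strict_mono) auto
  then have "k * ((cmod (z - of_real t * a))\<^sup>2 - (disc_radius q a)\<^sup>2) < 0"
    using k by (simp add: mult_less_0_iff)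
  then have "(cmod (z - a))\<^sup>2 < (q * cmod (1 - cnj z * a))\<^sup>2"
    unfolding eq by (simp add: power_mult_distrib)
  then have "cmod (z - a) < q * cmod (1 - cnj z * a)"
    by (rule power2_less_imp_less) (use q in auto)
  then show ?thesis
    using cmod_one_minus_cnj_mult_pos[OF assms(2) a] by (simp add: pseudohyp_def field_simps)
qed

lemma disc_radius_sq_div:
  "(disc_radius q a)\<^sup>2 / (1 - (cmod (disc_centre q a))\<^sup>2) = q\<^sup>2 * (1 - (cmod a)\<^sup>2) / (1 - q ^ 4 * (cmod a)\<^sup>2)"
proof -
  define h k where "h = (cmod a)\<^sup>2" and "k = 1 - q\<^sup>2 * (cmod a)\<^sup>2"
  have k: "k > 0" and h: "1 - h > 0" using disc_denominator_pos by (simp_all add: k_def h_def)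
  have "1 - (cmod (disc_centre q a))\<^sup>2 = (k\<^sup>2 - (1 - q\<^sup>2)\<^sup>2 * h) / k\<^sup>2"
    unfolding cmod_disc_centre k_def[symmetric] using k by (simp add: power_mult_distrib power_divide diff_divide_distrib h_def)
  also have "k\<^sup>2 - (1 - q\<^sup>2)\<^sup>2 * h = (1 - h) * (1 - q ^ 4 * h)"
    unfolding k_def h_def[symmetric] by (simp add: power2_eq_square power4_eq_xxxx algebra_simps)
  finally have 1: "1 - (cmod (disc_centre q a))\<^sup>2 = (1 - h) * (1 - q ^ 4 * h) / k\<^sup>2" .
  have 2: "(disc_radius q a)\<^sup>2 = q\<^sup>2 * (1 - h) * (1 - h) / k\<^sup>2"
    unfolding disc_radius_def h_def[symmetric] k_def by (simp add: power_divide power_mult_distrib power2_eq_square)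
  show ?thesis
    unfolding 1 2 h_def[symmetric] using h k by simp
qed

text \<open>The first term on the right equals \<open>(1 - |a|\<^sup>2) / 2\<close> times
  \<open>(1 - q ^ 4) / (1 - q ^ 4 |a|\<^sup>2)\<close>, a quotient that tends to 1 at the boundary.
  The deviation is of second order in \<open>1 - |a|\<^sup>2\<close>, comparable to the area of the
  disc, and so has bounded sum over disjoint discs.\<close>

lemma one_minus_cmod_le_disc:
  "1 - cmod a \<le> (1 - q ^ 4) / (2 * q\<^sup>2) * ((disc_radius q a)\<^sup>2 / (1 - (cmod (disc_centre q a))\<^sup>2))
     + (1 / (1 - q ^ 4) + 1) * (1 - (cmod a)\<^sup>2)\<^sup>2"
proof -
  define h where "h = (cmod a)\<^sup>2"
  have h: "0 < 1 - h" "0 \<le> h" using disc_denominator_pos by (simp_all add: h_def)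
  have q4: "0 < q ^ 4" "q ^ 4 < 1" using q by (auto simp: power_less_one_iff)
  have q4h: "1 - q ^ 4 * h \<ge> 1 - q ^ 4"
    using mult_left_mono[of h 1 "q ^ 4"] h q4 by simp
  have "(1 - h) - (1 - q ^ 4) * (1 - h) / (1 - q ^ 4 * h) = q ^ 4 * (1 - h)\<^sup>2 / (1 - q ^ 4 * h)"
  proof -
    define y where "y = 1 - q ^ 4 * h"
    have y: "y > 0" "1 - q ^ 4 = y - q ^ 4 * (1 - h)"
    proof -
      show "y > 0" using q4h q4 unfolding y_def by linarith
      show "1 - q ^ 4 = y - q ^ 4 * (1 - h)" by (simp add: y_def algebra_simps)
    qed
    show ?thesis
      unfolding y(2) y_def[symmetric] using y(1) by (simp add: field_simps power2_eq_square)
  qed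
  also have "\<dots> \<le> 1 * (1 - h)\<^sup>2 / (1 - q ^ 4)"
  proof (intro frac_le mult_right_mono)
    show "0 < 1 - q ^ 4" "1 - q ^ 4 \<le> 1 - q ^ 4 * h" "q ^ 4 \<le> 1" "0 \<le> 1 * (1 - h)\<^sup>2"
      using q4 q4h by auto
  qed simp
  finally have 1: "1 - h \<le> (1 - q ^ 4) * (1 - h) / (1 - q ^ 4 * h) + (1 - h)\<^sup>2 / (1 - q ^ 4)"
    by simp
  have "1 - cmod a \<le> 1 - h"
    using a unfolding h_def power2_eq_square by (simp add: mult_left_le)
  then have "(1 - cmod a)\<^sup>2 \<le> (1 - h)\<^sup>2"
    using a by (intro power_mono) auto
  moreover have "1 - cmod a = (1 - h) / 2 + (1 - cmod a)\<^sup>2 / 2"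
    by (simp add: h_def power2_diff add_divide_distrib diff_divide_distrib)
  moreover have "(1 - h)\<^sup>2 \<ge> 0" by simp
  ultimately have "1 - cmod a \<le> (1 - h) / 2 + (1 - h)\<^sup>2"
    by linarith
  also have "\<dots> \<le> ((1 - q ^ 4) * (1 - h) / (1 - q ^ 4 * h)) / 2 + (1 / (1 - q ^ 4) + 1) * (1 - h)\<^sup>2"
  proof -
    have "(1 - h)\<^sup>2 / (1 - q ^ 4) \<ge> 0" using q4 by simp
    moreover have "(1 / (1 - q ^ 4) + 1) * (1 - h)\<^sup>2 = (1 - h)\<^sup>2 / (1 - q ^ 4) + (1 - h)\<^sup>2"
      by (simp add: distrib_right)
    moreover have "x / 2 + e \<le> X / 2 + (U + e)" if "0 \<le> U" "x \<le> X + U" for x e X U :: real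
      using that by linarith
    ultimately show ?thesis using 1 by metis
  qed
  also have "((1 - q ^ 4) * (1 - h) / (1 - q ^ 4 * h)) / 2 =
      (1 - q ^ 4) / (2 * q\<^sup>2) * ((disc_radius q a)\<^sup>2 / (1 - (cmod (disc_centre q a))\<^sup>2))"
    unfolding disc_radius_sq_div h_def[symmetric] using q by simp
  finally show ?thesis unfolding h_def .
qed

end

section \<open>Area integrals over disjoint discs\<close>

lemma emeasure_lborel_ball_complex:
  fixes c :: complex
  shows "r \<ge> 0 \<Longrightarrow> emeasure lborel (ball c r) = ennreal (pi * r\<^sup>2)"
  by (simp add: emeasure_ball unit_ball_vol_2)

lemma nn_integral_lborel_reflect:
  fixes f :: "complex \<Rightarrow> ennreal"
  assumes [measurable]: "f \<in> borel_measurable borel"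
  shows "(\<integral>\<^sup>+ z. f (2 * c - z) \<partial>lborel) = (\<integral>\<^sup>+ z. f z \<partial>lborel)"
proof -
  have eq: "lborel = distr lborel borel (\<lambda>z::complex. 2 * c - z)"
    using lborel_affine[of "-1" "2 * c"] by (simp add: density_1)
  show ?thesis
    by (subst (2) eq) (simp add: nn_integral_distr)
qed

text \<open>Convexity of \<open>1 / (1 - |z|\<^sup>2)\<close>, averaged over pairs of points symmetric about the centre.\<close>

lemma nn_integral_ball_ge:
  fixes c :: complex
  assumes sub: "ball c R \<subseteq> ball 0 1" and R: "R > 0"
  shows "ennreal (pi * (R\<^sup>2 / (1 - (cmod c)\<^sup>2))) \<le>
    (\<integral>\<^sup>+ z. ennreal (1 / (1 - (cmod z)\<^sup>2)) * indicator (ball c R) z \<partial>lborel)"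
proof -
  define f where "f = (\<lambda>z::complex. ennreal (1 / (1 - (cmod z)\<^sup>2)) * indicator (ball c R) z)"
  have [measurable]: "ball c R \<in> sets borel" by simp
  have [measurable]: "f \<in> borel_measurable borel"
    unfolding f_def by measurable
  define C where "C = 1 / (1 - (cmod c)\<^sup>2)"
  have c: "c \<in> ball c R" using R by simp
  then have "c \<in> ball 0 1" using sub by blast
  then have c1: "cmod c < 1" by simp
  have "C > 0" using one_minus_cmod_sq_pos[OF c1] by (simp add: C_def)
  have pt: "ennreal (2 * C) * indicator (ball c R) z \<le> f z + f (2 * c - z)" for z
  proof (cases "z \<in> ball c R")
    case True
    define w where "w = 2 * c - z"
    have "dist c w = dist c z"
      by (simp add: w_def dist_norm norm_minus_commute)
    with True have w: "w \<in> ball c R" by simp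
    \<comment> \<open>This is the tangent line of \<open>1 / (1 - t)\<close> at
      \<open>t = |c|\<^sup>2\<close>, evaluated at \<open>t = |v|\<^sup>2\<close>. The linear terms
      for the two reflected points add up to something nonnegative by the parallelogram law.\<close>
    have tangent: "1 / (1 - (cmod v)\<^sup>2) \<ge> C + C\<^sup>2 * ((cmod v)\<^sup>2 - (cmod c)\<^sup>2)" if "v \<in> ball c R" for v
    proof -
      define x y where "x = 1 - (cmod v)\<^sup>2" and "y = 1 - (cmod c)\<^sup>2"
      have xy: "x > 0" "y > 0"
        using that sub c1 one_minus_cmod_sq_pos[of v] one_minus_cmod_sq_pos[of c] by (auto simp: x_def y_def)
      have "1 / x - (1 / y + (1 / y)\<^sup>2 * (y - x)) = (y - x)\<^sup>2 / (x * y\<^sup>2)"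
        using xy by (simp add: field_simps power2_eq_square)
      also have "\<dots> \<ge> 0" using xy by simp
      finally show ?thesis by (simp add: x_def y_def C_def)
    qed
    have "(cmod z)\<^sup>2 + (cmod w)\<^sup>2 - 2 * (cmod c)\<^sup>2 = 2 * (cmod (z - c))\<^sup>2"
      unfolding w_def cmod_power2 by (simp add: power2_eq_square algebra_simps)
    then have "C\<^sup>2 * ((cmod z)\<^sup>2 - (cmod c)\<^sup>2) + C\<^sup>2 * ((cmod w)\<^sup>2 - (cmod c)\<^sup>2) = C\<^sup>2 * (2 * (cmod (z - c))\<^sup>2)"
      unfolding distrib_left[symmetric] by (intro arg_cong[of _ _ "\<lambda>x. C\<^sup>2 * x"]) simp
    also have "\<dots> \<ge> 0" by simp
    finally have "2 * C \<le> 1 / (1 - (cmod z)\<^sup>2) + 1 / (1 - (cmod w)\<^sup>2)"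
      using tangent[OF True] tangent[OF w] by linarith
    moreover have "cmod z < 1" "cmod w < 1" using True w sub by auto
    ultimately have "ennreal (2 * C) \<le> ennreal (1 / (1 - (cmod z)\<^sup>2)) + ennreal (1 / (1 - (cmod w)\<^sup>2))"
      using one_minus_cmod_sq_pos[of z] one_minus_cmod_sq_pos[of w] \<open>C > 0\<close>
      by (subst ennreal_plus[symmetric]) (auto simp del: ennreal_plus intro!: ennreal_leI)
    then show ?thesis
      using True w by (simp add: f_def flip: w_def)
  qed simp
  have "ennreal (2 * C) * emeasure lborel (ball c R) = (\<integral>\<^sup>+ z. ennreal (2 * C) * indicator (ball c R) z \<partial>lborel)"
    by (subst nn_integral_cmult_indicator) auto
  also have "\<dots> \<le> (\<integral>\<^sup>+ z. f z + f (2 * c - z) \<partial>lborel)"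
    by (intro nn_integral_mono pt)
  also have "\<dots> = (\<integral>\<^sup>+ z. f z \<partial>lborel) + (\<integral>\<^sup>+ z. f (2 * c - z) \<partial>lborel)"
    by (intro nn_integral_add) measurable
  also have "\<dots> = 2 * (\<integral>\<^sup>+ z. f z \<partial>lborel)"
    by (subst nn_integral_lborel_reflect) (auto simp: mult_2)
  finally have "2 * (ennreal C * emeasure lborel (ball c R)) \<le> 2 * (\<integral>\<^sup>+ z. f z \<partial>lborel)"
    using \<open>C > 0\<close> by (simp add: ennreal_mult' mult.assoc)
  then have "ennreal C * emeasure lborel (ball c R) \<le> (\<integral>\<^sup>+ z. f z \<partial>lborel)"
    by (subst (asm) ennreal_mult_le_mult_iff) auto
  moreover have "ennreal C * emeasure lborel (ball c R) = ennreal (pi * (R\<^sup>2 / (1 - (cmod c)\<^sup>2)))"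
    using R \<open>C > 0\<close> by (subst emeasure_lborel_ball_complex) (auto simp: C_def simp flip: ennreal_mult' intro!: arg_cong[of _ _ ennreal])
  ultimately show ?thesis by (simp add: f_def)
qed

text \<open>The exact value is \<open>pi * ln (1 / (1 - s\<^sup>2))\<close>. The nested rings
  \<open>E j\<close>, where \<open>1 - |z|\<^sup>2 \<le> 1 / 2 ^ j\<close>, have area
  \<open>pi / 2 ^ j\<close> and receive weight \<open>2 ^ j\<close>, so each contributes
  \<open>pi\<close>; about \<open>log 2 (1 / (1 - s\<^sup>2))\<close> of them meet
  \<open>ball 0 s\<close>. The rounding costs the factor \<open>1 / ln 2\<close>.\<close>

lemma nn_integral_disc_le:
  assumes s: "0 \<le> s" "s < 1"
  shows "(\<integral>\<^sup>+ z. ennreal (1 / (1 - (cmod z)\<^sup>2)) * indicator (ball 0 s) z \<partial>lborel) \<le>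
    ennreal (pi * (2 + log 2 (1 / (1 - s\<^sup>2))))"
proof -
  have s2: "0 < 1 - s\<^sup>2" using s by (simp add: abs_square_less_1)
  define L where "L = log 2 (1 / (1 - s\<^sup>2))"
  have L: "L \<ge> 0" using s2 by (simp add: L_def)
  define K where "K = nat \<lfloor>L\<rfloor>"
  define E where "E = (\<lambda>j::nat. ball (0::complex) 1 - ball 0 (sqrt (1 - 1 / 2 ^ j)))"
  have pt: "ennreal (1 / (1 - (cmod z)\<^sup>2)) * indicator (ball 0 s) z \<le>
      2 * indicator (ball 0 1) z + (\<Sum>j=1..K. ennreal (2 ^ j) * indicator (E j) z)" for z :: complex
  proof (cases "z \<in> ball 0 s")
    case True
    define x where "x = 1 - (cmod z)\<^sup>2"
    have z1: "cmod z < 1" "cmod z < s" using True s by auto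
    have "(cmod z)\<^sup>2 < s\<^sup>2" using z1 by (intro power_strict_mono) auto
    then have x: "0 < x" "x \<le> 1" "1 - s\<^sup>2 < x"
      using one_minus_cmod_sq_pos[OF z1(1)] by (auto simp: x_def)
    define k where "k = nat \<lfloor>log 2 (1 / x)\<rfloor>"
    have lx: "log 2 (1 / x) \<ge> 0" using x by simp
    have k: "real k \<le> log 2 (1 / x)" "log 2 (1 / x) < real k + 1"
      using lx by (simp_all add: k_def)
    have k2: "2 ^ k \<le> 1 / x" "1 / x < 2 ^ (k + 1)"
    proof -
      have "2 ^ k = 2 powr real k" by (simp add: powr_realpow)
      also have "\<dots> \<le> 2 powr log 2 (1 / x)" using k by (intro powr_mono) auto
      finally show "2 ^ k \<le> 1 / x" using x by simp
      have "1 / x = 2 powr log 2 (1 / x)" using x by simp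
      also have "\<dots> < 2 powr (real (k + 1))" using k by (intro powr_less_mono) auto
      finally show "1 / x < 2 ^ (k + 1)" by (simp only: powr_realpow)
    qed
    have "log 2 (1 / x) \<le> L"
      unfolding L_def using x s2 by (subst log_le_cancel_iff) (auto intro!: divide_left_mono mult_pos_pos)
    then have kK: "k \<le> K"
      unfolding k_def K_def by (intro nat_mono floor_mono)
    have mem: "z \<in> E j" if "j \<in> {1..k}" for j
    proof -
      have "(2::real) ^ j \<le> 2 ^ k" using that by (intro power_increasing) auto
      then have "2 ^ j \<le> 1 / x" using k2 by linarith
      then have "x \<le> 1 / 2 ^ j" using x by (simp add: field_simps)
      then have "1 - 1 / 2 ^ j \<le> (cmod z)\<^sup>2" by (simp add: x_def)
      then have "sqrt (1 - 1 / 2 ^ j) \<le> cmod z"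
        using real_sqrt_le_mono by fastforce
      then show ?thesis using z1 by (simp add: E_def)
    qed
    \<comment> \<open>A point in the rings \<open>E 1\<close> to \<open>E k\<close> collects
      \<open>2 + (2 + 4 + \<dots> + 2 ^ k) = 2 ^ (k + 1)\<close>, which exceeds \<open>1 / x\<close>
      by the choice of \<open>k\<close>.\<close>
    have "1 / x \<le> 2 + (\<Sum>j=1..k. 2 ^ j)"
    proof -
      have "2 + (\<Sum>j=1..k. 2 ^ j) = (2::real) ^ (k + 1)"
        by (induction k) auto
      then show ?thesis using k2 by simp
    qed
    also have "(\<Sum>j=1..k. (2::real) ^ j) \<le> (\<Sum>j=1..K. 2 ^ j * indicator (E j) z)"
    proof -
      have "(\<Sum>j=1..k. (2::real) ^ j) = (\<Sum>j=1..k. 2 ^ j * indicator (E j) z)"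
        using mem by (intro sum.cong) auto
      also have "\<dots> \<le> (\<Sum>j=1..K. 2 ^ j * indicator (E j) z)"
        using kK by (intro sum_mono2) auto
      finally show ?thesis .
    qed
    finally have "ennreal (1 / x) \<le> ennreal (2 + (\<Sum>j=1..K. 2 ^ j * indicator (E j) z))"
      by (intro ennreal_leI) simp
    also have "\<dots> = 2 + (\<Sum>j=1..K. ennreal (2 ^ j) * indicator (E j) z)"
      by (subst ennreal_plus) (auto simp: sum_nonneg ennreal_mult' ennreal_indicator simp flip: sum_ennreal)
    finally show ?thesis
      using True z1 by (simp add: x_def)
  qed simp
  have E: "emeasure lborel (E j) = ennreal (pi * (1 / 2 ^ j))" for j
  proof -
    have "emeasure lborel (E j) = emeasure lborel (ball (0::complex) 1) - emeasure lborel (ball (0::complex) (sqrt (1 - 1 / 2 ^ j)))"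
    proof -
      have "sqrt (1 - 1 / 2 ^ j) \<le> 1" by simp
      then have "ball (0::complex) (sqrt (1 - 1 / 2 ^ j)) \<subseteq> ball 0 1" by (rule subset_ball)
      then show ?thesis
        unfolding E_def by (intro emeasure_Diff) (auto simp: emeasure_lborel_ball_complex)
    qed
    also have "\<dots> = ennreal (pi * 1\<^sup>2 - pi * (sqrt (1 - 1 / 2 ^ j))\<^sup>2)"
      by (subst (1 2) emeasure_lborel_ball_complex) (auto intro!: ennreal_minus)
    also have "(sqrt (1 - 1 / 2 ^ j))\<^sup>2 = 1 - 1 / 2 ^ j"
      by simp
    finally show ?thesis by (simp add: algebra_simps)
  qed
  have [measurable]: "ball (0::complex) 1 \<in> sets borel" by simp
  have Em [measurable]: "E j \<in> sets borel" for j
    unfolding E_def by measurable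
  have "(\<integral>\<^sup>+ z. ennreal (1 / (1 - (cmod z)\<^sup>2)) * indicator (ball 0 s) z \<partial>lborel) \<le>
      (\<integral>\<^sup>+ z. 2 * indicator (ball 0 1) z + (\<Sum>j=1..K. ennreal (2 ^ j) * indicator (E j) z) \<partial>(lborel :: complex measure))"
    by (intro nn_integral_mono pt)
  also have "\<dots> = (\<integral>\<^sup>+ z. 2 * indicator (ball 0 1) z \<partial>(lborel :: complex measure))
      + (\<integral>\<^sup>+ z. (\<Sum>j=1..K. ennreal (2 ^ j) * indicator (E j) z) \<partial>lborel)"
    by (intro nn_integral_add) measurable
  also have "(\<integral>\<^sup>+ z. (\<Sum>j=1..K. ennreal (2 ^ j) * indicator (E j) z) \<partial>lborel)
      = (\<Sum>j=1..K. \<integral>\<^sup>+ z. ennreal (2 ^ j) * indicator (E j) z \<partial>lborel)"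
    by (intro nn_integral_sum) measurable
  also have "\<dots> = (\<Sum>j=1..K. ennreal (2 ^ j) * emeasure lborel (E j))"
    by (intro sum.cong refl nn_integral_cmult_indicator) measurable
  also have "(\<integral>\<^sup>+ z. 2 * indicator (ball 0 1) z \<partial>(lborel :: complex measure)) = 2 * emeasure lborel (ball (0::complex) 1)"
    by (intro nn_integral_cmult_indicator) measurable
  also have "(\<Sum>j=1..K. ennreal (2 ^ j) * emeasure lborel (E j)) = (\<Sum>j=1..K. ennreal pi)"
    unfolding E by (intro sum.cong refl) (simp flip: ennreal_mult)
  also have "\<dots> = ennreal (\<Sum>j=1..K. pi)"
    by (rule sum_ennreal) simp
  also have "2 * emeasure lborel (ball (0::complex) 1) = ennreal (2 * pi)"
    by (subst emeasure_lborel_ball_complex) (simp_all add: ennreal_mult')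
  also have "ennreal (2 * pi) + ennreal (\<Sum>j=1..K. pi) = ennreal (2 * pi + (\<Sum>j=1..K. pi))"
    by (rule ennreal_plus[symmetric]) (auto intro: sum_nonneg)
  also have "\<dots> \<le> ennreal (pi * (2 + L))"
  proof (rule ennreal_leI)
    have "real K \<le> L" using L by (simp add: K_def)
    then show "2 * pi + (\<Sum>j=1..K. pi) \<le> pi * (2 + L)" by (simp add: algebra_simps)
  qed
  finally show ?thesis by (simp add: L_def)
qed

lemma sum_nn_integral_disjoint_le:
  fixes W :: "complex \<Rightarrow> ennreal"
  assumes [measurable]: "W \<in> borel_measurable borel" and F: "finite F"
    and disj: "disjoint_family_on B F" and [measurable]: "\<And>i. B i \<in> sets borel"
    and sub: "\<And>i. i \<in> F \<Longrightarrow> B i \<subseteq> U"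
  shows "(\<Sum>i\<in>F. \<integral>\<^sup>+ z. W z * indicator (B i) z \<partial>lborel) \<le> (\<integral>\<^sup>+ z. W z * indicator U z \<partial>lborel)"
proof -
  have "(\<Sum>i\<in>F. \<integral>\<^sup>+ z. W z * indicator (B i) z \<partial>lborel) = (\<integral>\<^sup>+ z. (\<Sum>i\<in>F. W z * indicator (B i) z) \<partial>lborel)"
    by (intro nn_integral_sum[symmetric]) measurable
  also have "\<dots> = (\<integral>\<^sup>+ z. W z * indicator (\<Union>i\<in>F. B i) z \<partial>lborel)"
    by (simp add: indicator_UN_disjoint[OF F disj] sum_distrib_left)
  also have "\<dots> \<le> (\<integral>\<^sup>+ z. W z * indicator U z \<partial>lborel)"
    using sub by (intro nn_integral_mono mult_left_mono) (auto simp: indicator_def)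
  finally show ?thesis .
qed

text \<open>The discs of radius \<open>q\<close> about the points are disjoint and lie in one disc
  about 0. Their masses with respect to \<open>1 / (1 - |z|\<^sup>2)\<close> pay for the main part
  of \<open>1 - |a_i|\<close>, and their Euclidean areas, of total at most \<open>pi\<close>, pay
  for the second-order error.\<close>

lemma packing_bound:
  assumes q: "0 < q" "q < 1"
  shows "\<exists>C. \<forall>F (a :: nat \<Rightarrow> complex) r. finite F \<longrightarrow> 0 < r \<longrightarrow> r < 1 \<longrightarrow> (\<forall>i\<in>F. cmod (a i) < r) \<longrightarrow>
    (\<forall>i\<in>F. \<forall>j\<in>F. i \<noteq> j \<longrightarrow> pseudohyp (a i) (a j) \<ge> 2 * q / (1 + q\<^sup>2)) \<longrightarrow>
    (\<Sum>i\<in>F. 1 - cmod (a i)) \<le> (1 - q ^ 4) / (2 * q\<^sup>2) * (3 / 2) * ln (1 / (1 - r)) + C"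
proof -
  define C1 where "C1 = (1 - q ^ 4) / (2 * q\<^sup>2)"
  define C2 where "C2 = 1 / (1 - q ^ 4) + 1"
  have q4: "0 < q ^ 4" "q ^ 4 < 1" using q by (auto simp: power_less_one_iff)
  have C12: "C1 \<ge> 0" "C2 \<ge> 0" using q4 q by (simp_all add: C1_def C2_def)
  define C where "C = C1 * (2 + 3 / 2 * ln (2 / (1 - q))) + C2 / q\<^sup>2"
  have "(\<Sum>i\<in>F. 1 - cmod (a i)) \<le> (1 - q ^ 4) / (2 * q\<^sup>2) * (3 / 2) * ln (1 / (1 - r)) + C"
    if F: "finite F" and r: "0 < r" "r < 1" and ar: "\<And>i. i \<in> F \<Longrightarrow> cmod (a i) < r"
      and far: "\<And>i j. i \<in> F \<Longrightarrow> j \<in> F \<Longrightarrow> i \<noteq> j \<Longrightarrow> pseudohyp (a i) (a j) \<ge> 2 * q / (1 + q\<^sup>2)"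
    for F and a :: "nat \<Rightarrow> complex" and r
  proof -
    \<comment> \<open>The hyperbolic sum of \<open>r\<close> and \<open>q\<close>:
      \<open>ball 0 s\<close> contains all the discs, and \<open>1 - s\<close> is still comparable
      to \<open>1 - r\<close>, so the logarithm changes only by a constant.\<close>
    define s where "s = (r + q) / (1 + q * r)"
    have "1 + q * r > 0" using q r by (simp add: add_pos_pos)
    then have s: "0 < s" "1 - s = (1 - r) * (1 - q) / (1 + q * r)"
    proof -
      show "0 < s" using q r \<open>1 + q * r > 0\<close> by (simp add: s_def)
      have "1 - s = ((1 + q * r) - (r + q)) / (1 + q * r)"
        unfolding s_def diff_divide_distrib using \<open>1 + q * r > 0\<close> by simp
      also have "(1 + q * r) - (r + q) = (1 - r) * (1 - q)" by (simp add: algebra_simps)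
      finally show "1 - s = (1 - r) * (1 - q) / (1 + q * r)" .
    qed
    have "1 - s > 0" using q r \<open>1 + q * r > 0\<close> unfolding s(2) by simp
    have "q * r \<le> 1" using q r by (simp add: mult_le_one)
    then have s_ge: "1 - s \<ge> (1 - r) * (1 - q) / 2"
      unfolding s(2) using q r \<open>1 + q * r > 0\<close> by (intro divide_left_mono) auto
    define B where "B = (\<lambda>i. ball (disc_centre q (a i)) (disc_radius q (a i)))"
    have a1: "cmod (a i) < 1" if "i \<in> F" for i using ar[OF that] r by simp
    have Bs: "B i \<subseteq> ball 0 s" if "i \<in> F" for i
    proof -
      have "(cmod (a i) + q) / (1 + q * cmod (a i)) \<le> s"
      proof -
        have "(cmod (a i) + q) * (1 + q * r) \<le> (r + q) * (1 + q * cmod (a i))"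
        proof -
          have "(r + q) * (1 + q * cmod (a i)) - (cmod (a i) + q) * (1 + q * r) = (r - cmod (a i)) * (1 - q\<^sup>2)"
            by (simp add: power2_eq_square algebra_simps)
          also have "\<dots> \<ge> 0" using ar[OF that] q by (simp add: power_le_one)
          finally show ?thesis by simp
        qed
        then show ?thesis
        proof -
          have "1 + q * cmod (a i) > 0" using q by (simp add: add_pos_nonneg)
          with \<open>1 + q * r > 0\<close> \<open>(cmod (a i) + q) * (1 + q * r) \<le> (r + q) * (1 + q * cmod (a i))\<close>
          have "cmod (a i) + q \<le> (r + q) * (1 + q * cmod (a i)) / (1 + q * r)"
            by (subst pos_le_divide_eq) simp_all
          also have "\<dots> = s * (1 + q * cmod (a i))"
            by (simp add: s_def)
          finally show ?thesis
            using \<open>1 + q * cmod (a i) > 0\<close> by (subst pos_divide_le_eq) simp_all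
        qed
      qed
      then show ?thesis
        unfolding B_def by (intro order_trans[OF disc_subset_ball[OF q a1[OF that]]] subset_ball)
    qed
    have B1: "B i \<subseteq> ball 0 1" if "i \<in> F" for i
      using Bs[OF that] \<open>1 - s > 0\<close> by auto
    have R: "disc_radius q (a i) > 0" if "i \<in> F" for i
      using disc_radius_ge[OF q a1[OF that]] q disc_denominator_pos[OF q a1[OF that]]
        mult_pos_pos[of q "1 - (cmod (a i))\<^sup>2"] by linarith
    have disj: "disjoint_family_on B F"
    proof (clarsimp simp: disjoint_family_on_def)
      fix i j assume ij: "i \<in> F" "j \<in> F" "i \<noteq> j"
      show "B i \<inter> B j = {}"
      proof (rule ccontr)
        assume "B i \<inter> B j \<noteq> {}"
        then obtain z where z: "z \<in> B i" "z \<in> B j" by auto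
        then have z1: "cmod z < 1" using B1[OF ij(1)] by auto
        define x y where "x = pseudohyp (a i) z" and "y = pseudohyp (a j) z"
        have xy: "0 \<le> x" "x < q" "0 \<le> y" "y < q"
          using pseudohyp_less_of_mem_disc[OF q a1[OF ij(1)] z(1)[unfolded B_def] z1]
            pseudohyp_less_of_mem_disc[OF q a1[OF ij(2)] z(2)[unfolded B_def] z1]
          unfolding x_def y_def pseudohyp_commute[of _ z] by (simp_all add: pseudohyp_nonneg)
        have "pseudohyp (a i) (a j) \<le> (x + y) / (1 + x * y)"
          unfolding x_def y_def by (rule pseudohyp_triangle_strong[OF a1[OF ij(1)] a1[OF ij(2)] z1])
        \<comment> \<open>The quotient \<open>(x + y) / (1 + x y)\<close> increases in each
          variable, and the right-hand side is its value at \<open>x = y = q\<close>.\<close>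
        also have "\<dots> < 2 * q / (1 + q\<^sup>2)"
        proof -
          have "q * x < 1 * 1" "q * y < 1 * 1"
            using xy q by (intro mult_strict_mono'; simp)+
          then have "q * x < 1" "q * y < 1" by simp_all
          have "2 * q * (1 + x * y) - (x + y) * (1 + q\<^sup>2) = (q - x) * (1 - q * y) + (q - y) * (1 - q * x)"
            by (simp add: power2_eq_square algebra_simps)
          also have "\<dots> > 0"
            using xy \<open>q * x < 1\<close> \<open>q * y < 1\<close> by (intro add_pos_pos mult_pos_pos) auto
          finally have "(x + y) * (1 + q\<^sup>2) < 2 * q * (1 + x * y)" by simp
          moreover have "1 + x * y > 0" "1 + q\<^sup>2 > 0" using xy by (auto intro: add_pos_nonneg)
          ultimately show ?thesis by (simp add: divide_less_eq less_divide_eq)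
        qed
        finally show False using far[OF ij] by simp
      qed
    qed
    have meas: "B i \<in> sets borel" for i by (simp add: B_def)
    have sum1: "(\<Sum>i\<in>F. (disc_radius q (a i))\<^sup>2 / (1 - (cmod (disc_centre q (a i)))\<^sup>2)) \<le> 2 + log 2 (1 / (1 - s\<^sup>2))"
    proof -
      have cB: "disc_centre q (a i) \<in> B i" if "i \<in> F" for i using R[OF that] by (simp add: B_def)
      have nn: "(disc_radius q (a i))\<^sup>2 / (1 - (cmod (disc_centre q (a i)))\<^sup>2) \<ge> 0" if "i \<in> F" for i
        using one_minus_cmod_sq_pos[of "disc_centre q (a i)"] cB[OF that] B1[OF that] by auto
      have "ennreal (\<Sum>i\<in>F. pi * ((disc_radius q (a i))\<^sup>2 / (1 - (cmod (disc_centre q (a i)))\<^sup>2)))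
          = (\<Sum>i\<in>F. ennreal (pi * ((disc_radius q (a i))\<^sup>2 / (1 - (cmod (disc_centre q (a i)))\<^sup>2))))"
        using nn by (intro sum_ennreal[symmetric] mult_nonneg_nonneg) auto
      also have "\<dots> \<le> (\<Sum>i\<in>F. \<integral>\<^sup>+ z. ennreal (1 / (1 - (cmod z)\<^sup>2)) * indicator (B i) z \<partial>lborel)"
        unfolding B_def using B1 R by (intro sum_mono nn_integral_ball_ge) (auto simp: B_def)
      also have "\<dots> \<le> (\<integral>\<^sup>+ z. ennreal (1 / (1 - (cmod z)\<^sup>2)) * indicator (ball 0 s) z \<partial>lborel)"
        by (intro sum_nn_integral_disjoint_le F disj meas Bs) measurable
      also have "\<dots> \<le> ennreal (pi * (2 + log 2 (1 / (1 - s\<^sup>2))))"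
        using s \<open>1 - s > 0\<close> by (intro nn_integral_disc_le) auto
      finally have "(\<Sum>i\<in>F. pi * ((disc_radius q (a i))\<^sup>2 / (1 - (cmod (disc_centre q (a i)))\<^sup>2))) \<le> pi * (2 + log 2 (1 / (1 - s\<^sup>2)))"
      proof (subst (asm) ennreal_le_iff)
        have "1 - s\<^sup>2 > 0" "s\<^sup>2 \<ge> 0" using s \<open>1 - s > 0\<close> by (auto simp: abs_square_less_1)
        then have "log 2 (1 / (1 - s\<^sup>2)) \<ge> 0" by simp
        then show "0 \<le> pi * (2 + log 2 (1 / (1 - s\<^sup>2)))" by simp
      qed
      then show ?thesis
        unfolding sum_distrib_left[symmetric] by simp
    qed
    have sum2: "(\<Sum>i\<in>F. (1 - (cmod (a i))\<^sup>2)\<^sup>2) \<le> 1 / q\<^sup>2"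
    proof -
      have "ennreal (\<Sum>i\<in>F. pi * (disc_radius q (a i))\<^sup>2) = (\<Sum>i\<in>F. \<integral>\<^sup>+ z. 1 * indicator (B i) z \<partial>lborel)"
        using R by (subst sum_ennreal[symmetric]) (auto simp: B_def emeasure_lborel_ball_complex less_imp_le intro!: sum.cong)
      also have "\<dots> \<le> (\<integral>\<^sup>+ z. 1 * indicator (ball 0 1) z \<partial>(lborel :: complex measure))"
        by (intro sum_nn_integral_disjoint_le F disj meas B1) measurable
      also have "\<dots> = ennreal (pi * 1\<^sup>2)"
        by (simp add: emeasure_lborel_ball_complex)
      finally have "(\<Sum>i\<in>F. pi * (disc_radius q (a i))\<^sup>2) \<le> pi * 1"
        by (subst (asm) ennreal_le_iff) auto
      then have "(\<Sum>i\<in>F. (disc_radius q (a i))\<^sup>2) \<le> 1"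
        unfolding sum_distrib_left[symmetric] by simp
      moreover have "(\<Sum>i\<in>F. q\<^sup>2 * (1 - (cmod (a i))\<^sup>2)\<^sup>2) \<le> (\<Sum>i\<in>F. (disc_radius q (a i))\<^sup>2)"
      proof (rule sum_mono)
        fix i assume i: "i \<in> F"
        have "(q * (1 - (cmod (a i))\<^sup>2))\<^sup>2 \<le> (disc_radius q (a i))\<^sup>2"
          using disc_radius_ge[OF q a1[OF i]] q disc_denominator_pos[OF q a1[OF i]] by (intro power_mono) auto
        then show "q\<^sup>2 * (1 - (cmod (a i))\<^sup>2)\<^sup>2 \<le> (disc_radius q (a i))\<^sup>2"
          by (simp add: power_mult_distrib)
      qed
      ultimately have "q\<^sup>2 * (\<Sum>i\<in>F. (1 - (cmod (a i))\<^sup>2)\<^sup>2) \<le> 1"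
        unfolding sum_distrib_left[symmetric] by linarith
      then show ?thesis using q by (simp add: field_simps)
    qed
    \<comment> \<open>The factor 3/2 is an upper bound for \<open>1 / ln 2\<close>.\<close>
    have lg: "log 2 (1 / (1 - s\<^sup>2)) \<le> 3 / 2 * (ln (1 / (1 - r)) + ln (2 / (1 - q)))"
    proof -
      have "s\<^sup>2 \<le> s" using s \<open>1 - s > 0\<close> by (simp add: power2_eq_square mult_left_le)
      then have "(1 - r) * (1 - q) / 2 \<le> 1 - s\<^sup>2" using s_ge by linarith
      moreover have pos: "0 < (1 - r) * (1 - q) / 2" using q r by simp
      ultimately have "1 - s\<^sup>2 > 0" by linarith
      then have "1 / (1 - s\<^sup>2) \<le> 1 / ((1 - r) * (1 - q) / 2)"
        using pos \<open>(1 - r) * (1 - q) / 2 \<le> 1 - s\<^sup>2\<close> by (intro divide_left_mono mult_pos_pos) auto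
      then have "ln (1 / (1 - s\<^sup>2)) \<le> ln (1 / ((1 - r) * (1 - q) / 2))"
        using pos \<open>1 - s\<^sup>2 > 0\<close> by (subst ln_le_cancel_iff) auto
      also have "1 / ((1 - r) * (1 - q) / 2) = 1 / (1 - r) * (2 / (1 - q))"
        using q r by simp
      also have "ln \<dots> = ln (1 / (1 - r)) + ln (2 / (1 - q))"
        using q r by (intro ln_mult_pos) auto
      finally have l: "ln (1 / (1 - s\<^sup>2)) \<le> ln (1 / (1 - r)) + ln (2 / (1 - q))" .
      have "ln (1 / (1 - r)) + ln (2 / (1 - q)) \<ge> 0"
        using q r by (intro add_nonneg_nonneg ln_ge_zero) auto
      then have "log 2 (1 / (1 - s\<^sup>2)) \<le> (ln (1 / (1 - r)) + ln (2 / (1 - q))) / ln 2"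
        unfolding log_def using l by (intro divide_right_mono) auto
      also have "\<dots> \<le> (ln (1 / (1 - r)) + ln (2 / (1 - q))) / (2 / 3)"
        using ln2_ge_two_thirds \<open>ln (1 / (1 - r)) + ln (2 / (1 - q)) \<ge> 0\<close>
        by (intro divide_left_mono) auto
      finally show ?thesis by simp
    qed
    have "(\<Sum>i\<in>F. 1 - cmod (a i)) \<le> (\<Sum>i\<in>F. C1 * ((disc_radius q (a i))\<^sup>2 / (1 - (cmod (disc_centre q (a i)))\<^sup>2))
         + C2 * (1 - (cmod (a i))\<^sup>2)\<^sup>2)"
      unfolding C1_def C2_def by (intro sum_mono one_minus_cmod_le_disc q a1)
    also have "\<dots> = C1 * (\<Sum>i\<in>F. (disc_radius q (a i))\<^sup>2 / (1 - (cmod (disc_centre q (a i)))\<^sup>2)) + C2 * (\<Sum>i\<in>F. (1 - (cmod (a i))\<^sup>2)\<^sup>2)"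
      by (simp add: sum.distrib sum_distrib_left)
    also have "\<dots> \<le> C1 * (2 + 3 / 2 * (ln (1 / (1 - r)) + ln (2 / (1 - q)))) + C2 * (1 / q\<^sup>2)"
      using sum1 sum2 lg C12 by (intro add_mono mult_left_mono) linarith+
    also have "\<dots> = C1 * (3 / 2) * ln (1 / (1 - r)) + C"
      by (simp add: C_def algebra_simps)
    finally show ?thesis by (simp add: C1_def)
  qed
  then show ?thesis
    by (intro exI[of _ C] allI impI) simp
qed


text \<open>A point at distance \<open>\<rho>\<close> from \<open>\<zeta>\<close> is counted for the
  radii in \<open>(\<rho>, r]\<close>. Since \<open>ennreal\<close> sends negative numbers to 0, the
  summand is the positive part of \<open>r - \<rho>\<close>.\<close>

lemma nn_integral_disc_count:
  assumes z: "z ` I \<subseteq> ball 0 1"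
  shows "(\<integral>\<^sup>+ s\<in>{0..r}. disc_count I z \<zeta> s \<partial>lborel) = (\<Sum>n. if n \<in> I then ennreal (r - pseudohyp (z n) \<zeta>) else 0)"
proof -
  define T where "T = (\<lambda>n s. (if n \<in> I then indicator {pseudohyp (z n) \<zeta><..r} s else 0) :: ennreal)"
  have [measurable]: "T n \<in> borel_measurable borel" for n
    unfolding T_def by auto
  have "disc_count I z \<zeta> s * indicator {0..r} s = (\<Sum>n. T n s)" for s
  proof -
    have "disc_count I z \<zeta> s = (\<Sum>n. indicator {n\<in>I. z n \<in> pseudohyp_disc \<zeta> s} n)"
      unfolding disc_count_def by (simp add: nn_integral_count_space_nat flip: nn_integral_indicator)
    then have "disc_count I z \<zeta> s * indicator {0..r} s = (\<Sum>n. indicator {n\<in>I. z n \<in> pseudohyp_disc \<zeta> s} n * indicator {0..r} s)"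
      by (simp add: ennreal_suminf_multc)
    also have "(\<lambda>n. indicator {n\<in>I. z n \<in> pseudohyp_disc \<zeta> s} n * indicator {0..r} s) = (\<lambda>n. T n s)"
    proof
      fix n
      show "indicator {n\<in>I. z n \<in> pseudohyp_disc \<zeta> s} n * indicator {0..r} s = T n s"
        using z pseudohyp_nonneg[of "z n" \<zeta>] by (auto simp: T_def indicator_def pseudohyp_disc_def)
    qed
    finally show ?thesis .
  qed
  then have "(\<integral>\<^sup>+ s\<in>{0..r}. disc_count I z \<zeta> s \<partial>lborel) = (\<integral>\<^sup>+ s. (\<Sum>n. T n s) \<partial>lborel)"
    by simp
  also have "\<dots> = (\<Sum>n. \<integral>\<^sup>+ s. T n s \<partial>lborel)"
    by (intro nn_integral_suminf) simp
  also have "(\<lambda>n. \<integral>\<^sup>+ s. T n s \<partial>lborel) = (\<lambda>n. if n \<in> I then ennreal (r - pseudohyp (z n) \<zeta>) else 0)"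
  proof
    fix n
    have "emeasure lborel {a<..r} = ennreal (r - a)" for a :: real
      by (cases "a \<le> r") (auto simp: ennreal_neg)
    then show "(\<integral>\<^sup>+ s. T n s \<partial>lborel) = (if n \<in> I then ennreal (r - pseudohyp (z n) \<zeta>) else 0)"
      by (simp add: T_def)
  qed
  finally show ?thesis .
qed

lemma eventually_ln_at_left_ge: "eventually (\<lambda>r::real. ln (1 / (1 - r)) \<ge> M) (at_left 1)"
  unfolding eventually_at_left_field
proof (intro exI conjI allI impI)
  show "1 - exp (- M) < 1" by simp
  fix r :: real assume r: "1 - exp (- M) < r" "r < 1"
  then have "ln (1 - r) \<le> ln (exp (- M))"
    by (subst ln_le_cancel_iff) auto
  then have "ln (1 - r) \<le> - M" by simp
  then show "M \<le> ln (1 / (1 - r))"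
    using r by (simp add: ln_div)
qed

text \<open>An automorphism moves \<open>\<zeta>\<close> to 0, and
  \<open>r - \<rho> \<le> 1 - \<rho>\<close> reduces the integrated count to the packing bound. The
  strict inequality for \<open>c\<close> absorbs its additive constant, because the logarithm tends
  to infinity.\<close>

lemma upper_density_packing:
  assumes z: "z ` I \<subseteq> ball 0 1" and q: "0 < q" "q < 1"
    and far: "\<And>i j. i \<in> I \<Longrightarrow> j \<in> I \<Longrightarrow> i \<noteq> j \<Longrightarrow> pseudohyp (z i) (z j) \<ge> 2 * q / (1 + q\<^sup>2)"
    and c: "(1 - q ^ 4) / (2 * q\<^sup>2) * (3 / 2) < c"
  shows "upper_density I z \<le> ennreal c"
proof -
  define c0 where "c0 = (1 - q ^ 4) / (2 * q\<^sup>2) * (3 / 2)"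
  obtain C where C: "\<forall>F (a :: nat \<Rightarrow> complex) r. finite F \<longrightarrow> 0 < r \<longrightarrow> r < 1 \<longrightarrow> (\<forall>i\<in>F. cmod (a i) < r) \<longrightarrow>
    (\<forall>i\<in>F. \<forall>j\<in>F. i \<noteq> j \<longrightarrow> pseudohyp (a i) (a j) \<ge> 2 * q / (1 + q\<^sup>2)) \<longrightarrow>
    (\<Sum>i\<in>F. 1 - cmod (a i)) \<le> (1 - q ^ 4) / (2 * q\<^sup>2) * (3 / 2) * ln (1 / (1 - r)) + C"
    using packing_bound[OF q] by blast
  have bound: "(SUP \<zeta>\<in>ball 0 1. \<integral>\<^sup>+ s\<in>{0..r}. disc_count I z \<zeta> s \<partial>lborel) \<le> ennreal (c0 * ln (1 / (1 - r)) + C)"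
    if r: "0 < r" "r < 1" for r
  proof (rule SUP_least)
    fix \<zeta> :: complex assume "\<zeta> \<in> ball 0 1"
    then have \<zeta>: "cmod \<zeta> < 1" by simp
    have "(\<Sum>n. if n \<in> I then ennreal (r - pseudohyp (z n) \<zeta>) else 0) \<le> ennreal (c0 * ln (1 / (1 - r)) + C)"
      unfolding suminf_eq_SUP
    proof (rule SUP_least)
      fix N :: nat
      define F where "F = {n. n < N \<and> n \<in> I \<and> pseudohyp (z n) \<zeta> < r}"
      have F: "finite F" "F \<subseteq> {..<N}" "F \<subseteq> I" by (auto simp: F_def)
      have "(\<Sum>n<N. if n \<in> I then ennreal (r - pseudohyp (z n) \<zeta>) else 0) = (\<Sum>n\<in>F. ennreal (r - pseudohyp (z n) \<zeta>))"
        using F(2) by (intro sum.mono_neutral_cong_right) (auto simp: F_def ennreal_neg)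
      also have "\<dots> \<le> (\<Sum>n\<in>F. ennreal (1 - cmod (moebius \<zeta> (z n))))"
        using r by (intro sum_mono ennreal_leI) (simp add: cmod_moebius)
      also have "\<dots> = ennreal (\<Sum>n\<in>F. 1 - cmod (moebius \<zeta> (z n)))"
        using r by (intro sum_ennreal) (auto simp: cmod_moebius F_def)
      also have "\<dots> \<le> ennreal (c0 * ln (1 / (1 - r)) + C)"
      proof (rule ennreal_leI)
        show "(\<Sum>n\<in>F. 1 - cmod (moebius \<zeta> (z n))) \<le> c0 * ln (1 / (1 - r)) + C"
          unfolding c0_def
        proof (rule C[rule_format, OF F(1) r])
          show "cmod (moebius \<zeta> (z i)) < r" if "i \<in> F" for i
            using that by (simp add: F_def cmod_moebius)
          show "2 * q / (1 + q\<^sup>2) \<le> pseudohyp (moebius \<zeta> (z i)) (moebius \<zeta> (z j))"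
            if "i \<in> F" "j \<in> F" "i \<noteq> j" for i j
          proof -
            have "z i \<in> ball 0 1" "z j \<in> ball 0 1"
              using that F(3) z by blast+
            then have "cmod (z i) < 1" "cmod (z j) < 1" by simp_all
            then show ?thesis
              using far[of i j] that F(3) \<zeta> by (subst pseudohyp_moebius) auto
          qed
        qed
      qed
      finally show "(\<Sum>n<N. if n \<in> I then ennreal (r - pseudohyp (z n) \<zeta>) else 0) \<le> ennreal (c0 * ln (1 / (1 - r)) + C)" .
    qed
    then show "(\<integral>\<^sup>+ s\<in>{0..r}. disc_count I z \<zeta> s \<partial>lborel) \<le> ennreal (c0 * ln (1 / (1 - r)) + C)"
      by (simp add: nn_integral_disc_count[OF z])
  qed
  have "eventually (\<lambda>r. r < 1) (at_left (1::real))" "eventually (\<lambda>r. 0 < r) (at_left (1::real))"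
    by (auto simp: eventually_at_left_field intro: exI[of _ 0])
  moreover have "eventually (\<lambda>r::real. ln (1 / (1 - r)) \<ge> max 1 (C / (c - c0))) (at_left 1)"
    by (rule eventually_ln_at_left_ge)
  ultimately have ev: "eventually (\<lambda>r::real. (SUP \<zeta>\<in>ball 0 1. \<integral>\<^sup>+ s\<in>{0..r}. disc_count I z \<zeta> s \<partial>lborel) / ennreal (ln (1 / (1 - r))) \<le> ennreal c) (at_left 1)"
  proof eventually_elim
    case (elim r)
    define L where "L = ln (1 / (1 - r))"
    have L: "L \<ge> 1" "C \<le> (c - c0) * L"
    proof -
      have "c0 < c" using c by (simp only: c0_def)
      moreover have "C / (c - c0) \<le> L" using elim by (simp add: L_def)
      ultimately show "C \<le> (c - c0) * L" by (simp add: divide_le_eq mult.commute)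
    qed (use elim in \<open>simp add: L_def\<close>)
    have "(SUP \<zeta>\<in>ball 0 1. \<integral>\<^sup>+ s\<in>{0..r}. disc_count I z \<zeta> s \<partial>lborel) \<le> ennreal (c0 * L + C)"
      unfolding L_def using elim by (intro bound) auto
    also have "\<dots> \<le> ennreal (c * L)"
      using L by (intro ennreal_leI) (simp add: algebra_simps)
    finally have "(SUP \<zeta>\<in>ball 0 1. \<integral>\<^sup>+ s\<in>{0..r}. disc_count I z \<zeta> s \<partial>lborel) / ennreal L \<le> ennreal (c * L) / ennreal L"
      by (rule divide_right_mono_ennreal)
    also have "\<dots> = ennreal c"
    proof -
      have "c0 \<ge> 0" using q by (simp add: c0_def power_le_one)
      then have "c \<ge> 0" using c by (simp add: c0_def)
      then show ?thesis
        using L by (subst divide_ennreal) auto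
    qed
    finally show ?case by (simp add: L_def)
  qed
  show ?thesis
    unfolding upper_density_def by (rule Limsup_bounded[OF ev])
qed

text \<open>
  In terms of \<open>x = sqrt N\<close>, the root on the right-hand side is \<open>(x - 1) / y\<close> with \<open>y = sqrt (x\<^sup>2 + 1)\<close>,
  and \<open>y - x + 1 \<le> sqrt 2\<close>.
\<close>

lemma packing_constant_less:
  assumes N: "N > 1"
  defines "w \<equiv> sqrt (1 - 2 * sqrt N / (N + 1))"
  defines "q \<equiv> 1 / sqrt N"
  shows "(1 - q ^ 4) / (2 * q\<^sup>2) * (3 / 2) < (2 * pi + 1) * w / (1 - w)\<^sup>2"
proof -
  define x where "x = sqrt N"
  define y where "y = sqrt (x\<^sup>2 + 1)"
  have x: "x > 1" "N = x\<^sup>2" using N by (simp_all add: x_def)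
  have y2: "y\<^sup>2 = x\<^sup>2 + 1" by (simp add: y_def)
  have y: "y > x" "y \<ge> 0"
  proof -
    show "y > x" unfolding y_def by (rule real_less_rsqrt) simp
    then show "y \<ge> 0" using x by simp
  qed
  have w: "w = (x - 1) / y"
  proof -
    have "1 - 2 * sqrt N / (N + 1) = (x - 1)\<^sup>2 / y\<^sup>2"
    proof -
      have "x\<^sup>2 + 1 > 0" by (simp add: add_nonneg_pos)
      then have "1 - 2 * x / (x\<^sup>2 + 1) = (x\<^sup>2 + 1 - 2 * x) / (x\<^sup>2 + 1)"
        by (simp add: diff_divide_distrib)
      also have "x\<^sup>2 + 1 - 2 * x = (x - 1)\<^sup>2"
        by (simp add: power2_eq_square algebra_simps)
      finally show ?thesis
        unfolding y2 x_def[symmetric] x(2)[symmetric] .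
    qed
    then show ?thesis
      unfolding w_def using x y by (simp add: real_sqrt_divide)
  qed
  have "y \<le> x - 1 + sqrt 2"
  proof (rule power2_le_imp_le)
    have "(x - 1 + sqrt 2)\<^sup>2 - y\<^sup>2 = 2 * (sqrt 2 - 1) * (x - 1)"
      unfolding y2 by (simp add: power2_eq_square algebra_simps)
    also have "\<dots> \<ge> 0" using x by simp
    finally show "y\<^sup>2 \<le> (x - 1 + sqrt 2)\<^sup>2" by simp
  qed (use x in auto)
  then have "(y - x + 1)\<^sup>2 \<le> (sqrt 2)\<^sup>2"
    using y by (intro power_mono) auto
  then have d: "(y - x + 1)\<^sup>2 \<le> 2" "(y - x + 1)\<^sup>2 > 0" using y by auto
  have "(2 * pi + 1) * w / (1 - w)\<^sup>2 = (2 * pi + 1) * ((x - 1) * y) / (y - x + 1)\<^sup>2"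
  proof -
    have "1 - w = (y - x + 1) / y" unfolding w using y x by (simp add: field_simps)
    then have "(2 * pi + 1) * w / (1 - w)\<^sup>2 = (2 * pi + 1) * ((x - 1) / y) / ((y - x + 1)\<^sup>2 / y\<^sup>2)"
      by (simp only: w power_divide)
    also have "\<dots> = (2 * pi + 1) * ((x - 1) * y) / (y - x + 1)\<^sup>2"
      using x y d by (simp add: power2_eq_square)
    finally show ?thesis .
  qed
  also have "\<dots> \<ge> (2 * pi + 1) * ((x - 1) * y) / 2"
    using d x y by (intro divide_left_mono mult_nonneg_nonneg) auto
  also have "(2 * pi + 1) * ((x - 1) * y) / 2 \<ge> 7 * ((x - 1) * y) / 2"
    using pi_gt3 x y by (intro divide_right_mono mult_right_mono mult_nonneg_nonneg) auto
  finally have R: "7 * ((x - 1) * y) / 2 \<le> (2 * pi + 1) * w / (1 - w)\<^sup>2" .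
  \<comment> \<open>Both sides of the claim degenerate as \<open>N\<close> tends to 1, so the common
    factor \<open>x - 1\<close> is split off. The rest is compared with \<open>y\<close>: the factor
    is 3 on the left and 7/2 on the right.\<close>
  have "(1 - q ^ 4) / (2 * q\<^sup>2) * (3 / 2) = 3 / 4 * (x\<^sup>2 - 1 / x\<^sup>2)"
  proof -
    have "(1 - q ^ 4) / (2 * q\<^sup>2) * (3 / 2) = (1 - 1 / x ^ 4) * x\<^sup>2 * (3 / 4)"
      unfolding q_def x_def[symmetric] by (simp add: power_divide)
    also have "(1 - 1 / x ^ 4) * x\<^sup>2 = x\<^sup>2 - 1 / x\<^sup>2"
      using x by (simp add: left_diff_distrib power2_eq_square power4_eq_xxxx)
    finally show ?thesis by simp
  qed
  also have "x\<^sup>2 - 1 / x\<^sup>2 = (x - 1) * ((x + 1) * (1 + 1 / x\<^sup>2))"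
  proof -
    have "t - 1 / t = (t - 1) * (1 + 1 / t)" if "t > 0" for t :: real
      using that by (simp add: field_simps)
    from this[of "x\<^sup>2"] have "x\<^sup>2 - 1 / x\<^sup>2 = (x\<^sup>2 - 1) * (1 + 1 / x\<^sup>2)" using x(1) by simp
    also have "x\<^sup>2 - 1 = (x - 1) * (x + 1)" by (simp add: power2_eq_square algebra_simps)
    finally show ?thesis by (simp only: mult.assoc)
  qed
  also have "(x - 1) * ((x + 1) * (1 + 1 / x\<^sup>2)) \<le> (x - 1) * ((2 * y) * 2)"
  proof (intro mult_left_mono mult_mono)
    have "1 / x\<^sup>2 \<le> 1" using x by simp
    then show "1 + 1 / x\<^sup>2 \<le> 2" by simp
  qed (use x y in auto)
  finally have "(1 - q ^ 4) / (2 * q\<^sup>2) * (3 / 2) \<le> 3 * ((x - 1) * y)" by (simp add: mult.commute)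
  also have "\<dots> < 7 * ((x - 1) * y) / 2"
    using x y by simp
  finally show ?thesis using R by (rule less_le_trans)
qed

section \<open>Sums over a sequence of small upper density\<close>

text \<open>For the dyadic decompositions below. The inner sum may run over all of \<open>F\<close>,
  not only over one class, since the additional terms are nonnegative; the bounds available for it
  hold for arbitrary finite sets.\<close>

lemma sum_le_sum_over_classes:
  fixes f :: "'a \<Rightarrow> real" and g :: "'b \<Rightarrow> 'a \<Rightarrow> real"
  assumes F: "finite F" and le: "\<And>n. n \<in> F \<Longrightarrow> f n \<le> g (\<kappa> n) n" and nn: "\<And>k n. n \<in> F \<Longrightarrow> g k n \<ge> 0"
  shows "(\<Sum>n\<in>F. f n) \<le> (\<Sum>k\<in>\<kappa> ` F. \<Sum>n\<in>F. g k n)"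
proof -
  have "f n \<le> (\<Sum>k\<in>\<kappa> ` F. g k n)" if "n \<in> F" for n
  proof -
    have "g (\<kappa> n) n \<le> (\<Sum>k\<in>\<kappa> ` F. g k n)"
      using F that nn by (intro member_le_sum) auto
    then show ?thesis using le[OF that] by linarith
  qed
  then have "(\<Sum>n\<in>F. f n) \<le> (\<Sum>n\<in>F. \<Sum>k\<in>\<kappa> ` F. g k n)"
    by (intro sum_mono)
  also have "\<dots> = (\<Sum>k\<in>\<kappa> ` F. \<Sum>n\<in>F. g k n)"
    by (rule sum.swap)
  finally show ?thesis .
qed

lemma cmod_one_minus_scaled_le:
  assumes "cmod a < 1" "cmod w < 1" "0 \<le> t" "t \<le> 1"
  shows "cmod (1 - cnj a * (of_real (1 - t) * w)) \<le> cmod (1 - cnj a * w) + t"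
proof -
  have "1 - cnj a * (of_real (1 - t) * w) = (1 - cnj a * w) + of_real t * (cnj a * w)"
    by (simp add: algebra_simps)
  then have "cmod (1 - cnj a * (of_real (1 - t) * w)) \<le> cmod (1 - cnj a * w) + cmod (of_real t * (cnj a * w))"
    using norm_triangle_ineq by metis
  also have "cmod (of_real t * (cnj a * w)) = t * (cmod a * cmod w)"
    using assms by (simp add: norm_mult)
  also have "\<dots> \<le> t * 1"
    using assms by (intro mult_left_mono) (simp_all add: mult_le_one)
  finally show ?thesis by simp
qed

text \<open>The last assumption is the condition \<open>D\<^sup>+ < 1\<close> with the integrated
  counting function written as a sum of positive parts. Stating it for finite \<open>F\<close> keeps
  questions of convergence out of all estimates.\<close>

locale thin_sequence =
  fixes I :: "nat set" and z :: "nat \<Rightarrow> complex" and p r0 :: real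
  assumes in_disc: "n \<in> I \<Longrightarrow> cmod (z n) < 1"
    and p: "0 < p" "p < 1" and r0: "0 < r0" "r0 < 1"
    and density: "r0 < r \<Longrightarrow> r < 1 \<Longrightarrow> cmod \<zeta> < 1 \<Longrightarrow> finite F \<Longrightarrow> F \<subseteq> I \<Longrightarrow>
      (\<Sum>n\<in>F. max 0 (r - pseudohyp (z n) \<zeta>)) \<le> p * ln (1 / (1 - r))"
begin

text \<open>The density hypothesis at \<open>r = 1 - (1 / 2) ^ k\<close> gives a multiple of
  \<open>k ln 2\<close>. When that \<open>r\<close> is not above \<open>r0\<close>, a fixed larger
  index \<open>k0\<close> is used instead, which costs the factor \<open>k0\<close>.\<close>

lemma sum_truncated_le:
  "\<exists>C>0. \<forall>k \<zeta> F. 1 \<le> k \<longrightarrow> cmod \<zeta> < 1 \<longrightarrow> finite F \<longrightarrow> F \<subseteq> I \<longrightarrow>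
     (\<Sum>n\<in>F. max 0 (1 - pseudohyp (z n) \<zeta> - (1 / 2) ^ k)) \<le> C * real k"
proof -
  obtain k1 where k1: "(1 / 2 :: real) ^ k1 < 1 - r0"
    using real_arch_pow_inv[of "1 - r0" "1 / 2"] r0 by auto
  define k0 where "k0 = Suc k1"
  have k0: "(1 / 2 :: real) ^ k0 < 1 - r0" "1 \<le> k0"
  proof -
    have "(1 / 2 :: real) ^ k0 = (1 / 2) ^ k1 / 2" "(1 / 2 :: real) ^ k1 > 0" by (simp_all add: k0_def)
    then show "(1 / 2 :: real) ^ k0 < 1 - r0" using k1 by linarith
  qed (simp add: k0_def)
  have "(\<Sum>n\<in>F. max 0 (1 - pseudohyp (z n) \<zeta> - (1 / 2) ^ k)) \<le> real k0 * real k"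
    if k: "1 \<le> k" and \<zeta>: "cmod \<zeta> < 1" and F: "finite F" "F \<subseteq> I" for k \<zeta> F
  proof -
    define m where "m = max k k0"
    define r where "r = 1 - (1 / 2 :: real) ^ m"
    have "(1 / 2 :: real) ^ m \<le> (1 / 2) ^ k0" "(1 / 2 :: real) ^ m \<le> (1 / 2) ^ k"
      by (auto simp: m_def intro!: power_decreasing)
    moreover have "(1 / 2 :: real) ^ m > 0" by simp
    ultimately have r: "r0 < r" "r < 1" "1 - (1 / 2) ^ k \<le> r"
      using k0(1) unfolding r_def by linarith+
    have "(\<Sum>n\<in>F. max 0 (1 - pseudohyp (z n) \<zeta> - (1 / 2) ^ k)) \<le> (\<Sum>n\<in>F. max 0 (r - pseudohyp (z n) \<zeta>))"
      using r(3) by (intro sum_mono) auto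
    also have "\<dots> \<le> p * ln (1 / (1 - r))"
      by (rule density) (use r \<zeta> F in auto)
    also have "1 / (1 - r) = 2 ^ m"
      by (simp add: r_def power_divide)
    also have "p * ln (2 ^ m) = p * (real m * ln 2)"
      by (simp add: ln_realpow)
    also have "\<dots> \<le> 1 * (real m * 1)"
      using p ln_less_self[of 2] ln2_le_25_over_36 by (intro mult_mono) auto
    also have "real m \<le> real k0 * real k"
    proof -
      have "m \<le> k0 * k" using k k0 by (auto simp: m_def)
      then show ?thesis by (metis of_nat_le_iff of_nat_mult)
    qed
    finally show ?thesis by simp
  qed
  moreover have "real k0 > 0" using k0 by simp
  ultimately show ?thesis by blast
qed

text \<open>Points with \<open>1 - \<rho>\<close> of size \<open>(1 / 2) ^ k\<close> contribute at
  most a multiple of \<open>k\<close> to the sum of \<open>1 - \<rho>\<close>, and the additional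
  power \<open>a - 1\<close> contributes a factor \<open>\<theta> ^ k\<close> with
  \<open>\<theta> < 1\<close>; the series of \<open>k \<theta> ^ k\<close> converges.\<close>

lemma sum_powr_le:
  assumes a: "a > 1"
  shows "\<exists>C>0. \<forall>\<zeta> F. cmod \<zeta> < 1 \<longrightarrow> finite F \<longrightarrow> F \<subseteq> I \<longrightarrow>
     (\<Sum>n\<in>F. (1 - pseudohyp (z n) \<zeta>) powr a) \<le> C"
proof -
  obtain C1 where C1: "C1 > 0" "\<And>k \<zeta> F. 1 \<le> k \<Longrightarrow> cmod \<zeta> < 1 \<Longrightarrow> finite F \<Longrightarrow> F \<subseteq> I \<Longrightarrow>
     (\<Sum>n\<in>F. max 0 (1 - pseudohyp (z n) \<zeta> - (1 / 2) ^ k)) \<le> C1 * real k"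
    using sum_truncated_le by metis
  define \<theta> where "\<theta> = (1 / 2 :: real) powr (a - 1)"
  have "\<theta> < (1 / 2) powr 0"
    unfolding \<theta>_def using a by (intro powr_less_mono') auto
  then have \<theta>: "0 < \<theta>" "\<theta> < 1" by (auto simp: \<theta>_def)
  have sums: "(\<lambda>k. real (Suc k) * \<theta> ^ k) sums (1 / (1 - \<theta>)\<^sup>2)"
    using geometric_deriv_sums[of \<theta>] \<theta> by simp
  define B where "B = 2 * 4 powr (a - 1)"
  have B: "B > 0" by (simp add: B_def)
  define C where "C = B * C1 / (1 - \<theta>)\<^sup>2"
  have "(\<Sum>n\<in>F. (1 - pseudohyp (z n) \<zeta>) powr a) \<le> C"
    if \<zeta>: "cmod \<zeta> < 1" and F: "finite F" "F \<subseteq> I" for \<zeta> F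
  proof -
    define x where "x = (\<lambda>n. 1 - pseudohyp (z n) \<zeta>)"
    have x: "0 < x n" "x n \<le> 1" if "n \<in> F" for n
      using pseudohyp_less_1[OF in_disc \<zeta>, of n] pseudohyp_nonneg[of "z n" \<zeta>] that F by (auto simp: x_def)
    have "\<exists>k\<ge>1. x n powr a \<le> B * (\<theta> ^ k * max 0 (x n - (1 / 2) ^ k))" if n: "n \<in> F" for n
    proof -
      \<comment> \<open>Least \<open>k\<close> such that truncation at \<open>(1 / 2) ^ k\<close>
        removes at most half of \<open>x n\<close>. Minimality gives
        \<open>x n < 4 * (1 / 2) ^ k\<close>.\<close>
      define k where "k = (LEAST k. (1 / 2) ^ k \<le> x n / 2)"
      have "\<exists>k. (1 / 2) ^ k \<le> x n / 2"
        using real_arch_pow_inv[of "x n / 2" "1 / 2"] x[OF n] by (auto intro: less_imp_le)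
      then have k: "(1 / 2) ^ k \<le> x n / 2"
        unfolding k_def by (rule LeastI_ex)
      have "k \<noteq> 0"
      proof
        assume "k = 0"
        then show False using k x[OF n] by simp
      qed
      then obtain m where m: "k = Suc m" by (cases k) auto
      have "\<not> (1 / 2) ^ m \<le> x n / 2"
        using not_less_Least[of m "\<lambda>k. (1 / 2) ^ k \<le> x n / 2"] m by (simp add: k_def)
      then have "x n \<le> 4 * (1 / 2) ^ k" by (simp add: m)
      then have "x n powr (a - 1) \<le> (4 * (1 / 2) ^ k) powr (a - 1)"
        using x[OF n] a by (intro powr_mono2) auto
      also have "\<dots> = 4 powr (a - 1) * \<theta> ^ k"
        by (simp add: \<theta>_def powr_mult powr_power powr_powr mult.commute flip: powr_realpow)
      finally have "x n powr (a - 1) * x n \<le> 4 powr (a - 1) * \<theta> ^ k * (2 * max 0 (x n - (1 / 2) ^ k))"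
        using k x[OF n] \<theta> by (intro mult_mono) auto
      moreover have "x n powr a = x n powr (a - 1) * x n"
        using x[OF n] by (simp add: powr_diff)
      ultimately show ?thesis
        using m by (intro exI[of _ k]) (simp add: B_def mult_ac)
    qed
    then obtain \<kappa> where \<kappa>: "\<And>n. n \<in> F \<Longrightarrow> 1 \<le> \<kappa> n"
      "\<And>n. n \<in> F \<Longrightarrow> x n powr a \<le> B * (\<theta> ^ \<kappa> n * max 0 (x n - (1 / 2) ^ \<kappa> n))"
      by metis
    have "(\<Sum>n\<in>F. x n powr a) \<le> (\<Sum>k\<in>\<kappa> ` F. \<Sum>n\<in>F. B * (\<theta> ^ k * max 0 (x n - (1 / 2) ^ k)))"
      using \<kappa>(2) F(1) B \<theta> by (intro sum_le_sum_over_classes) auto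
    also have "\<dots> = (\<Sum>k\<in>\<kappa> ` F. B * (\<theta> ^ k * (\<Sum>n\<in>F. max 0 (x n - (1 / 2) ^ k))))"
      by (simp add: sum_distrib_left)
    also have "\<dots> \<le> (\<Sum>k\<in>\<kappa> ` F. B * (\<theta> ^ k * (C1 * real (Suc k))))"
    proof (intro sum_mono mult_left_mono)
      fix k assume "k \<in> \<kappa> ` F"
      then have "(\<Sum>n\<in>F. max 0 (x n - (1 / 2) ^ k)) \<le> C1 * real k"
        unfolding x_def using \<kappa>(1) \<zeta> F by (intro C1(2)) auto
      also have "\<dots> \<le> C1 * real (Suc k)" using C1(1) by simp
      finally show "(\<Sum>n\<in>F. max 0 (x n - (1 / 2) ^ k)) \<le> C1 * real (Suc k)" .
    qed (use B \<theta> in auto)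
    also have "\<dots> = B * C1 * (\<Sum>k\<in>\<kappa> ` F. real (Suc k) * \<theta> ^ k)"
      by (simp add: sum_distrib_left mult_ac)
    also have "\<dots> \<le> B * C1 * (1 / (1 - \<theta>)\<^sup>2)"
    proof (intro mult_left_mono)
      have "(\<Sum>k\<in>\<kappa> ` F. real (Suc k) * \<theta> ^ k) \<le> (\<Sum>k. real (Suc k) * \<theta> ^ k)"
        using F(1) \<theta> by (intro sum_le_suminf sums_summable[OF sums]) auto
      then show "(\<Sum>k\<in>\<kappa> ` F. real (Suc k) * \<theta> ^ k) \<le> 1 / (1 - \<theta>)\<^sup>2"
        using sums_unique[OF sums] by simp
    qed (use B C1 in auto)
    finally show ?thesis by (simp add: x_def C_def)
  qed
  moreover have "C > 0" using B C1 \<theta> by (simp add: C_def)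
  ultimately show ?thesis by blast
qed

text \<open>A Carleson-type estimate. The set \<open>|1 - cnj z w| \<le> t\<close> is viewed from
  the point \<open>\<zeta> = (1 - s) w\<close> at height about \<open>t\<close>; there
  \<open>1 - \<rho>(z, \<zeta>)\<close> is at least a constant times \<open>(1 - |z|) / t\<close>,
  so the preceding bound applies. For \<open>t \<ge> 1\<close> the point \<open>\<zeta>\<close> is
  0.\<close>

lemma sum_near_le:
  assumes a: "a > 1"
  shows "\<exists>C>0. \<forall>w t F. cmod w < 1 \<longrightarrow> 0 < t \<longrightarrow> finite F \<longrightarrow> F \<subseteq> I \<longrightarrow>
     (\<forall>n\<in>F. cmod (1 - cnj (z n) * w) \<le> t) \<longrightarrow> (\<Sum>n\<in>F. (1 - cmod (z n)) powr a) \<le> C * t powr a"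
proof -
  obtain C1 where C1: "C1 > 0" "\<And>\<zeta> F. cmod \<zeta> < 1 \<Longrightarrow> finite F \<Longrightarrow> F \<subseteq> I \<Longrightarrow>
     (\<Sum>n\<in>F. (1 - pseudohyp (z n) \<zeta>) powr a) \<le> C1"
    using sum_powr_le[OF a] by metis
  have "(\<Sum>n\<in>F. (1 - cmod (z n)) powr a) \<le> 8 powr a * C1 * t powr a"
    if w: "cmod w < 1" and t: "0 < t" and F: "finite F" "F \<subseteq> I"
      and near: "\<forall>n\<in>F. cmod (1 - cnj (z n) * w) \<le> t" for w t F
  proof -
    define s where "s = min t 1"
    define \<zeta> where "\<zeta> = of_real (1 - s) * w"
    have s: "0 < s" "s \<le> 1" "s \<le> t" using t by (auto simp: s_def)
    have \<zeta>le: "cmod \<zeta> \<le> 1 - s"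
      unfolding \<zeta>_def norm_mult norm_of_real using s w by (simp add: mult_left_le)
    then have \<zeta>: "cmod \<zeta> < 1" using s by simp
    have \<zeta>s: "1 - (cmod \<zeta>)\<^sup>2 \<ge> s"
    proof -
      have "(cmod \<zeta>)\<^sup>2 \<le> cmod \<zeta>" using \<zeta> by (simp add: power2_eq_square mult_left_le)
      then show ?thesis using \<zeta>le by linarith
    qed
    have pt: "(1 - cmod (z n)) powr a \<le> (8 * s) powr a * (1 - pseudohyp (z n) \<zeta>) powr a" if n: "n \<in> F" for n
    proof -
      have zn: "cmod (z n) < 1" using in_disc n F by auto
      have den: "cmod (1 - cnj (z n) * \<zeta>) \<le> 2 * s"
      proof (cases "t \<le> 1")
        case True
        then have "cmod (1 - cnj (z n) * \<zeta>) \<le> cmod (1 - cnj (z n) * w) + s"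
          unfolding \<zeta>_def using zn w s by (intro cmod_one_minus_scaled_le) auto
        then show ?thesis using near n True by (auto simp: s_def)
      next
        case False
        then show ?thesis by (simp add: \<zeta>_def s_def)
      qed
      have "(1 - cmod (z n)) / (4 * s) = (1 - cmod (z n)) * s / (2 * s)\<^sup>2"
        using s by (simp add: power2_eq_square)
      also have "\<dots> \<le> (1 - (cmod (z n))\<^sup>2) * (1 - (cmod \<zeta>)\<^sup>2) / (cmod (1 - cnj (z n) * \<zeta>))\<^sup>2"
      proof (rule frac_le)
        have "(cmod (z n))\<^sup>2 \<le> cmod (z n)" using zn by (simp add: power2_eq_square mult_left_le)
        then show "(1 - cmod (z n)) * s \<le> (1 - (cmod (z n))\<^sup>2) * (1 - (cmod \<zeta>)\<^sup>2)"
          using \<zeta>s s zn by (intro mult_mono) auto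
        then show "0 \<le> (1 - (cmod (z n))\<^sup>2) * (1 - (cmod \<zeta>)\<^sup>2)"
          using s zn by (meson diff_ge_0_iff_ge less_imp_le mult_nonneg_nonneg order_trans)
        show "(cmod (1 - cnj (z n) * \<zeta>))\<^sup>2 \<le> (2 * s)\<^sup>2"
          using den by (intro power_mono) auto
        show "0 < (cmod (1 - cnj (z n) * \<zeta>))\<^sup>2"
          using cmod_one_minus_cnj_mult_pos[OF zn \<zeta>] by simp
      qed
      also have "\<dots> = 1 - (pseudohyp (z n) \<zeta>)\<^sup>2"
        using one_minus_pseudohyp_sq[OF zn \<zeta>] by simp
      also have "\<dots> \<le> 2 * (1 - pseudohyp (z n) \<zeta>)"
      proof -
        have "0 \<le> (1 - pseudohyp (z n) \<zeta>)\<^sup>2" by simp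
        then show ?thesis by (simp add: power2_diff)
      qed
      finally have "1 - cmod (z n) \<le> 8 * s * (1 - pseudohyp (z n) \<zeta>)"
        using s by (simp add: divide_le_eq mult_ac)
      then have "(1 - cmod (z n)) powr a \<le> (8 * s * (1 - pseudohyp (z n) \<zeta>)) powr a"
        using zn a by (intro powr_mono2) auto
      then show ?thesis
        by (simp add: powr_mult)
    qed
    have "(\<Sum>n\<in>F. (1 - cmod (z n)) powr a) \<le> (\<Sum>n\<in>F. (8 * s) powr a * (1 - pseudohyp (z n) \<zeta>) powr a)"
      by (intro sum_mono pt)
    also have "\<dots> = (8 * s) powr a * (\<Sum>n\<in>F. (1 - pseudohyp (z n) \<zeta>) powr a)"
      by (simp add: sum_distrib_left)
    also have "\<dots> \<le> (8 * t) powr a * C1"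
      using s C1(2)[OF \<zeta> F] C1(1) a by (intro mult_mono powr_mono2) (auto intro: sum_nonneg)
    finally show ?thesis
      by (simp add: powr_mult mult_ac)
  qed
  moreover have "8 powr a * C1 > 0" using C1 by simp
  ultimately show ?thesis by blast
qed

text \<open>On the set where \<open>\<tau> + |1 - cnj z w|\<close> is of size
  \<open>2 ^ k \<tau>\<close> the sum is at most a multiple of
  \<open>(2 ^ k \<tau>) powr (a - b)\<close>, and these bounds form a convergent geometric series
  because \<open>a < b\<close>.\<close>

lemma sum_kernel_le:
  assumes a: "a > 1" and b: "b > a"
  shows "\<exists>C>0. \<forall>w \<tau> F. cmod w < 1 \<longrightarrow> 0 < \<tau> \<longrightarrow> finite F \<longrightarrow> F \<subseteq> I \<longrightarrow>
     (\<Sum>n\<in>F. (1 - cmod (z n)) powr a / (\<tau> + cmod (1 - cnj (z n) * w)) powr b) \<le> C * \<tau> powr (a - b)"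
proof -
  obtain C1 where C1: "C1 > 0" "\<forall>w t F. cmod w < 1 \<longrightarrow> 0 < t \<longrightarrow> finite F \<longrightarrow> F \<subseteq> I \<longrightarrow>
     (\<forall>n\<in>F. cmod (1 - cnj (z n) * w) \<le> t) \<longrightarrow> (\<Sum>n\<in>F. (1 - cmod (z n)) powr a) \<le> C1 * t powr a"
    using sum_near_le[OF a] by blast
  define \<theta> where "\<theta> = (2 :: real) powr (a - b)"
  have "\<theta> < 2 powr 0"
    unfolding \<theta>_def using b by (intro powr_less_mono) auto
  then have \<theta>: "0 < \<theta>" "\<theta> < 1" by (auto simp: \<theta>_def)
  define C where "C = 2 powr b * C1 * (1 / (1 - \<theta>))"
  have "(\<Sum>n\<in>F. (1 - cmod (z n)) powr a / (\<tau> + cmod (1 - cnj (z n) * w)) powr b) \<le> C * \<tau> powr (a - b)"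
    if w: "cmod w < 1" and \<tau>: "0 < \<tau>" and F: "finite F" "F \<subseteq> I" for w \<tau> F
  proof -
    define x where "x = (\<lambda>n. cmod (1 - cnj (z n) * w))"
    define m where "m = (\<lambda>n. (1 - cmod (z n)) powr a)"
    have x0: "x n \<ge> 0" and m0: "m n \<ge> 0" for n by (simp_all add: x_def m_def)
    have "\<exists>k. x n \<le> 2 ^ k * \<tau> \<and> m n / (\<tau> + x n) powr b \<le> 2 powr b * (m n / (2 ^ k * \<tau>) powr b)" for n
    proof -
      define k where "k = (LEAST k. \<tau> + x n \<le> 2 ^ k * \<tau>)"
      obtain k' where "(\<tau> + x n) / \<tau> < 2 ^ k'"
        using real_arch_pow[of 2 "(\<tau> + x n) / \<tau>"] by auto
      then have "\<exists>k. \<tau> + x n \<le> 2 ^ k * \<tau>"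
        using \<tau> by (intro exI[of _ k']) (simp add: field_simps)
      then have k: "\<tau> + x n \<le> 2 ^ k * \<tau>"
        unfolding k_def by (rule LeastI_ex)
      have "2 ^ k * \<tau> \<le> 2 * (\<tau> + x n)"
      proof (cases k)
        case 0
        then show ?thesis using \<tau> x0[of n] by simp
      next
        case (Suc l)
        have "\<not> \<tau> + x n \<le> 2 ^ l * \<tau>"
          using not_less_Least[of l "\<lambda>k. \<tau> + x n \<le> 2 ^ k * \<tau>"] Suc by (simp add: k_def)
        then show ?thesis by (simp add: Suc)
      qed
      then have "(2 ^ k * \<tau>) powr b \<le> (2 * (\<tau> + x n)) powr b"
        using \<tau> a b by (intro powr_mono2) auto
      also have "\<dots> = 2 powr b * (\<tau> + x n) powr b"
        by (rule powr_mult)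
      finally have "m n * (2 ^ k * \<tau>) powr b \<le> m n * (2 powr b * (\<tau> + x n) powr b)"
        by (intro mult_left_mono m0)
      then have "m n / (\<tau> + x n) powr b \<le> 2 powr b * (m n / (2 ^ k * \<tau>) powr b)"
        using \<tau> x0[of n] by (simp add: divide_simps mult_ac add_pos_nonneg)
      moreover have "x n \<le> 2 ^ k * \<tau>" using k \<tau> by simp
      ultimately show ?thesis by blast
    qed
    then obtain \<kappa> where \<kappa>: "\<And>n. x n \<le> 2 ^ \<kappa> n * \<tau>"
      "\<And>n. m n / (\<tau> + x n) powr b \<le> 2 powr b * (m n / (2 ^ \<kappa> n * \<tau>) powr b)"
      by metis
    have "(\<Sum>n\<in>F. m n / (\<tau> + x n) powr b) \<le>
      (\<Sum>k\<in>\<kappa> ` F. \<Sum>n\<in>F. if x n \<le> 2 ^ k * \<tau> then 2 powr b * (m n / (2 ^ k * \<tau>) powr b) else 0)"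
      using F(1) \<kappa> m0 by (intro sum_le_sum_over_classes) auto
    also have "\<dots> \<le> (\<Sum>k\<in>\<kappa> ` F. 2 powr b * C1 * \<tau> powr (a - b) * \<theta> ^ k)"
    proof (rule sum_mono)
      fix k assume "k \<in> \<kappa> ` F"
      define T where "T = 2 ^ k * \<tau>"
      have T: "T > 0" using \<tau> by (simp add: T_def)
      have "(\<Sum>n\<in>F. if x n \<le> T then 2 powr b * (m n / T powr b) else 0)
          = (\<Sum>n\<in>{n\<in>F. x n \<le> T}. 2 powr b * (m n / T powr b))"
        using F(1) by (simp add: sum.If_cases Int_def)
      also have "\<dots> = 2 powr b / T powr b * (\<Sum>n\<in>{n\<in>F. x n \<le> T}. m n)"
        by (simp add: sum_distrib_left)
      also have "\<dots> \<le> 2 powr b / T powr b * (C1 * T powr a)"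
        unfolding m_def using w T F by (intro mult_left_mono C1(2)[rule_format]) (auto simp: x_def)
      also have "\<dots> = 2 powr b * C1 * T powr (a - b)"
        by (simp add: powr_diff)
      also have "T powr (a - b) = \<tau> powr (a - b) * \<theta> ^ k"
        using \<tau> by (simp add: T_def \<theta>_def powr_mult powr_power powr_powr mult.commute flip: powr_realpow)
      finally show "(\<Sum>n\<in>F. if x n \<le> 2 ^ k * \<tau> then 2 powr b * (m n / (2 ^ k * \<tau>) powr b) else 0)
          \<le> 2 powr b * C1 * \<tau> powr (a - b) * \<theta> ^ k"
        by (simp only: T_def mult.assoc)
    qed
    also have "\<dots> = 2 powr b * C1 * \<tau> powr (a - b) * (\<Sum>k\<in>\<kappa> ` F. \<theta> ^ k)"
      by (simp add: sum_distrib_left)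
    also have "\<dots> \<le> 2 powr b * C1 * \<tau> powr (a - b) * (1 / (1 - \<theta>))"
    proof (intro mult_left_mono)
      have "(\<Sum>k\<in>\<kappa> ` F. \<theta> ^ k) \<le> (\<Sum>k. \<theta> ^ k)"
        using F(1) \<theta> by (intro sum_le_suminf) auto
      then show "(\<Sum>k\<in>\<kappa> ` F. \<theta> ^ k) \<le> 1 / (1 - \<theta>)"
        using \<theta> by (simp add: suminf_geometric)
    qed (use C1 in auto)
    finally show ?thesis by (simp add: x_def m_def C_def mult_ac)
  qed
  moreover have "C > 0" using C1 \<theta> by (simp add: C_def)
  ultimately show ?thesis by blast
qed

lemma sum_kernel_le':
  assumes a: "a > 1" and b: "b > a"
  shows "\<exists>C>0. \<forall>w F. cmod w < 1 \<longrightarrow> finite F \<longrightarrow> F \<subseteq> I \<longrightarrow>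
     (\<Sum>n\<in>F. (1 - cmod (z n)) powr a / cmod (1 - cnj (z n) * w) powr b) \<le> C * (1 - cmod w) powr (a - b)"
proof -
  obtain C1 where C1: "C1 > 0" "\<forall>w \<tau> F. cmod w < 1 \<longrightarrow> 0 < \<tau> \<longrightarrow> finite F \<longrightarrow> F \<subseteq> I \<longrightarrow>
     (\<Sum>n\<in>F. (1 - cmod (z n)) powr a / (\<tau> + cmod (1 - cnj (z n) * w)) powr b) \<le> C1 * \<tau> powr (a - b)"
    using sum_kernel_le[OF a b] by blast
  have "(\<Sum>n\<in>F. (1 - cmod (z n)) powr a / cmod (1 - cnj (z n) * w) powr b) \<le> 2 powr b * C1 * (1 - cmod w) powr (a - b)"
    if w: "cmod w < 1" and F: "finite F" "F \<subseteq> I" for w F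
  proof -
    have "(1 - cmod (z n)) powr a / cmod (1 - cnj (z n) * w) powr b \<le>
        2 powr b * ((1 - cmod (z n)) powr a / ((1 - cmod w) + cmod (1 - cnj (z n) * w)) powr b)" if "n \<in> F" for n
    proof -
      have zn: "cmod (z n) < 1" using in_disc that F by auto
      define x where "x = cmod (1 - cnj (z n) * w)"
      have x: "x \<ge> 1 - cmod w" "x > 0"
        using cmod_one_minus_cnj_mult_ge(2)[of "z n" w] zn w by (auto simp: x_def)
      have "((1 - cmod w) + x) powr b \<le> (2 * x) powr b"
        using x w a b by (intro powr_mono2) auto
      also have "\<dots> = 2 powr b * x powr b"
        by (rule powr_mult)
      finally have "2 powr b * (1 - cmod (z n)) powr a / (2 powr b * x powr b) \<le>
          2 powr b * (1 - cmod (z n)) powr a / ((1 - cmod w) + x) powr b"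
        using x w by (intro divide_left_mono) auto
      then show ?thesis
        unfolding x_def[symmetric] by simp
    qed
    then have "(\<Sum>n\<in>F. (1 - cmod (z n)) powr a / cmod (1 - cnj (z n) * w) powr b) \<le>
        (\<Sum>n\<in>F. 2 powr b * ((1 - cmod (z n)) powr a / ((1 - cmod w) + cmod (1 - cnj (z n) * w)) powr b))"
      by (rule sum_mono)
    also have "\<dots> = 2 powr b * (\<Sum>n\<in>F. (1 - cmod (z n)) powr a / ((1 - cmod w) + cmod (1 - cnj (z n) * w)) powr b)"
      by (simp add: sum_distrib_left)
    also have "\<dots> \<le> 2 powr b * (C1 * (1 - cmod w) powr (a - b))"
      using w F by (intro mult_left_mono C1(2)[rule_format]) auto
    finally show ?thesis by (simp add: mult_ac)
  qed
  moreover have "2 powr b * C1 > 0" using C1 by simp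
  ultimately show ?thesis by blast
qed

end

section \<open>Swept weights\<close>

text \<open>
  \<open>swept s a\<close> is the part of the real part of the compensating factor
  \<open>(1 - |a|\<^sup>2) / 2 * (1 + s cnj a x) / (1 - s cnj a x)\<close> which does not cancel against \<open>- log |b|\<close>
  for the Blaschke factor \<open>b\<close> with zero \<open>a\<close>.
\<close>

definition swept :: "real \<Rightarrow> complex \<Rightarrow> complex \<Rightarrow> real" where
  "swept s a x = (1 - (cmod a)\<^sup>2) / 2 * (cmod x)\<^sup>2 * (1 - s\<^sup>2 * (cmod a)\<^sup>2) / (cmod (1 - cnj a * (of_real s * x)))\<^sup>2"

lemma cmod_scaled_less_1:
  assumes "cmod x < 1" "0 \<le> s" "s \<le> 1"
  shows "cmod (of_real s * x) < 1" "cmod (of_real s * x) \<le> cmod x"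
proof -
  have "cmod (of_real s * x) = s * cmod x"
    using assms by (simp add: norm_mult)
  moreover have "s * cmod x \<le> cmod x"
    using assms by (simp add: mult_left_le_one_le)
  ultimately show "cmod (of_real s * x) < 1" "cmod (of_real s * x) \<le> cmod x"
    using assms by simp_all
qed

lemma cmod_one_minus_scaled_ge:
  assumes a: "cmod a < 1" and x: "cmod x < 1" and s: "0 \<le> s" "s < 1"
  shows "cmod (1 - cnj a * (of_real s * x)) \<ge> 1 - s"
    "cmod (1 - cnj a * x) \<le> 2 * cmod (1 - cnj a * (of_real s * x))"
proof -
  have "cmod (of_real s * x) \<le> s"
    using s x by (simp add: norm_mult mult_left_le)
  then show 1: "cmod (1 - cnj a * (of_real s * x)) \<ge> 1 - s"
    using cmod_one_minus_cnj_mult_ge(2)[of a "of_real s * x"] a s by simp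
  have "1 - cnj a * x = (1 - cnj a * (of_real s * x)) - of_real (1 - s) * (cnj a * x)"
    by (simp add: algebra_simps)
  then have "cmod (1 - cnj a * x) \<le> cmod (1 - cnj a * (of_real s * x)) + cmod (of_real (1 - s) * (cnj a * x))"
    using norm_triangle_ineq4 by metis
  also have "cmod (of_real (1 - s) * (cnj a * x)) = (1 - s) * (cmod a * cmod x)"
    unfolding norm_mult norm_of_real using s by simp
  also have "\<dots> \<le> (1 - s) * 1"
    using s a x by (intro mult_left_mono) (simp_all add: mult_le_one)
  finally show "cmod (1 - cnj a * x) \<le> 2 * cmod (1 - cnj a * (of_real s * x))"
    using 1 by simp
qed

lemma one_minus_sq_bounds:
  fixes r :: real
  assumes "0 \<le> r" "r \<le> 1"
  shows "1 - r \<le> 1 - r\<^sup>2" "1 - r\<^sup>2 \<le> 2 * (1 - r)"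
proof -
  have "1 - r\<^sup>2 = (1 + r) * (1 - r)" by (simp add: power2_eq_square algebra_simps)
  moreover have "1 * (1 - r) \<le> (1 + r) * (1 - r)" "(1 + r) * (1 - r) \<le> 2 * (1 - r)"
    using assms by (intro mult_right_mono; simp)+
  ultimately show "1 - r \<le> 1 - r\<^sup>2" "1 - r\<^sup>2 \<le> 2 * (1 - r)" by simp_all
qed

lemma one_minus_prod_sq_le:
  fixes r s :: real
  assumes "0 \<le> r" "r \<le> 1" "0 \<le> s" "s \<le> 1"
  shows "1 - s\<^sup>2 * r\<^sup>2 \<le> (1 - s\<^sup>2) + (1 - r\<^sup>2)" "0 \<le> 1 - s\<^sup>2 * r\<^sup>2"
proof -
  have "0 \<le> (1 - s\<^sup>2) * (1 - r\<^sup>2)" using assms by (intro mult_nonneg_nonneg) (auto simp: power_le_one)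
  then show "1 - s\<^sup>2 * r\<^sup>2 \<le> (1 - s\<^sup>2) + (1 - r\<^sup>2)" by (simp add: algebra_simps)
  have "s\<^sup>2 * r\<^sup>2 \<le> 1" using assms by (intro mult_le_one) (auto simp: power_le_one)
  then show "0 \<le> 1 - s\<^sup>2 * r\<^sup>2" by simp
qed

lemma swept_nonneg:
  assumes "cmod a < 1" "0 \<le> s" "s \<le> 1"
  shows "swept s a x \<ge> 0"
  unfolding swept_def using assms one_minus_prod_sq_le(2)[of "cmod a" s]
  by (intro divide_nonneg_nonneg mult_nonneg_nonneg) (auto simp: power_le_one)

lemma swept_coeff_le:
  assumes a: "cmod a < 1" and s: "0 \<le> s" "s < 1" and K: "1 - s \<le> K * (1 - cmod a)"
  shows "0 \<le> (1 - (cmod a)\<^sup>2) / 2 * (1 - s\<^sup>2 * (cmod a)\<^sup>2)"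
    "(1 - (cmod a)\<^sup>2) / 2 * (1 - s\<^sup>2 * (cmod a)\<^sup>2) \<le> 2 * (K + 1) * (1 - cmod a)\<^sup>2"
proof -
  have a': "0 \<le> cmod a" "cmod a \<le> 1" using a by auto
  note b = one_minus_sq_bounds[OF a'] one_minus_sq_bounds[of s] one_minus_prod_sq_le[OF a', of s]
  show "0 \<le> (1 - (cmod a)\<^sup>2) / 2 * (1 - s\<^sup>2 * (cmod a)\<^sup>2)"
    using b a s by (intro mult_nonneg_nonneg) auto
  have "1 - s\<^sup>2 * (cmod a)\<^sup>2 \<le> 2 * (1 - s) + 2 * (1 - cmod a)"
    using b s by linarith
  also have "\<dots> \<le> 2 * (K * (1 - cmod a)) + 2 * (1 - cmod a)" using K by simp
  also have "\<dots> = 2 * (K + 1) * (1 - cmod a)" by (simp add: algebra_simps)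
  finally have "(1 - (cmod a)\<^sup>2) / 2 * (1 - s\<^sup>2 * (cmod a)\<^sup>2) \<le> (1 - cmod a) * (2 * (K + 1) * (1 - cmod a))"
    using b a s by (intro mult_mono) auto
  then show "(1 - (cmod a)\<^sup>2) / 2 * (1 - s\<^sup>2 * (cmod a)\<^sup>2) \<le> 2 * (K + 1) * (1 - cmod a)\<^sup>2"
    by (simp add: power2_eq_square mult_ac)
qed

lemma swept_le:
  assumes a: "cmod a < 1" and x: "cmod x < 1" and s: "0 \<le> s" "s < 1" and K: "1 - s \<le> K * (1 - cmod a)"
  shows "swept s a x \<le> 8 * (K + 1) * (1 - cmod a)\<^sup>2 / (cmod (1 - cnj a * x))\<^sup>2"
proof -
  define X where "X = cmod (1 - cnj a * (of_real s * x))"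
  have X: "X > 0" "cmod (1 - cnj a * x) \<le> 2 * X"
    using cmod_one_minus_scaled_ge[OF a x s] s by (auto simp: X_def)
  have x0: "cmod (1 - cnj a * x) > 0" by (rule cmod_one_minus_cnj_mult_pos[OF a x])
  have "swept s a x = (1 - (cmod a)\<^sup>2) / 2 * (1 - s\<^sup>2 * (cmod a)\<^sup>2) * (cmod x)\<^sup>2 / X\<^sup>2"
    by (simp add: swept_def X_def)
  also have "\<dots> \<le> (2 * (K + 1) * (1 - cmod a)\<^sup>2) * 1 / X\<^sup>2"
  proof (intro divide_right_mono)
    define c where "c = (1 - (cmod a)\<^sup>2) / 2 * (1 - s\<^sup>2 * (cmod a)\<^sup>2)"
    have "c * (cmod x)\<^sup>2 \<le> c * 1"
      using swept_coeff_le(1)[OF a s K] x by (intro mult_left_mono) (auto simp: c_def power_le_one)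
    also have "\<dots> \<le> (2 * (K + 1) * (1 - cmod a)\<^sup>2) * 1"
      using swept_coeff_le(2)[OF a s K] by (simp add: c_def)
    finally show "(1 - (cmod a)\<^sup>2) / 2 * (1 - s\<^sup>2 * (cmod a)\<^sup>2) * (cmod x)\<^sup>2 \<le> (2 * (K + 1) * (1 - cmod a)\<^sup>2) * 1"
      by (simp only: c_def)
  qed simp
  also have "\<dots> = 8 * (K + 1) * (1 - cmod a)\<^sup>2 / (2 * X)\<^sup>2"
    using X(1) by (simp add: field_simps power2_eq_square)
  also have "\<dots> \<le> 8 * (K + 1) * (1 - cmod a)\<^sup>2 / (cmod (1 - cnj a * x))\<^sup>2"
  proof (intro divide_left_mono mult_pos_pos zero_less_power power_mono)
    have "0 < K * (1 - cmod a)" using K s by linarith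
    then have "0 < K" using a by (simp add: zero_less_mult_iff)
    then show "0 \<le> 8 * (K + 1) * (1 - cmod a)\<^sup>2" by simp
    show "0 < X" by (rule X(1))
  qed (use X(2) x0 in simp_all)
  finally show ?thesis .
qed

text \<open>The kernel is smooth on the scale \<open>1 - s\<close>. If \<open>x\<close> and
  \<open>w\<close> are no farther apart than that scale, the denominators \<open>X\<close> and
  \<open>Y\<close> are comparable, and a mean value estimate gains a factor
  \<open>t / X\<close>.\<close>

lemma swept_diff_le:
  assumes a: "cmod a < 1" and x: "cmod x < 1" and w: "cmod w < 1" and s: "0 \<le> s" "s < 1"
    and K: "1 - s \<le> K * (1 - cmod a)" and t: "t = cmod (1 - cnj w * x)" "t \<le> 2 * (1 - s)"
  shows "swept s a x - swept s a w \<le> 9216 * (K + 1) * t * ((1 - cmod a)\<^sup>2 / (t + cmod (1 - cnj a * x)) ^ 3)"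
proof -
  define X where "X = cmod (1 - cnj a * (of_real s * x))"
  define Y where "Y = cmod (1 - cnj a * (of_real s * w))"
  define c where "c = (1 - (cmod a)\<^sup>2) / 2 * (1 - s\<^sup>2 * (cmod a)\<^sup>2)"
  have t0: "t > 0" using cmod_one_minus_cnj_mult_pos[OF w x] t by simp
  have X: "1 - s \<le> X" "cmod (1 - cnj a * x) \<le> 2 * X" and Y: "1 - s \<le> Y"
    using cmod_one_minus_scaled_ge[OF a x s] cmod_one_minus_scaled_ge[OF a w s] by (auto simp: X_def Y_def)
  have X0: "X > 0" and Y0: "Y > 0" using X Y s by auto
  have "cmod (of_real s * x) < 1" using cmod_scaled_less_1[OF x] s by simp
  then have X2: "X \<le> 2" unfolding X_def by (intro cmod_one_minus_cnj_mult_le_2 a)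
  have xw: "cmod (x - w) \<le> t"
    using cmod_diff_le[OF w x] t by (simp add: norm_minus_commute)
  have XY: "\<bar>X - Y\<bar> \<le> t"
  proof -
    have "\<bar>X - Y\<bar> \<le> cmod ((1 - cnj a * (of_real s * x)) - (1 - cnj a * (of_real s * w)))"
      unfolding X_def Y_def by (rule norm_triangle_ineq3)
    also have "(1 - cnj a * (of_real s * x)) - (1 - cnj a * (of_real s * w)) = cnj a * (of_real s * (w - x))"
      by (simp add: algebra_simps)
    also have "cmod \<dots> = cmod a * s * cmod (x - w)"
      unfolding norm_mult using s by (simp add: norm_minus_commute)
    also have "\<dots> \<le> 1 * cmod (x - w)"
      using a s by (intro mult_right_mono mult_le_one) auto
    finally show ?thesis using xw by simp
  qed
  have Y3: "Y \<le> 3 * X" and X3: "X \<le> 3 * Y" using XY X Y t by auto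
  have "1 / Y \<le> 3 / X" using X3 X0 Y0 by (simp add: field_simps)
  then have "(1 / Y)\<^sup>2 \<le> (3 / X)\<^sup>2" using Y0 by (intro power_mono) auto
  then have Y9: "1 / Y\<^sup>2 \<le> 9 / X\<^sup>2" by (simp add: power_divide)
  have e1: "(cmod x)\<^sup>2 * (1 / X\<^sup>2 - 1 / Y\<^sup>2) \<le> 36 * t / X ^ 3"
  proof -
    have "1 / X\<^sup>2 - 1 / Y\<^sup>2 = (Y - X) * (X + Y) / X\<^sup>2 * (1 / Y\<^sup>2)"
      using X0 Y0 by (simp add: field_simps power2_eq_square)
    also have "\<dots> \<le> \<bar>(Y - X) * (X + Y) / X\<^sup>2 * (1 / Y\<^sup>2)\<bar>" by (rule abs_ge_self)
    also have "\<dots> = \<bar>X - Y\<bar> * (X + Y) / X\<^sup>2 * (1 / Y\<^sup>2)"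
      using X0 Y0 by (simp add: abs_mult abs_minus_commute)
    also have "\<dots> \<le> t * (4 * X) / X\<^sup>2 * (9 / X\<^sup>2)"
      using XY Y3 X0 Y0 Y9 t0 by (intro mult_mono divide_right_mono) auto
    also have "\<dots> = 36 * t / X ^ 3"
      using X0 by (simp add: power2_eq_square power3_eq_cube)
    finally have "1 / X\<^sup>2 - 1 / Y\<^sup>2 \<le> 36 * t / X ^ 3" .
    then have "(cmod x)\<^sup>2 * (1 / X\<^sup>2 - 1 / Y\<^sup>2) \<le> (cmod x)\<^sup>2 * (36 * t / X ^ 3)"
      by (intro mult_left_mono) auto
    also have "\<dots> \<le> 1 * (36 * t / X ^ 3)"
      using x t0 X0 by (intro mult_right_mono) (auto simp: power_le_one)
    finally show ?thesis by simp
  qed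
  have e2: "((cmod x)\<^sup>2 - (cmod w)\<^sup>2) / Y\<^sup>2 \<le> 36 * t / X ^ 3"
  proof -
    have "(cmod x)\<^sup>2 - (cmod w)\<^sup>2 = (cmod x - cmod w) * (cmod x + cmod w)"
      by (simp add: power2_eq_square algebra_simps)
    also have "\<dots> \<le> t * 2"
      using norm_triangle_ineq2[of x w] xw x w t0 by (intro mult_mono) auto
    finally have "((cmod x)\<^sup>2 - (cmod w)\<^sup>2) / Y\<^sup>2 \<le> (t * 2) / Y\<^sup>2"
      by (intro divide_right_mono) auto
    also have "\<dots> = (t * 2) * (1 / Y\<^sup>2)" by simp
    also have "\<dots> \<le> (t * 2) * (9 / X\<^sup>2)" using Y9 t0 by (intro mult_left_mono) auto
    also have "\<dots> = 18 * t * X / X ^ 3"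
      using X0 by (simp add: power2_eq_square power3_eq_cube)
    also have "\<dots> \<le> 18 * t * 2 / X ^ 3"
      using X0 X2 t0 by (intro divide_right_mono mult_left_mono) auto
    finally show ?thesis by simp
  qed
  have "swept s a x = c * ((cmod x)\<^sup>2 / X\<^sup>2)" "swept s a w = c * ((cmod w)\<^sup>2 / Y\<^sup>2)"
    by (simp_all add: swept_def c_def X_def Y_def mult_ac)
  then have "swept s a x - swept s a w = c * ((cmod x)\<^sup>2 / X\<^sup>2 - (cmod w)\<^sup>2 / Y\<^sup>2)"
    by (simp only: right_diff_distrib)
  also have "(cmod x)\<^sup>2 / X\<^sup>2 - (cmod w)\<^sup>2 / Y\<^sup>2 = (cmod x)\<^sup>2 * (1 / X\<^sup>2 - 1 / Y\<^sup>2) + ((cmod x)\<^sup>2 - (cmod w)\<^sup>2) / Y\<^sup>2"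
    by (simp add: algebra_simps diff_divide_distrib)
  also have "c * \<dots> \<le> c * (72 * t / X ^ 3)"
    using e1 e2 swept_coeff_le(1)[OF a s K] by (intro mult_left_mono) (auto simp: c_def)
  also have "\<dots> \<le> (2 * (K + 1) * (1 - cmod a)\<^sup>2) * (72 * t / X ^ 3)"
    using swept_coeff_le[OF a s K] t0 X0 by (intro mult_right_mono) (auto simp: c_def)
  \<comment> \<open>The constant is \<open>2 * 72 * 4 ^ 3\<close>; the power of 4 prepares for
    \<open>t + |1 - cnj a x| \<le> 4 X\<close>.\<close>
  also have "\<dots> = 9216 * (K + 1) * t * (1 - cmod a)\<^sup>2 / (4 * X) ^ 3"
    using X0 by (simp add: power_mult_distrib field_simps)
  also have "\<dots> \<le> 9216 * (K + 1) * t * (1 - cmod a)\<^sup>2 / (t + cmod (1 - cnj a * x)) ^ 3"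
  proof (intro divide_left_mono mult_pos_pos zero_less_power power_mono)
    show "t + cmod (1 - cnj a * x) \<le> 4 * X"
    proof -
      have "t \<le> 2 * X" using X(1) t(2) by simp
      from add_mono[OF this X(2)] show ?thesis by simp
    qed
    show "t + cmod (1 - cnj a * x) > 0" using t0 by (simp add: add_pos_nonneg)
    have "0 < K * (1 - cmod a)" using K s by linarith
    then have "0 < K" using a by (simp add: zero_less_mult_iff)
    then show "0 \<le> 9216 * (K + 1) * t * (1 - cmod a)\<^sup>2" using t0 by simp
  qed (use X0 t0 in auto)
  finally show ?thesis by simp
qed

section \<open>Layers of the weight\<close>

context thin_sequence
begin

text \<open>A layer consists of points with a common \<open>\<eta> = 1 - s\<close>. Where
  \<open>|1 - cnj z \<zeta>| \<le> Y \<eta>\<close>, the term is at most a factor near 1 times the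
  truncated \<open>R - \<rho>\<close>, and the density hypothesis applies; the other points form a
  tail of bounded sum. That \<open>C\<close> does not depend on \<open>\<beta>\<close> allows
  \<open>\<beta>\<close> to be chosen after \<open>C\<close>.\<close>

lemma layer_sum_le:
  assumes \<epsilon>: "0 < \<epsilon>" "\<epsilon> \<le> 1 / 12"
  shows "\<exists>C. \<forall>\<beta> \<eta> F x. \<beta> \<ge> 1 / (1 - r0) \<longrightarrow> 0 < \<eta> \<longrightarrow> \<eta> \<le> 1 \<longrightarrow> cmod x < 1 \<longrightarrow> finite F \<longrightarrow> F \<subseteq> I \<longrightarrow>
     (\<forall>n\<in>F. \<eta> / \<beta> \<le> 2 / \<epsilon> * (1 - cmod (z n)) \<and> 2 / \<epsilon> * (1 - cmod (z n)) \<le> \<eta>) \<longrightarrow>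
     (\<Sum>n\<in>F. swept (1 - \<eta>) (z n) x) \<le> (1 + \<epsilon>) / (1 - \<epsilon>) * (p * ((1 + 4 * \<epsilon>) * ln \<beta>)) + C"
proof -
  obtain C1 where C1: "C1 > 0" "\<forall>w \<tau> F. cmod w < 1 \<longrightarrow> 0 < \<tau> \<longrightarrow> finite F \<longrightarrow> F \<subseteq> I \<longrightarrow>
     (\<Sum>n\<in>F. (1 - cmod (z n)) powr (1 + \<epsilon>) / (\<tau> + cmod (1 - cnj (z n) * w)) powr 2) \<le> C1 * \<tau> powr ((1 + \<epsilon>) - 2)"
    using sum_kernel_le[of "1 + \<epsilon>" 2] \<epsilon> by auto
  define Q where "Q = 2 / \<epsilon>"
  have Q: "Q > 0" using \<epsilon> by (simp add: Q_def)
  define A where "A = (1 + \<epsilon>) / (1 - \<epsilon>)"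
  have A: "A \<ge> 0" using \<epsilon> by (simp add: A_def)
  define C where "C = A * (p * ln (2 * Q / \<epsilon>)) + 16 * Q powr \<epsilon> * C1"
  have "(\<Sum>n\<in>F. swept (1 - \<eta>) (z n) x) \<le> A * (p * ((1 + 4 * \<epsilon>) * ln \<beta>)) + C"
    if \<beta>: "\<beta> \<ge> 1 / (1 - r0)" and \<eta>: "0 < \<eta>" "\<eta> \<le> 1" and x: "cmod x < 1" and F: "finite F" "F \<subseteq> I"
      and layer: "\<forall>n\<in>F. \<eta> / \<beta> \<le> 2 / \<epsilon> * (1 - cmod (z n)) \<and> 2 / \<epsilon> * (1 - cmod (z n)) \<le> \<eta>"
    for \<beta> \<eta> F x
  proof -
    have "1 \<le> 1 / (1 - r0)" using r0 by simp
    then have \<beta>1: "\<beta> \<ge> 1" using \<beta> by linarith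
    define s where "s = 1 - \<eta>"
    have s: "0 \<le> s" "s < 1" using \<eta> by (auto simp: s_def)
    define \<zeta> where "\<zeta> = of_real s * x"
    have \<zeta>: "cmod \<zeta> < 1" unfolding \<zeta>_def using cmod_scaled_less_1[OF x] s by simp
    \<comment> \<open>The exponent balances two losses: \<open>Y\<^sup>2\<close> adds only
      \<open>4 \<epsilon> ln \<beta>\<close> to the main term, while the tail is bounded by a
      multiple of \<open>\<beta> powr \<epsilon> * Y powr (\<epsilon> - 1)\<close>, which is at most
      1.\<close>
    define Y where "Y = \<beta> powr (2 * \<epsilon>)"
    have Y: "Y \<ge> 1" unfolding Y_def using \<beta>1 \<epsilon> by (intro ge_one_powr_ge_zero) auto
    define X where "X = (\<lambda>n. cmod (1 - cnj (z n) * \<zeta>))"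
    \<comment> \<open>\<open>1 - R\<close> is \<open>\<epsilon>\<close> times a lower bound for the
      kernel at the near points. Hence \<open>1 - R \<le> \<epsilon> (1 - \<rho>)\<close> there, and
      truncation at \<open>R\<close> costs only a factor \<open>1 - \<epsilon>\<close>.\<close>
    define R where "R = 1 - \<epsilon> / (2 * \<beta> * Q * Y\<^sup>2)"
    have den: "2 * \<beta> * Q * Y\<^sup>2 > 0" using \<beta>1 Q Y by simp
    have R: "r0 < R" "R < 1"
    proof -
      have "\<beta> * (2 * Q) \<le> \<beta> * (2 * Q) * Y\<^sup>2" using Y \<beta>1 Q by simp
      moreover have "1 / (1 - r0) * (2 * Q) \<le> \<beta> * (2 * Q)"
        using \<beta> Q by (intro mult_right_mono) auto
      ultimately have "1 / (1 - r0) * (2 * Q) \<le> 2 * \<beta> * Q * Y\<^sup>2" by (simp add: mult_ac)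
      moreover have "\<epsilon> < 2 * Q"
      proof -
        have "\<epsilon> * \<epsilon> \<le> 1 * 1" using \<epsilon> by (intro mult_mono) auto
        then show ?thesis using \<epsilon> by (simp add: Q_def less_divide_eq)
      qed
      ultimately have "1 / (1 - r0) * \<epsilon> < 2 * \<beta> * Q * Y\<^sup>2"
        using r0 mult_strict_left_mono[of \<epsilon> "2 * Q" "1 / (1 - r0)"] by simp
      then have "\<epsilon> < (1 - r0) * (2 * \<beta> * Q * Y\<^sup>2)"
        using r0 by (simp add: divide_less_eq mult.commute)
      then have "\<epsilon> / (2 * \<beta> * Q * Y\<^sup>2) < 1 - r0"
        by (subst pos_divide_less_eq[OF den])
      then show "r0 < R" by (simp add: R_def)
      show "R < 1" using den \<epsilon> by (simp add: R_def)
    qed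
    have facts: "cmod (z n) < 1" "(1 - cmod (z n)) * Q \<le> \<eta>" "\<eta> \<le> \<beta> * Q * (1 - cmod (z n))" "X n \<ge> \<eta>"
      "swept s (z n) x \<le> (1 + \<epsilon>) * ((1 - (cmod (z n))\<^sup>2) * (1 - s\<^sup>2) / (X n)\<^sup>2 / 2)"
      "(1 - (cmod (z n))\<^sup>2) * (1 - s\<^sup>2) / (X n)\<^sup>2 \<le> 1 - (pseudohyp (z n) \<zeta>)\<^sup>2"
      if n: "n \<in> F" for n
    proof -
      show zn: "cmod (z n) < 1" using in_disc n F by auto
      show Qn: "(1 - cmod (z n)) * Q \<le> \<eta>" using layer n by (simp add: Q_def mult.commute)
      show "\<eta> \<le> \<beta> * Q * (1 - cmod (z n))"
      proof -
        have "\<eta> / \<beta> \<le> Q * (1 - cmod (z n))" using layer n by (simp add: Q_def)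
        then show ?thesis using \<beta>1 by (simp add: divide_le_eq mult_ac)
      qed
      show Xn: "X n \<ge> \<eta>"
        using cmod_one_minus_scaled_ge(1)[OF zn x s] by (simp add: X_def \<zeta>_def s_def)
      note b = one_minus_sq_bounds[of "cmod (z n)"] one_minus_sq_bounds[of s] one_minus_prod_sq_le[of "cmod (z n)" s]
      have "1 - (cmod (z n))\<^sup>2 \<le> \<epsilon> * \<eta>"
      proof -
        have "2 * (1 - cmod (z n)) \<le> \<epsilon> * \<eta>" using Qn \<epsilon> by (simp add: Q_def field_simps)
        then show ?thesis using b zn by auto
      qed
      also have "\<epsilon> * \<eta> \<le> \<epsilon> * (1 - s\<^sup>2)"
        using b s \<epsilon> by (intro mult_left_mono) (auto simp: s_def)
      finally have c: "1 - s\<^sup>2 * (cmod (z n))\<^sup>2 \<le> (1 + \<epsilon>) * (1 - s\<^sup>2)"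
        using b zn s by (simp add: algebra_simps)
      have zn0: "0 \<le> 1 - (cmod (z n))\<^sup>2" using one_minus_cmod_sq_pos[OF zn] by simp
      have "swept s (z n) x = (1 - (cmod (z n))\<^sup>2) / 2 * (cmod x)\<^sup>2 * (1 - s\<^sup>2 * (cmod (z n))\<^sup>2) / (X n)\<^sup>2"
        by (simp add: swept_def X_def \<zeta>_def)
      also have "\<dots> \<le> (1 - (cmod (z n))\<^sup>2) / 2 * 1 * ((1 + \<epsilon>) * (1 - s\<^sup>2)) / (X n)\<^sup>2"
        using zn0 x c b(6) zn s by (intro divide_right_mono mult_mono) (auto simp: power_le_one)
      finally show "swept s (z n) x \<le> (1 + \<epsilon>) * ((1 - (cmod (z n))\<^sup>2) * (1 - s\<^sup>2) / (X n)\<^sup>2 / 2)"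
        by (simp add: mult_ac)
      have "(cmod \<zeta>)\<^sup>2 \<le> s\<^sup>2"
        using x s by (intro power_mono) (auto simp: \<zeta>_def norm_mult mult_left_le)
      then have "(1 - (cmod (z n))\<^sup>2) * (1 - s\<^sup>2) / (X n)\<^sup>2 \<le> (1 - (cmod (z n))\<^sup>2) * (1 - (cmod \<zeta>)\<^sup>2) / (X n)\<^sup>2"
        using zn0 by (intro divide_right_mono mult_left_mono) auto
      then show "(1 - (cmod (z n))\<^sup>2) * (1 - s\<^sup>2) / (X n)\<^sup>2 \<le> 1 - (pseudohyp (z n) \<zeta>)\<^sup>2"
        using one_minus_pseudohyp_sq[OF zn \<zeta>] by (simp add: X_def)
    qed
    have near: "swept s (z n) x \<le> A * max 0 (R - pseudohyp (z n) \<zeta>)" if n: "n \<in> F" "X n \<le> Y * \<eta>" for n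
    proof -
      define \<rho> where "\<rho> = pseudohyp (z n) \<zeta>"
      have \<rho>: "1 - \<rho>\<^sup>2 \<le> 2 * (1 - \<rho>)"
        using one_minus_sq_bounds(2)[of \<rho>] pseudohyp_less_1[OF facts(1)[OF n(1)] \<zeta>] pseudohyp_nonneg[of "z n" \<zeta>]
        by (simp add: \<rho>_def)
      define V where "V = (1 - (cmod (z n))\<^sup>2) * (1 - s\<^sup>2) / (X n)\<^sup>2 / 2"
      have V1: "V \<le> 1 - \<rho>" using facts(6)[OF n(1)] \<rho> by (simp add: V_def \<rho>_def)
      have "\<epsilon> / (2 * \<beta> * Q * Y\<^sup>2) = \<epsilon> * ((\<eta> / (\<beta> * Q)) * \<eta> / (Y * \<eta>)\<^sup>2 / 2)"
        using \<eta> by (simp add: power2_eq_square)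
      also have "\<dots> \<le> \<epsilon> * V"
        unfolding V_def
      proof (intro mult_left_mono divide_right_mono frac_le mult_mono power_mono)
        have "\<eta> / (\<beta> * Q) \<le> 1 - cmod (z n)"
          using facts(3)[OF n(1)] \<beta>1 Q by (simp add: divide_le_eq mult_ac)
        then show "\<eta> / (\<beta> * Q) \<le> 1 - (cmod (z n))\<^sup>2"
          using one_minus_sq_bounds(1)[of "cmod (z n)"] facts(1)[OF n(1)] by simp
        show "\<eta> \<le> 1 - s\<^sup>2" using one_minus_sq_bounds(1)[of s] s by (simp add: s_def)
        show "0 \<le> 1 - (cmod (z n))\<^sup>2" using one_minus_cmod_sq_pos[OF facts(1)[OF n(1)]] by simp
        then show "0 \<le> (1 - (cmod (z n))\<^sup>2) * (1 - s\<^sup>2)"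
          using s by (intro mult_nonneg_nonneg) (auto simp: power_le_one)
        show "0 < (X n)\<^sup>2" using facts(4)[OF n(1)] \<eta> by simp
        show "X n \<le> Y * \<eta>" by (rule n(2))
      qed (use \<epsilon> \<eta> \<beta>1 Q facts(4)[OF n(1)] in auto)
      also have "\<dots> \<le> \<epsilon> * (1 - \<rho>)" using V1 \<epsilon> by (intro mult_left_mono) auto
      finally have "(1 - \<epsilon>) * (1 - \<rho>) \<le> R - \<rho>" by (simp add: R_def algebra_simps)
      then have "1 - \<rho> \<le> (R - \<rho>) / (1 - \<epsilon>)"
        using \<epsilon> by (subst pos_le_divide_eq) (auto simp: mult.commute)
      also have "\<dots> \<le> max 0 (R - \<rho>) / (1 - \<epsilon>)"
        using \<epsilon> by (intro divide_right_mono) auto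
      finally have "(1 + \<epsilon>) * V \<le> (1 + \<epsilon>) * (max 0 (R - \<rho>) / (1 - \<epsilon>))"
        using V1 \<epsilon> by (intro mult_left_mono) auto
      then show ?thesis
        using facts(5)[OF n(1)] by (simp add: V_def A_def \<rho>_def)
    qed
    \<comment> \<open>The kernel estimate needs a power of \<open>1 - |z|\<close> above the first.
      The additional \<open>(1 - |z|) powr \<epsilon>\<close> is paid for by
      \<open>1 / (1 - |z|) \<le> \<beta> Q / \<eta>\<close>, valid in the layer.\<close>
    define D where "D = 16 * \<eta> * (\<beta> * Q / \<eta>) powr \<epsilon>"
    have D: "D \<ge> 0" using \<eta> by (simp add: D_def)
    have far: "swept s (z n) x \<le> D * ((1 - cmod (z n)) powr (1 + \<epsilon>) / (Y * \<eta> + X n) powr 2)"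
      if n: "n \<in> F" "X n > Y * \<eta>" for n
    proof -
      define r where "r = cmod (z n)"
      have r: "0 \<le> r" "r < 1" using facts(1)[OF n(1)] by (auto simp: r_def)
      have X0: "X n > 0" using facts(4)[OF n(1)] \<eta> by simp
      have "swept s (z n) x \<le> (1 + \<epsilon>) * ((1 - r\<^sup>2) * (1 - s\<^sup>2) / (X n)\<^sup>2 / 2)"
        using facts(5)[OF n(1)] by (simp add: r_def)
      also have "\<dots> \<le> 2 * ((2 * (1 - r)) * (2 * \<eta>) / (X n)\<^sup>2 / 2)"
        using one_minus_sq_bounds[of r] one_minus_sq_bounds[of s] r s \<epsilon> \<eta>
        by (intro mult_mono divide_right_mono) (auto simp: s_def power_le_one intro!: divide_nonneg_nonneg mult_nonneg_nonneg)
      also have "\<dots> = 16 * \<eta> * (1 - r) / (2 * X n)\<^sup>2" by (simp add: power_mult_distrib)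
      also have "\<dots> \<le> 16 * \<eta> * ((1 - r) powr (1 + \<epsilon>) * (\<beta> * Q / \<eta>) powr \<epsilon>) / (Y * \<eta> + X n)\<^sup>2"
      proof (intro frac_le mult_left_mono power_mono)
        have "1 / (1 - r) \<le> \<beta> * Q / \<eta>"
          using facts(3)[OF n(1)] r \<eta> by (simp add: r_def field_simps)
        then have "(1 / (1 - r)) powr \<epsilon> \<le> (\<beta> * Q / \<eta>) powr \<epsilon>"
          using r \<epsilon> by (intro powr_mono2) auto
        then have "(1 - r) powr (1 + \<epsilon>) * (1 / (1 - r)) powr \<epsilon> \<le> (1 - r) powr (1 + \<epsilon>) * (\<beta> * Q / \<eta>) powr \<epsilon>"
          by (intro mult_left_mono) auto
        moreover have "(1 - r) powr (1 + \<epsilon>) * (1 / (1 - r)) powr \<epsilon> = 1 - r"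
          using r by (simp add: powr_add powr_divide)
        ultimately show "1 - r \<le> (1 - r) powr (1 + \<epsilon>) * (\<beta> * Q / \<eta>) powr \<epsilon>" by simp
        have "0 < Y * \<eta> + X n" using Y \<eta> X0 by (intro add_pos_pos) auto
        then show "0 < (Y * \<eta> + X n)\<^sup>2" by simp
        show "Y * \<eta> + X n \<le> 2 * X n" using n(2) by simp
      qed (use Y \<eta> X0 in auto)
      also have "(Y * \<eta> + X n)\<^sup>2 = (Y * \<eta> + X n) powr 2"
      proof -
        have "Y * \<eta> + X n > 0" using Y \<eta> X0 by (intro add_pos_pos) auto
        then show ?thesis by simp
      qed
      finally show ?thesis by (simp add: D_def r_def mult_ac)
    qed
    define F1 F2 where "F1 = {n\<in>F. X n \<le> Y * \<eta>}" and "F2 = {n\<in>F. X n > Y * \<eta>}"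
    have split: "F = F1 \<union> F2" "F1 \<inter> F2 = {}" "finite F1" "finite F2" "F1 \<subseteq> I" "F2 \<subseteq> I" "F1 \<subseteq> F" "F2 \<subseteq> F"
      using F by (auto simp: F1_def F2_def)
    have "(\<Sum>n\<in>F1. swept s (z n) x) \<le> (\<Sum>n\<in>F1. A * max 0 (R - pseudohyp (z n) \<zeta>))"
      by (intro sum_mono near) (auto simp: F1_def)
    also have "\<dots> = A * (\<Sum>n\<in>F1. max 0 (R - pseudohyp (z n) \<zeta>))" by (simp add: sum_distrib_left)
    also have "\<dots> \<le> A * (p * ln (1 / (1 - R)))"
      using A split R \<zeta> by (intro mult_left_mono density) auto
    also have "1 / (1 - R) = \<beta> * (Y * Y) * (2 * Q / \<epsilon>)"
      by (simp add: R_def power2_eq_square mult_ac)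
    also have "ln \<dots> = ln \<beta> + (ln Y + ln Y) + ln (2 * Q / \<epsilon>)"
    proof -
      have "\<beta> > 0" "Y > 0" "2 * Q / \<epsilon> > 0" using \<beta>1 Y Q \<epsilon> by auto
      then show ?thesis by (simp only: ln_mult_pos mult_pos_pos)
    qed
    also have "ln Y = 2 * \<epsilon> * ln \<beta>" using \<beta>1 by (simp add: Y_def ln_powr)
    finally have S1: "(\<Sum>n\<in>F1. swept s (z n) x) \<le> A * (p * ((1 + 4 * \<epsilon>) * ln \<beta>)) + A * (p * ln (2 * Q / \<epsilon>))"
      by (simp add: algebra_simps)
    have "(\<Sum>n\<in>F2. swept s (z n) x) \<le> (\<Sum>n\<in>F2. D * ((1 - cmod (z n)) powr (1 + \<epsilon>) / (Y * \<eta> + X n) powr 2))"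
      by (intro sum_mono far) (auto simp: F2_def)
    also have "\<dots> = D * (\<Sum>n\<in>F2. (1 - cmod (z n)) powr (1 + \<epsilon>) / (Y * \<eta> + X n) powr 2)"
      by (simp add: sum_distrib_left)
    also have "\<dots> \<le> D * (C1 * (Y * \<eta>) powr ((1 + \<epsilon>) - 2))"
      unfolding X_def using D \<zeta> split Y \<eta> by (intro mult_left_mono C1(2)[rule_format]) auto
    also have "\<dots> = 16 * Q powr \<epsilon> * C1 * (\<beta> powr \<epsilon> * Y powr (\<epsilon> - 1))"
    proof -
      have "\<eta> * (\<beta> * Q / \<eta>) powr \<epsilon> * (Y * \<eta>) powr (\<epsilon> - 1) = \<beta> powr \<epsilon> * Q powr \<epsilon> * Y powr (\<epsilon> - 1)"
        using \<eta> Y by (simp add: powr_mult powr_divide powr_diff abs_mult)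
      then show ?thesis by (simp add: D_def mult_ac)
    qed
    also have "\<beta> powr \<epsilon> * Y powr (\<epsilon> - 1) = \<beta> powr (\<epsilon> * (2 * \<epsilon> - 1))"
      by (simp add: Y_def powr_powr algebra_simps flip: powr_add)
    also have "\<dots> \<le> \<beta> powr 0"
      using \<beta>1 \<epsilon> by (intro powr_mono) (auto simp: mult_nonneg_nonpos)
    also have "\<beta> powr 0 = 1" using \<beta>1 by simp
    finally have S2: "(\<Sum>n\<in>F2. swept s (z n) x) \<le> 16 * Q powr \<epsilon> * C1"
      using C1 by (simp add: mult_left_mono)
    have "(\<Sum>n\<in>F. swept s (z n) x) = (\<Sum>n\<in>F1. swept s (z n) x) + (\<Sum>n\<in>F2. swept s (z n) x)"
      unfolding split(1) using split(2-4) by (intro sum.union_disjoint) auto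
    then show ?thesis using S1 S2 unfolding C_def s_def by linarith
  qed
  then show ?thesis unfolding A_def by blast
qed


text \<open>Layer 0 also receives every \<open>t > 1\<close>, for which no power of
  \<open>1 / \<beta>\<close> is an upper bound; hence the exceptional case.\<close>

lemma layer_index_exists:
  fixes \<beta> t :: real
  assumes \<beta>: "\<beta> > 1" and t: "t > 0"
  shows "\<exists>j::nat. (1 / \<beta>) ^ j / \<beta> < t \<and> (j = 0 \<or> t \<le> (1 / \<beta>) ^ j)"
proof -
  define i where "i = (LEAST i. (1 / \<beta>) ^ i < t)"
  have "\<exists>i. (1 / \<beta>) ^ i < t"
    using real_arch_pow_inv[of t "1 / \<beta>"] t \<beta> by auto
  then have i: "(1 / \<beta>) ^ i < t"
    unfolding i_def by (rule LeastI_ex)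
  show ?thesis
  proof (cases i)
    case 0
    have "1 / \<beta> < 1" using \<beta> by simp
    then have "1 / \<beta> < t" using i 0 by simp
    then show ?thesis by (intro exI[of _ 0]) simp
  next
    case (Suc j)
    have "\<not> (1 / \<beta>) ^ j < t"
      using not_less_Least[of j "\<lambda>i. (1 / \<beta>) ^ i < t"] Suc by (simp add: i_def)
    moreover have "(1 / \<beta>) ^ j / \<beta> < t"
      using i by (simp add: Suc)
    ultimately show ?thesis by (intro exI[of _ j]) simp
  qed
qed

text \<open>The exponents lie in an interval of length \<open>ln (U / L) / ln \<beta>\<close>.
  Counting both ends may add one integer, which is the extra \<open>ln \<beta>\<close>.\<close>

lemma card_mult_ln_le:
  fixes \<beta> L U :: real
  assumes \<beta>: "\<beta> > 1" and J: "finite J" and LU: "0 < L" "L \<le> U"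
    and mem: "\<And>k. k \<in> J \<Longrightarrow> L \<le> (1 / \<beta>) ^ k \<and> (1 / \<beta>) ^ k \<le> U"
  shows "real (card J) * ln \<beta> \<le> ln (U / L) + ln \<beta>"
proof (cases "J = {}")
  case True
  have "1 \<le> U / L" using LU by simp
  then show ?thesis using True \<beta> by simp
next
  case False
  define a b where "a = Min J" and "b = Max J"
  have ab: "a \<in> J" "b \<in> J" "a \<le> b" "J \<subseteq> {a..b}"
    using J False by (auto simp: a_def b_def)
  have "card J \<le> card {a..b}" using ab by (intro card_mono) auto
  then have "card J \<le> (b - a) + 1" using ab by simp
  then have "real (card J) \<le> real (b - a) + 1" by linarith
  then have "real (card J) * ln \<beta> \<le> (real (b - a) + 1) * ln \<beta>"
    using \<beta> by (intro mult_right_mono) auto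
  also have "\<dots> = ln (\<beta> ^ (b - a)) + ln \<beta>"
    using \<beta> by (simp add: ln_realpow algebra_simps)
  also have "\<beta> ^ (b - a) = (1 / \<beta>) ^ a / (1 / \<beta>) ^ b"
    using \<beta> ab by (simp add: power_diff power_divide)
  also have "ln ((1 / \<beta>) ^ a / (1 / \<beta>) ^ b) \<le> ln (U / L)"
  proof -
    have "(1 / \<beta>) ^ a / (1 / \<beta>) ^ b \<le> U / L"
      using mem[OF ab(1)] mem[OF ab(2)] LU \<beta> by (intro frac_le) auto
    moreover have "(1 / \<beta>) ^ a / (1 / \<beta>) ^ b > 0" using \<beta> by simp
    ultimately show ?thesis by simp
  qed
  finally show ?thesis by simp
qed

text \<open>Layers are sorted by their scale \<open>1 - s_n\<close>. On scales above half of
  \<open>t = |1 - cnj w x|\<close> the kernels hardly change between \<open>x\<close> and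
  \<open>w\<close>; those below \<open>1 - |x|\<close> add a bounded amount at \<open>x\<close>;
  each scale in between costs \<open>p' ln \<beta>\<close>. For the last two groups the terms at
  \<open>w\<close> are dropped, being nonnegative.\<close>

lemma sum_swept_diff_le:
  "\<exists>s p' K C. 0 < p' \<and> p' < 1 \<and> 0 \<le> K \<and> (\<forall>n\<in>I. 0 \<le> s n \<and> s n < 1 \<and> 1 - s n \<le> K * (1 - cmod (z n))) \<and>
     (\<forall>x w F. cmod x < 1 \<longrightarrow> cmod w < 1 \<longrightarrow> finite F \<longrightarrow> F \<subseteq> I \<longrightarrow>
       (\<Sum>n\<in>F. swept (s n) (z n) x - swept (s n) (z n) w) \<le> p' * ln (cmod (1 - cnj w * x) / (1 - cmod x)) + C)"
proof -
  \<comment> \<open>With \<open>12 \<epsilon> = 1 - p\<close> the accumulated factor satisfies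
    \<open>p1 \<le> p (1 + 10 \<epsilon>) \<le> p + 10 \<epsilon> < 1\<close>.\<close>
  define \<epsilon> where "\<epsilon> = (1 - p) / 12"
  have \<epsilon>: "0 < \<epsilon>" "\<epsilon> \<le> 1 / 12" using p by (auto simp: \<epsilon>_def)
  define Q where "Q = 2 / \<epsilon>"
  have Q: "Q \<ge> 1" using \<epsilon> by (simp add: Q_def)
  obtain C0 where C0: "\<forall>\<beta> \<eta> F x. \<beta> \<ge> 1 / (1 - r0) \<longrightarrow> 0 < \<eta> \<longrightarrow> \<eta> \<le> 1 \<longrightarrow> cmod x < 1 \<longrightarrow> finite F \<longrightarrow> F \<subseteq> I \<longrightarrow>
     (\<forall>n\<in>F. \<eta> / \<beta> \<le> 2 / \<epsilon> * (1 - cmod (z n)) \<and> 2 / \<epsilon> * (1 - cmod (z n)) \<le> \<eta>) \<longrightarrow>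
     (\<Sum>n\<in>F. swept (1 - \<eta>) (z n) x) \<le> (1 + \<epsilon>) / (1 - \<epsilon>) * (p * ((1 + 4 * \<epsilon>) * ln \<beta>)) + C0"
    using layer_sum_le[OF \<epsilon>] by blast
  define p1 where "p1 = (1 + \<epsilon>) / (1 - \<epsilon>) * (p * (1 + 4 * \<epsilon>))"
  have p1: "0 < p1" "p1 < 1"
  proof -
    show "0 < p1" using \<epsilon> p by (simp add: p1_def)
    have "\<epsilon> * \<epsilon> \<le> 1 / 12 * \<epsilon>" using \<epsilon> by (intro mult_right_mono) auto
    then have "(1 + \<epsilon>) * (1 + 4 * \<epsilon>) \<le> (1 + 10 * \<epsilon>) * (1 - \<epsilon>)"
      using \<epsilon> by (simp add: algebra_simps)
    then have "(1 + \<epsilon>) * (1 + 4 * \<epsilon>) / (1 - \<epsilon>) \<le> 1 + 10 * \<epsilon>"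
      using \<epsilon> by (subst pos_divide_le_eq) auto
    then have "p * ((1 + \<epsilon>) * (1 + 4 * \<epsilon>) / (1 - \<epsilon>)) \<le> p * (1 + 10 * \<epsilon>)"
      using p by (intro mult_left_mono) auto
    also have "\<dots> < 1"
    proof -
      have "p * \<epsilon> \<le> \<epsilon>" using p \<epsilon> by (simp add: mult_left_le_one_le)
      then have "p * (1 + 10 * \<epsilon>) \<le> p + 10 * \<epsilon>" by (simp add: algebra_simps)
      also have "p + 10 * \<epsilon> < 1" using p by (simp add: \<epsilon>_def field_simps)
      finally show ?thesis .
    qed
    finally show "p1 < 1" by (simp add: p1_def mult_ac)
  qed
  define p' where "p' = (1 + p1) / 2"
  have p': "0 < p'" "p' < 1" "p1 < p'" using p1 by (auto simp: p'_def)
  \<comment> \<open>So large that the constant \<open>C0\<close> of each layer fits into the gap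
    \<open>(p' - p1) * ln \<beta>\<close>.\<close>
  define \<beta> where "\<beta> = max (1 / (1 - r0)) (exp (C0 / (p' - p1)))"
  have \<beta>: "\<beta> \<ge> 1 / (1 - r0)" by (simp add: \<beta>_def)
  have "1 / (1 - r0) > 1" using r0 by simp
  then have \<beta>1: "\<beta> > 1" using \<beta> by linarith
  have ln\<beta>: "p1 * ln \<beta> + C0 \<le> p' * ln \<beta>"
  proof -
    have "exp (C0 / (p' - p1)) \<le> \<beta>" by (simp add: \<beta>_def)
    then have "C0 / (p' - p1) \<le> ln \<beta>" using \<beta>1 by (subst ln_ge_iff) auto
    then have "C0 \<le> (p' - p1) * ln \<beta>" using p' by (simp add: divide_le_eq mult.commute)
    then show ?thesis by (simp add: algebra_simps)
  qed
  define K where "K = \<beta> * Q"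
  have K: "K \<ge> 0" using \<beta>1 Q by (simp add: K_def)
  have "\<exists>j::nat. (1 / \<beta>) ^ j / \<beta> < Q * (1 - cmod (z n)) \<and> (j = 0 \<or> Q * (1 - cmod (z n)) \<le> (1 / \<beta>) ^ j)" if "n \<in> I" for n
    using in_disc[OF that] Q \<beta>1 by (intro layer_index_exists) auto
  then obtain j :: "nat \<Rightarrow> nat" where j: "\<forall>n\<in>I. (1 / \<beta>) ^ j n / \<beta> < Q * (1 - cmod (z n)) \<and>
      (j n = 0 \<or> Q * (1 - cmod (z n)) \<le> (1 / \<beta>) ^ j n)"
    by metis
  define s where "s = (\<lambda>n. 1 - (1 / \<beta>) ^ j n)"
  have s: "0 \<le> s n" "s n < 1" "1 - s n \<le> K * (1 - cmod (z n))" if n: "n \<in> I" for n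
  proof -
    have "(1 / \<beta>) ^ j n \<le> 1" using \<beta>1 by (intro power_le_one) auto
    then show "0 \<le> s n" "s n < 1" using \<beta>1 by (auto simp: s_def)
    have "(1 / \<beta>) ^ j n / \<beta> \<le> Q * (1 - cmod (z n))" using j n by fastforce
    then show "1 - s n \<le> K * (1 - cmod (z n))"
      using \<beta>1 by (simp add: s_def K_def pos_divide_le_eq mult_ac)
  qed
  obtain C1 where C1: "C1 > 0" "\<forall>w \<tau> F. cmod w < 1 \<longrightarrow> 0 < \<tau> \<longrightarrow> finite F \<longrightarrow> F \<subseteq> I \<longrightarrow>
     (\<Sum>n\<in>F. (1 - cmod (z n)) powr 2 / (\<tau> + cmod (1 - cnj (z n) * w)) powr 3) \<le> C1 * \<tau> powr (2 - 3)"
    using sum_kernel_le[of 2 3] by auto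
  obtain C2 where C2: "C2 > 0" "\<forall>w F. cmod w < 1 \<longrightarrow> finite F \<longrightarrow> F \<subseteq> I \<longrightarrow>
     (\<Sum>n\<in>F. (1 - cmod (z n)) powr (3 / 2) / cmod (1 - cnj (z n) * w) powr 2) \<le> C2 * (1 - cmod w) powr (3 / 2 - 2)"
    using sum_kernel_le'[of "3 / 2" 2] by auto
  define C where "C = 9216 * (K + 1) * C1 + 8 * (K + 1) * C2 + p' * ln \<beta>"
  have "(\<Sum>n\<in>F. swept (s n) (z n) x - swept (s n) (z n) w) \<le> p' * ln (cmod (1 - cnj w * x) / (1 - cmod x)) + C"
    if x: "cmod x < 1" and w: "cmod w < 1" and F: "finite F" "F \<subseteq> I" for x w F
  proof -
    define t where "t = cmod (1 - cnj w * x)"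
    have t: "0 < t" "1 - cmod x \<le> t" "t \<le> 2"
      using cmod_one_minus_cnj_mult_pos[OF w x] cmod_one_minus_cnj_mult_ge(2)[of w x]
        cmod_one_minus_cnj_mult_le_2[OF w x] w x by (auto simp: t_def)
    define F1 where "F1 = {n\<in>F. t \<le> 2 * (1 - s n)}"
    define F2 where "F2 = {n\<in>F. t > 2 * (1 - s n) \<and> 1 - s n < 1 - cmod x}"
    define F3 where "F3 = {n\<in>F. t > 2 * (1 - s n) \<and> 1 - s n \<ge> 1 - cmod x}"
    have sub: "F1 \<subseteq> I" "F2 \<subseteq> I" "F3 \<subseteq> I" "finite F1" "finite F2" "finite F3"
      using F by (auto simp: F1_def F2_def F3_def)
    \<comment> \<open>Layer 0 has \<open>s n = 0\<close> and would require \<open>t > 2\<close>,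
      which is impossible. So the exceptional points of \<open>layer_index_exists\<close> all lie in
      \<open>F1\<close>.\<close>
    have fine: "j n \<noteq> 0" "Q * (1 - cmod (z n)) \<le> 1 - s n" if "n \<in> F2 \<union> F3" for n
    proof -
      show "j n \<noteq> 0"
      proof
        assume "j n = 0"
        then have "s n = 0" by (simp add: s_def)
        then show False using that t by (auto simp: F2_def F3_def)
      qed
      moreover have "n \<in> I" using that sub by blast
      ultimately have "Q * (1 - cmod (z n)) \<le> (1 / \<beta>) ^ j n" using bspec[OF j, of n] by simp
      then show "Q * (1 - cmod (z n)) \<le> 1 - s n" by (simp add: s_def)
    qed
    have S1: "(\<Sum>n\<in>F1. swept (s n) (z n) x - swept (s n) (z n) w) \<le> 9216 * (K + 1) * C1"
    proof -
      have "(\<Sum>n\<in>F1. swept (s n) (z n) x - swept (s n) (z n) w) \<le>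
          (\<Sum>n\<in>F1. 9216 * (K + 1) * t * ((1 - cmod (z n))\<^sup>2 / (t + cmod (1 - cnj (z n) * x)) ^ 3))"
        using sub s x w by (intro sum_mono swept_diff_le in_disc) (auto simp: t_def F1_def)
      also have "\<dots> = 9216 * (K + 1) * t * (\<Sum>n\<in>F1. (1 - cmod (z n))\<^sup>2 / (t + cmod (1 - cnj (z n) * x)) ^ 3)"
        by (simp add: sum_distrib_left)
      also have "(\<Sum>n\<in>F1. (1 - cmod (z n))\<^sup>2 / (t + cmod (1 - cnj (z n) * x)) ^ 3) =
          (\<Sum>n\<in>F1. (1 - cmod (z n)) powr 2 / (t + cmod (1 - cnj (z n) * x)) powr 3)"
      proof (intro sum.cong refl)
        fix n assume "n \<in> F1"
        then have "cmod (z n) < 1" using sub in_disc by auto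
        moreover have "t + cmod (1 - cnj (z n) * x) > 0" using t by (simp add: add_pos_nonneg)
        ultimately show "(1 - cmod (z n))\<^sup>2 / (t + cmod (1 - cnj (z n) * x)) ^ 3 =
          (1 - cmod (z n)) powr 2 / (t + cmod (1 - cnj (z n) * x)) powr 3" by simp
      qed
      also have "9216 * (K + 1) * t * \<dots> \<le> 9216 * (K + 1) * t * (C1 * t powr (2 - 3))"
        using K t sub x by (intro mult_left_mono C1(2)[rule_format]) auto
      also have "\<dots> = 9216 * (K + 1) * C1"
        using t by (simp add: powr_minus field_simps)
      finally show ?thesis .
    qed
    have S2: "(\<Sum>n\<in>F2. swept (s n) (z n) x) \<le> 8 * (K + 1) * C2"
    proof -
      define \<delta> where "\<delta> = 1 - cmod x"
      have \<delta>: "\<delta> > 0" using x by (simp add: \<delta>_def)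
      \<comment> \<open>One half power of \<open>1 - |z|\<close> is traded for
        \<open>\<delta>\<close>, which leaves exponents 3/2 and 2 for the kernel estimate; the
        resulting powers of \<open>\<delta>\<close> cancel.\<close>
      have "swept (s n) (z n) x \<le> 8 * (K + 1) * \<delta> powr (1 / 2) * ((1 - cmod (z n)) powr (3 / 2) / cmod (1 - cnj (z n) * x) powr 2)"
        if n: "n \<in> F2" for n
      proof -
        have nI: "n \<in> I" using n sub by auto
        have zn: "cmod (z n) < 1" by (rule in_disc[OF nI])
        have y0: "cmod (1 - cnj (z n) * x) > 0" by (rule cmod_one_minus_cnj_mult_pos[OF zn x])
        have "1 - cmod (z n) \<le> Q * (1 - cmod (z n))" using Q zn by simp
        then have "1 - cmod (z n) \<le> \<delta>"
          using fine(2)[of n] n by (auto simp: F2_def \<delta>_def)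
        then have "(1 - cmod (z n)) powr (1 / 2) \<le> \<delta> powr (1 / 2)"
          using zn by (intro powr_mono2) auto
        then have "(1 - cmod (z n)) powr (3 / 2) * (1 - cmod (z n)) powr (1 / 2) \<le> (1 - cmod (z n)) powr (3 / 2) * \<delta> powr (1 / 2)"
          by (intro mult_left_mono) auto
        moreover have "(1 - cmod (z n)) powr (3 / 2) * (1 - cmod (z n)) powr (1 / 2) = (1 - cmod (z n))\<^sup>2"
          using zn by (simp flip: powr_add)
        ultimately have sq: "(1 - cmod (z n))\<^sup>2 \<le> (1 - cmod (z n)) powr (3 / 2) * \<delta> powr (1 / 2)" by simp
        have "swept (s n) (z n) x \<le> 8 * (K + 1) * (1 - cmod (z n))\<^sup>2 / (cmod (1 - cnj (z n) * x))\<^sup>2"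
          by (rule swept_le[OF zn x s[OF nI]])
        also have "\<dots> \<le> 8 * (K + 1) * ((1 - cmod (z n)) powr (3 / 2) * \<delta> powr (1 / 2)) / (cmod (1 - cnj (z n) * x))\<^sup>2"
          using sq K by (intro divide_right_mono mult_left_mono) auto
        finally show ?thesis using y0 by (simp add: mult_ac)
      qed
      then have "(\<Sum>n\<in>F2. swept (s n) (z n) x) \<le>
          (\<Sum>n\<in>F2. 8 * (K + 1) * \<delta> powr (1 / 2) * ((1 - cmod (z n)) powr (3 / 2) / cmod (1 - cnj (z n) * x) powr 2))"
        by (rule sum_mono)
      also have "\<dots> = 8 * (K + 1) * \<delta> powr (1 / 2) * (\<Sum>n\<in>F2. (1 - cmod (z n)) powr (3 / 2) / cmod (1 - cnj (z n) * x) powr 2)"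
        by (simp add: sum_distrib_left)
      also have "\<dots> \<le> 8 * (K + 1) * \<delta> powr (1 / 2) * (C2 * \<delta> powr (3 / 2 - 2))"
        unfolding \<delta>_def using K sub x by (intro mult_left_mono C2(2)[rule_format]) auto
      also have "\<dots> = 8 * (K + 1) * C2 * (\<delta> powr (1 / 2) * \<delta> powr (3 / 2 - 2))"
        by (simp add: mult_ac)
      also have "\<delta> powr (1 / 2) * \<delta> powr (3 / 2 - 2) = 1"
        using \<delta> by (simp flip: powr_add)
      finally show ?thesis by simp
    qed
    have S3: "(\<Sum>n\<in>F3. swept (s n) (z n) x) \<le> p' * ln (t / (1 - cmod x)) + p' * ln \<beta>"
    proof -
      have "(\<Sum>n\<in>F3. swept (s n) (z n) x) = (\<Sum>k\<in>j ` F3. \<Sum>n\<in>{n\<in>F3. j n = k}. swept (s n) (z n) x)"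
        by (rule sum.image_gen[OF sub(6)])
      also have "\<dots> \<le> (\<Sum>k\<in>j ` F3. p' * ln \<beta>)"
      proof (rule sum_mono)
        fix k assume k: "k \<in> j ` F3"
        define \<eta> where "\<eta> = (1 / \<beta>) ^ k"
        have "(\<Sum>n\<in>{n\<in>F3. j n = k}. swept (s n) (z n) x) = (\<Sum>n\<in>{n\<in>F3. j n = k}. swept (1 - \<eta>) (z n) x)"
          by (intro sum.cong) (auto simp: s_def \<eta>_def)
        also have "\<dots> \<le> (1 + \<epsilon>) / (1 - \<epsilon>) * (p * ((1 + 4 * \<epsilon>) * ln \<beta>)) + C0"
        proof (rule C0[rule_format])
          show "0 < \<eta>" "\<eta> \<le> 1" using \<beta>1 by (auto simp: \<eta>_def intro!: power_le_one)
          show "\<eta> / \<beta> \<le> 2 / \<epsilon> * (1 - cmod (z n)) \<and> 2 / \<epsilon> * (1 - cmod (z n)) \<le> \<eta>" if n: "n \<in> {n\<in>F3. j n = k}" for n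
          proof -
            have "n \<in> I" using n sub by auto
            then have "(1 / \<beta>) ^ j n / \<beta> < Q * (1 - cmod (z n))" using j by blast
            moreover have "Q * (1 - cmod (z n)) \<le> 1 - s n" using fine(2)[of n] n by auto
            ultimately show ?thesis using n by (auto simp: \<eta>_def Q_def s_def)
          qed
        qed (use \<beta> x sub in auto)
        also have "(1 + \<epsilon>) / (1 - \<epsilon>) * (p * ((1 + 4 * \<epsilon>) * ln \<beta>)) = p1 * ln \<beta>"
          by (simp add: p1_def mult_ac)
        finally show "(\<Sum>n\<in>{n\<in>F3. j n = k}. swept (s n) (z n) x) \<le> p' * ln \<beta>"
          using ln\<beta> by linarith
      qed
      also have "\<dots> = p' * (real (card (j ` F3)) * ln \<beta>)" by simp
      also have "\<dots> \<le> p' * (ln (t / (1 - cmod x)) + ln \<beta>)"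
      proof (intro mult_left_mono card_mult_ln_le \<beta>1)
        show "finite (j ` F3)" using sub by simp
        show "1 - cmod x \<le> (1 / \<beta>) ^ k \<and> (1 / \<beta>) ^ k \<le> t" if k: "k \<in> j ` F3" for k
        proof -
          obtain n where n: "n \<in> F3" "k = j n" using k by auto
          then have "1 - s n = (1 / \<beta>) ^ k" by (simp add: s_def)
          moreover have "0 \<le> 1 - s n" using s[of n] n sub by auto
          ultimately show ?thesis using n by (auto simp: F3_def)
        qed
      qed (use x t p' in auto)
      finally show ?thesis by (simp add: algebra_simps)
    qed
    have nonneg: "swept (s n) (z n) w \<ge> 0" if "n \<in> I" for n
      using s[OF that] in_disc[OF that] by (intro swept_nonneg) auto
    have "F = F1 \<union> (F2 \<union> F3)" "F1 \<inter> (F2 \<union> F3) = {}" "F2 \<inter> F3 = {}"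
      by (auto simp: F1_def F2_def F3_def)
    then have "(\<Sum>n\<in>F. swept (s n) (z n) x - swept (s n) (z n) w) =
        (\<Sum>n\<in>F1. swept (s n) (z n) x - swept (s n) (z n) w) +
        ((\<Sum>n\<in>F2. swept (s n) (z n) x - swept (s n) (z n) w) + (\<Sum>n\<in>F3. swept (s n) (z n) x - swept (s n) (z n) w))"
      using sub by (simp add: sum.union_disjoint)
    also have "(\<Sum>n\<in>F2. swept (s n) (z n) x - swept (s n) (z n) w) \<le> (\<Sum>n\<in>F2. swept (s n) (z n) x)"
      using nonneg sub by (intro sum_mono) auto
    also have "(\<Sum>n\<in>F3. swept (s n) (z n) x - swept (s n) (z n) w) \<le> (\<Sum>n\<in>F3. swept (s n) (z n) x)"
      using nonneg sub by (intro sum_mono) auto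
    finally show ?thesis
      using S1 S2 S3 unfolding C_def t_def by linarith
  qed
  then show ?thesis
    using p' K s by (intro exI[of _ s] exI[of _ p'] exI[of _ K] exI[of _ C]) auto
qed

end

section \<open>The canonical product\<close>

lemma norm_exp_minus_one_le: "cmod (exp y - 1) \<le> cmod y * exp (cmod y)"
proof -
  have "cmod (exp y - exp 0) \<le> exp (cmod y) * cmod (y - 0)"
  proof (rule field_differentiable_bound[of "cball 0 (cmod y)" exp exp])
    show "(exp has_field_derivative exp v) (at v within cball 0 (cmod y))" for v :: complex
      by (rule DERIV_subset[OF DERIV_exp]) simp
    show "cmod (exp v) \<le> exp (cmod y)" if "v \<in> cball 0 (cmod y)" for v
      using that norm_exp[of v] by (auto intro: order_trans)
  qed auto
  then show ?thesis by (simp add: mult.commute)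
qed

lemma norm_primary_factor_minus_one_le: "cmod ((1 - v) * exp v - 1) \<le> (cmod v)\<^sup>2 * exp (cmod v)"
proof -
  have "cmod ((1 - v) * exp v - (1 - 0) * exp 0) \<le> (cmod v * exp (cmod v)) * cmod (v - 0)"
  proof (rule field_differentiable_bound[of "cball 0 (cmod v)" "\<lambda>v. (1 - v) * exp v" "\<lambda>v. - v * exp v"])
    show "((\<lambda>v. (1 - v) * exp v) has_field_derivative - y * exp y) (at y within cball 0 (cmod v))" for y :: complex
      by (auto intro!: derivative_eq_intros simp: algebra_simps)
    show "cmod (- y * exp y) \<le> cmod v * exp (cmod v)" if "y \<in> cball 0 (cmod v)" for y
    proof -
      have "cmod y \<le> cmod v" using that by simp
      moreover have "cmod (exp y) \<le> exp (cmod v)"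
        using norm_exp[of y] calculation by (auto intro: order_trans)
      ultimately show ?thesis by (auto simp: norm_mult intro!: mult_mono)
    qed
  qed auto
  then show ?thesis by (simp add: power2_eq_square mult_ac)
qed

text \<open>
  The value of \<open>direction\<close> at \<open>0\<close> is an arbitrary unit vector. The Blaschke factor is normalised so
  that it tends to \<open>1\<close> as \<open>a\<close> tends to the unit circle.
\<close>

definition direction :: "complex \<Rightarrow> complex" where
  "direction a = (if a = 0 then 1 else sgn a)"

definition blaschke :: "complex \<Rightarrow> complex \<Rightarrow> complex" where
  "blaschke a x = (of_real (cmod a) - cnj (direction a) * x) / (1 - cnj a * x)"

definition compensator :: "real \<Rightarrow> complex \<Rightarrow> complex \<Rightarrow> complex" where
  "compensator s a x = of_real ((1 - (cmod a)\<^sup>2) / 2) * (1 + cnj a * (of_real s * x)) / (1 - cnj a * (of_real s * x))"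

definition canonical_factor :: "real \<Rightarrow> complex \<Rightarrow> complex \<Rightarrow> complex" where
  "canonical_factor s a x = blaschke a x * exp (compensator s a x)"

lemma direction: "cmod (direction a) = 1" "a = of_real (cmod a) * direction a"
proof -
  show "cmod (direction a) = 1" by (simp add: direction_def norm_sgn)
  show "a = of_real (cmod a) * direction a" by (simp add: direction_def sgn_eq)
qed

lemma cmod_blaschke: "cmod (blaschke a x) = pseudohyp x a"
proof -
  define u where "u = direction a"
  have u: "cmod u = 1" "a = of_real (cmod a) * u" using direction by (simp_all add: u_def)
  have "cnj u * u = 1" using u(1) complex_norm_square[of u] by (simp add: mult.commute)
  then have "cnj u * a = of_real (cmod a)"
    by (subst u(2)) (metis mult.left_commute mult.right_neutral)
  then have "of_real (cmod a) - cnj u * x = cnj u * (a - x)"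
    by (simp add: algebra_simps)
  then have "cmod (of_real (cmod a) - cnj u * x) = cmod (x - a)"
    using u(1) by (simp add: norm_mult norm_minus_commute)
  then show ?thesis
    unfolding blaschke_def pseudohyp_def norm_divide u_def using cmod_one_minus_cnj_mult_commute[of x a] by simp
qed

lemma one_minus_cnj_mult_nonzero:
  assumes "cmod a < 1" "cmod x < 1"
  shows "1 - cnj a * x \<noteq> 0"
  using cmod_one_minus_cnj_mult_pos[OF assms] by auto

lemma holomorphic_canonical_factor:
  assumes a: "cmod a < 1" and s: "0 \<le> s" "s \<le> 1"
  shows "canonical_factor s a holomorphic_on ball 0 1"
proof -
  have "1 - cnj a * x \<noteq> 0" "1 - cnj a * (of_real s * x) \<noteq> 0" if "x \<in> ball 0 1" for x
    using one_minus_cnj_mult_nonzero[OF a] cmod_scaled_less_1[OF _ s, of x] that by auto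
  then show ?thesis
    unfolding canonical_factor_def blaschke_def compensator_def by (auto intro!: holomorphic_intros)
qed

text \<open>With \<open>v = s cnj a x\<close>, the real part of \<open>(1 + v) / (1 - v)\<close> has
  numerator \<open>1 - |v|\<^sup>2\<close>, which splits into
  \<open>|x|\<^sup>2 (1 - s\<^sup>2 |a|\<^sup>2)\<close> and \<open>1 - |x|\<^sup>2\<close>. The
  second part is the one that compensates the logarithm of the Blaschke factor.\<close>

lemma Re_compensator:
  assumes a: "cmod a < 1" and x: "cmod x < 1" and s: "0 \<le> s" "s \<le> 1"
  shows "Re (compensator s a x) = swept s a x +
    (1 - (cmod a)\<^sup>2) / 2 * (1 - (cmod x)\<^sup>2) / (cmod (1 - cnj a * (of_real s * x)))\<^sup>2"
proof -
  define v where "v = cnj a * (of_real s * x)"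
  have "1 - v \<noteq> 0"
    unfolding v_def using cmod_scaled_less_1[OF x s] by (intro one_minus_cnj_mult_nonzero a) simp
  then have "(1 + v) / (1 - v) = (1 + v) * cnj (1 - v) / ((1 - v) * cnj (1 - v))"
    by simp
  also have "(1 - v) * cnj (1 - v) = of_real ((cmod (1 - v))\<^sup>2)"
    by (rule complex_norm_square[symmetric])
  finally have "Re ((1 + v) / (1 - v)) = Re ((1 + v) * cnj (1 - v)) / (cmod (1 - v))\<^sup>2"
    by (simp add: Re_divide_of_real)
  also have "Re ((1 + v) * cnj (1 - v)) = 1 - (cmod v)\<^sup>2"
    unfolding cmod_power2 by (simp add: power2_eq_square algebra_simps)
  also have "(cmod v)\<^sup>2 = s\<^sup>2 * (cmod a)\<^sup>2 * (cmod x)\<^sup>2"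
    using s by (simp add: v_def norm_mult power_mult_distrib)
  also have "1 - s\<^sup>2 * (cmod a)\<^sup>2 * (cmod x)\<^sup>2 = (cmod x)\<^sup>2 * (1 - s\<^sup>2 * (cmod a)\<^sup>2) + (1 - (cmod x)\<^sup>2)"
    by (simp add: algebra_simps)
  finally have R: "Re ((1 + v) / (1 - v)) = ((cmod x)\<^sup>2 * (1 - s\<^sup>2 * (cmod a)\<^sup>2) + (1 - (cmod x)\<^sup>2)) / (cmod (1 - v))\<^sup>2" .
  have "compensator s a x = of_real ((1 - (cmod a)\<^sup>2) / 2) * ((1 + v) / (1 - v))"
    unfolding compensator_def v_def by (rule times_divide_eq_right[symmetric])
  then have "Re (compensator s a x) = (1 - (cmod a)\<^sup>2) / 2 * Re ((1 + v) / (1 - v))"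
    by (simp only: Re_complex_of_real Im_complex_of_real times_complex.sel)
  then show ?thesis
    unfolding R by (simp add: swept_def v_def add_divide_distrib distrib_left mult_ac)
qed

text \<open>Putting \<open>s = 1\<close> would turn the compensating part into exactly
  \<open>(1 - \<rho>\<^sup>2) / 2\<close>. The change is controlled by
  \<open>|X - y| \<le> 1 - s \<le> K (1 - |a|)\<close>, which supplies a second factor
  \<open>1 - |a|\<close>; thus the errors are summable by the kernel estimate with exponents 2 and
  3.\<close>

lemma compensator_error:
  assumes a: "cmod a < 1" and x: "cmod x < 1" and s: "0 \<le> s" "s < 1" and K: "K \<ge> 0" "1 - s \<le> K * (1 - cmod a)"
  shows "\<bar>(1 - (cmod a)\<^sup>2) / 2 * (1 - (cmod x)\<^sup>2) / (cmod (1 - cnj a * (of_real s * x)))\<^sup>2 - (1 - (pseudohyp x a)\<^sup>2) / 2\<bar>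
    \<le> 8 * K * (K + 2) * (1 - cmod x) * ((1 - cmod a)\<^sup>2 / cmod (1 - cnj a * x) ^ 3)"
proof -
  define X where "X = cmod (1 - cnj a * (of_real s * x))"
  define y where "y = cmod (1 - cnj a * x)"
  define m where "m = (1 - (cmod a)\<^sup>2) / 2 * (1 - (cmod x)\<^sup>2)"
  have y0: "y > 0" unfolding y_def by (rule cmod_one_minus_cnj_mult_pos[OF a x])
  have yX: "y \<le> 2 * X" using cmod_one_minus_scaled_ge(2)[OF a x s] by (simp add: y_def X_def)
  then have X0: "X > 0" using y0 by linarith
  have ay: "1 - cmod a \<le> y" unfolding y_def using a x by (intro cmod_one_minus_cnj_mult_ge) auto
  have diff: "\<bar>y - X\<bar> \<le> 1 - s"
  proof -
    have "\<bar>y - X\<bar> \<le> cmod ((1 - cnj a * x) - (1 - cnj a * (of_real s * x)))"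
      unfolding X_def y_def by (rule norm_triangle_ineq3)
    also have "(1 - cnj a * x) - (1 - cnj a * (of_real s * x)) = of_real (s - 1) * (cnj a * x)"
      by (simp add: algebra_simps)
    also have "cmod \<dots> = (1 - s) * (cmod a * cmod x)"
      unfolding norm_mult norm_of_real using s by simp
    also have "\<dots> \<le> (1 - s) * 1"
      using s a x by (intro mult_left_mono) (simp_all add: mult_le_one)
    finally show ?thesis by simp
  qed
  have diffK: "\<bar>y - X\<bar> \<le> K * (1 - cmod a)" using diff K by linarith
  have "K * (1 - cmod a) \<le> K * y" using ay K by (intro mult_left_mono) auto
  then have Xy: "y + X \<le> (K + 2) * y" using diffK by (simp add: algebra_simps)
  have "1 / X \<le> 2 / y" using yX X0 y0 by (simp add: field_simps)
  then have "(1 / X)\<^sup>2 \<le> (2 / y)\<^sup>2" using X0 by (intro power_mono) auto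
  then have X4: "1 / X\<^sup>2 \<le> 4 / y\<^sup>2" by (simp add: power_divide)
  have m: "0 \<le> m" "m \<le> (1 - cmod a) * (2 * (1 - cmod x))"
  proof -
    have "(1 - (cmod a)\<^sup>2) / 2 \<le> 1 - cmod a" "0 \<le> (1 - (cmod a)\<^sup>2) / 2" "0 \<le> 1 - (cmod x)\<^sup>2" "1 - (cmod x)\<^sup>2 \<le> 2 * (1 - cmod x)"
      using one_minus_sq_bounds[of "cmod a"] one_minus_sq_bounds[of "cmod x"] a x by auto
    moreover have "0 \<le> 1 - cmod a" using a by simp
    ultimately have "0 \<le> (1 - (cmod a)\<^sup>2) / 2 * (1 - (cmod x)\<^sup>2) \<and>
        (1 - (cmod a)\<^sup>2) / 2 * (1 - (cmod x)\<^sup>2) \<le> (1 - cmod a) * (2 * (1 - cmod x))"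
      by (intro conjI mult_nonneg_nonneg mult_mono)
    then show "0 \<le> m" "m \<le> (1 - cmod a) * (2 * (1 - cmod x))" by (simp_all only: m_def)
  qed
  have "m / X\<^sup>2 - m / y\<^sup>2 = m * ((y - X) * (y + X) * (1 / X\<^sup>2) / y\<^sup>2)"
    using X0 y0 by (simp add: field_simps power2_eq_square)
  then have "\<bar>m / X\<^sup>2 - m / y\<^sup>2\<bar> = m * (\<bar>y - X\<bar> * (y + X) * (1 / X\<^sup>2) / y\<^sup>2)"
    using X0 y0 m by (simp add: abs_mult)
  also have "\<dots> \<le> ((1 - cmod a) * (2 * (1 - cmod x))) * ((K * (1 - cmod a)) * ((K + 2) * y) * (4 / y\<^sup>2) / y\<^sup>2)"
    using m diffK Xy X4 X0 y0 K a x
    by (intro mult_mono divide_right_mono) (auto intro!: mult_nonneg_nonneg divide_nonneg_nonneg)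
  also have "\<dots> = 8 * K * (K + 2) * (1 - cmod x) * ((1 - cmod a)\<^sup>2 / y ^ 3)"
    using y0 by (simp add: field_simps power2_eq_square power3_eq_cube)
  finally have "\<bar>m / X\<^sup>2 - m / y\<^sup>2\<bar> \<le> 8 * K * (K + 2) * (1 - cmod x) * ((1 - cmod a)\<^sup>2 / y ^ 3)" .
  moreover have "m / y\<^sup>2 = (1 - (pseudohyp x a)\<^sup>2) / 2"
    using one_minus_pseudohyp_sq[OF a x] by (simp add: m_def y_def pseudohyp_commute[of x a])
  ultimately have "\<bar>m / X\<^sup>2 - (1 - (pseudohyp x a)\<^sup>2) / 2\<bar> \<le> 8 * K * (K + 2) * (1 - cmod x) * ((1 - cmod a)\<^sup>2 / y ^ 3)"
    by (simp only:)
  then show ?thesis by (simp only: m_def X_def y_def)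
qed

lemma mult_exp_half_le_1:
  fixes \<rho> :: real
  assumes "0 \<le> \<rho>"
  shows "\<rho> * exp ((1 - \<rho>\<^sup>2) / 2) \<le> 1"
proof -
  have "\<rho>\<^sup>2 \<le> exp (\<rho>\<^sup>2 - 1)" using exp_ge_add_one_self[of "\<rho>\<^sup>2 - 1"] by simp
  also have "\<dots> = (exp ((\<rho>\<^sup>2 - 1) / 2))\<^sup>2" by (simp flip: exp_double)
  finally have "\<rho> \<le> exp ((\<rho>\<^sup>2 - 1) / 2)" by (rule power2_le_imp_le) simp
  then have "\<rho> * exp ((1 - \<rho>\<^sup>2) / 2) \<le> exp ((\<rho>\<^sup>2 - 1) / 2) * exp ((1 - \<rho>\<^sup>2) / 2)"
    by (intro mult_right_mono) auto
  also have "\<dots> = 1" by (simp flip: exp_add add: add_divide_distrib[symmetric])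
  finally show ?thesis .
qed

text \<open>Second-order counterpart of \<open>ln \<rho>\<^sup>2 \<le> \<rho>\<^sup>2 - 1\<close>:
  the defect is quadratic in \<open>1 - \<rho>\<^sup>2\<close> as long as \<open>\<rho>\<close>
  stays away from 0, and the sum of such squares over the sequence is bounded.\<close>

lemma mult_exp_half_ge:
  fixes \<rho> e :: real
  assumes e: "0 < e" "e \<le> \<rho>" and \<rho>: "\<rho> \<le> 1"
  shows "\<rho> * exp ((1 - \<rho>\<^sup>2) / 2) \<ge> exp (- ((1 - \<rho>\<^sup>2)\<^sup>2 / (2 * e\<^sup>2)))"
proof -
  define y where "y = 1 - \<rho>\<^sup>2"
  have \<rho>0: "\<rho> > 0" using e by simp
  have y: "0 \<le> y" "1 - y = \<rho>\<^sup>2" "1 - y > 0" using \<rho> \<rho>0 by (auto simp: y_def power_le_one)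
  have "ln (1 / (1 - y)) \<le> 1 / (1 - y) - 1" using y by (intro ln_le_minus_one) auto
  then have "- y - y\<^sup>2 / (1 - y) \<le> ln (1 - y)"
    using y(3) by (simp add: ln_div field_simps power2_eq_square)
  also have "ln (1 - y) = 2 * ln \<rho>" using \<rho>0 by (simp add: y(2) ln_realpow)
  finally have "- y - y\<^sup>2 / (1 - y) \<le> 2 * ln \<rho>" .
  moreover have "- Z / 2 \<le> l + y / 2" if "- y - Z \<le> 2 * l" for Z l :: real
    using that by simp
  ultimately have "- (y\<^sup>2 / (1 - y)) / 2 \<le> ln \<rho> + y / 2" by blast
  moreover have "y\<^sup>2 / (1 - y) \<le> y\<^sup>2 / e\<^sup>2"
    unfolding y(2) using e by (intro divide_left_mono mult_pos_pos power_mono) auto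
  moreover have "- Z' / 2 \<le> l" if "- Z / 2 \<le> l" "Z \<le> Z'" for Z Z' l :: real
    using that by simp
  ultimately have "- (y\<^sup>2 / e\<^sup>2) / 2 \<le> ln \<rho> + y / 2" by blast
  moreover have "- (y\<^sup>2 / (2 * e\<^sup>2)) = - (y\<^sup>2 / e\<^sup>2) / 2" by simp
  ultimately have "- (y\<^sup>2 / (2 * e\<^sup>2)) \<le> ln \<rho> + y / 2" by (simp only:)
  then have "exp (- (y\<^sup>2 / (2 * e\<^sup>2))) \<le> exp (ln \<rho> + y / 2)" by simp
  also have "\<dots> = \<rho> * exp (y / 2)" using \<rho>0 by (simp add: exp_add)
  finally show ?thesis by (simp add: y_def)
qed

text \<open>The modulus is \<open>\<rho> exp ((1 - \<rho>\<^sup>2) / 2) * exp (swept)\<close> up to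
  an error at most \<open>e\<close> in the exponent, and the first product is close to 1 away from
  the zero. The bounds serve in turn for an arbitrary point, for keeping the zero visible from
  above, for the one factor whose zero may be near, and for factors whose zeros are far.\<close>

lemma cmod_canonical_factor:
  assumes a: "cmod a < 1" and x: "cmod x < 1" and s: "0 \<le> s" "s < 1" and K: "K \<ge> 0" "1 - s \<le> K * (1 - cmod a)"
    and e: "e = 8 * K * (K + 2) * (1 - cmod x) * ((1 - cmod a)\<^sup>2 / cmod (1 - cnj a * x) ^ 3)"
  shows "cmod (canonical_factor s a x) \<le> exp (swept s a x + e)"
    "cmod (canonical_factor s a x) \<le> pseudohyp x a * exp (1 / 2 + (swept s a x + e))"
    "cmod (canonical_factor s a x) \<ge> pseudohyp x a * exp (swept s a x)"
    "0 < c \<Longrightarrow> c \<le> pseudohyp x a \<Longrightarrow>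
       cmod (canonical_factor s a x) \<ge> exp (swept s a x - (e + (1 - (pseudohyp x a)\<^sup>2)\<^sup>2 / (2 * c\<^sup>2)))"
proof -
  define \<rho> where "\<rho> = pseudohyp x a"
  define d where "d = (1 - (cmod a)\<^sup>2) / 2 * (1 - (cmod x)\<^sup>2) / (cmod (1 - cnj a * (of_real s * x)))\<^sup>2"
  have \<rho>: "0 \<le> \<rho>" "\<rho> \<le> 1" using pseudohyp_less_1[OF x a] by (auto simp: \<rho>_def pseudohyp_nonneg)
  have d: "\<bar>d - (1 - \<rho>\<^sup>2) / 2\<bar> \<le> e" unfolding d_def \<rho>_def e by (rule compensator_error[OF a x s K])
  have d0: "d \<ge> 0"
    unfolding d_def using a x by (intro divide_nonneg_nonneg mult_nonneg_nonneg) (auto simp: power_le_one)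
  have eq: "cmod (canonical_factor s a x) = \<rho> * exp (swept s a x + d)"
    unfolding canonical_factor_def norm_mult cmod_blaschke norm_exp_eq_Re \<rho>_def d_def
    using Re_compensator[OF a x s(1)] s by simp
  show "cmod (canonical_factor s a x) \<ge> pseudohyp x a * exp (swept s a x)"
    unfolding eq \<rho>_def[symmetric] using d0 \<rho> by (intro mult_left_mono) auto
  have "\<rho> * exp (swept s a x + d) \<le> \<rho> * exp ((1 - \<rho>\<^sup>2) / 2 + (swept s a x + e))"
    using d \<rho> by (intro mult_left_mono) auto
  also have "\<dots> = \<rho> * exp ((1 - \<rho>\<^sup>2) / 2) * exp (swept s a x + e)"
    by (simp only: exp_add mult.assoc)
  finally have up: "cmod (canonical_factor s a x) \<le> \<rho> * exp ((1 - \<rho>\<^sup>2) / 2) * exp (swept s a x + e)"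
    unfolding eq .
  also have "\<dots> \<le> 1 * exp (swept s a x + e)"
    using mult_exp_half_le_1[OF \<rho>(1)] by (intro mult_right_mono) auto
  finally show "cmod (canonical_factor s a x) \<le> exp (swept s a x + e)" by simp
  have "\<rho> * exp ((1 - \<rho>\<^sup>2) / 2) * exp (swept s a x + e) \<le> \<rho> * exp (1 / 2) * exp (swept s a x + e)"
    using \<rho> by (intro mult_right_mono mult_left_mono) auto
  from order_trans[OF up this]
  show "cmod (canonical_factor s a x) \<le> pseudohyp x a * exp (1 / 2 + (swept s a x + e))"
    unfolding exp_add[of "1 / 2"] \<rho>_def by (simp only: mult.assoc)
  show "cmod (canonical_factor s a x) \<ge> exp (swept s a x - (e + (1 - (pseudohyp x a)\<^sup>2)\<^sup>2 / (2 * c\<^sup>2)))"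
    if c: "0 < c" "c \<le> pseudohyp x a"
  proof -
    have "exp (swept s a x - (e + (1 - \<rho>\<^sup>2)\<^sup>2 / (2 * c\<^sup>2))) = exp (- ((1 - \<rho>\<^sup>2)\<^sup>2 / (2 * c\<^sup>2))) * exp (swept s a x - e)"
      by (simp flip: exp_add)
    also have "\<dots> \<le> (\<rho> * exp ((1 - \<rho>\<^sup>2) / 2)) * exp (swept s a x - e)"
      using mult_exp_half_ge[of c \<rho>] c \<rho> by (intro mult_right_mono) (auto simp: \<rho>_def)
    also have "\<dots> = \<rho> * exp (swept s a x + ((1 - \<rho>\<^sup>2) / 2 - e))"
      by (simp add: exp_add exp_diff mult_ac)
    also have "\<dots> \<le> \<rho> * exp (swept s a x + d)"
      using d \<rho> by (intro mult_left_mono) auto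
    finally show ?thesis unfolding eq \<rho>_def .
  qed
qed

text \<open>The Blaschke factor is \<open>1 - v\<close> and the compensator is \<open>v + h\<close>,
  where \<open>v = O(1 - |a|)\<close> and \<open>h = O((1 - |a|)\<^sup>2)\<close> uniformly on
  \<open>|x| \<le> \<rho>\<close>. The factor is therefore the primary factor
  \<open>(1 - v) e\<^sup>v\<close> times \<open>e\<^sup>h\<close>, and its first-order deviation
  from 1 cancels.\<close>

lemma canonical_factor_minus_one_le:
  assumes \<rho>: "\<rho> < 1" and K: "K \<ge> 0"
  shows "\<exists>B. \<forall>a x s. cmod a < 1 \<longrightarrow> cmod x \<le> \<rho> \<longrightarrow> 0 \<le> s \<longrightarrow> s < 1 \<longrightarrow> 1 - s \<le> K * (1 - cmod a) \<longrightarrow>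
    cmod (canonical_factor s a x - 1) \<le> B * (1 - cmod a)\<^sup>2"
proof -
  define M1 where "M1 = 2 / (1 - \<rho>)"
  define M2 where "M2 = 2 * (1 + K) / (1 - \<rho>)\<^sup>2 + 1 / (1 - \<rho>)"
  have M: "M1 \<ge> 0" "M2 \<ge> 0" using \<rho> K by (auto simp: M1_def M2_def)
  define B where "B = M1\<^sup>2 * exp M1 * exp M2 + M2 * exp M2"
  have "cmod (canonical_factor s a x - 1) \<le> B * (1 - cmod a)\<^sup>2"
    if a: "cmod a < 1" and x: "cmod x \<le> \<rho>" and s: "0 \<le> s" "s < 1" and Ks: "1 - s \<le> K * (1 - cmod a)" for a x s
  proof -
    define r where "r = cmod a"
    define y where "y = cnj (direction a) * x"
    have r: "0 \<le> r" "r < 1" using a by (auto simp: r_def)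
    have cnj_a: "cnj a = of_real r * cnj (direction a)"
      by (subst direction(2)[of a]) (simp add: r_def)
    have ax: "cnj a * x = of_real r * y" "cnj a * (of_real s * x) = of_real (s * r) * y"
      by (simp_all add: cnj_a y_def)
    have y: "cmod y \<le> \<rho>" using x direction(1)[of a] by (simp add: y_def norm_mult)
    have den: "cmod (1 - of_real t * y) \<ge> 1 - \<rho>" if "0 \<le> t" "t \<le> 1" for t
    proof -
      have "cmod (of_real t * y) \<le> 1 * \<rho>"
        unfolding norm_mult norm_of_real using that y by (intro mult_mono) auto
      then show ?thesis using norm_triangle_ineq2[of 1 "of_real t * y"] by simp
    qed
    have num: "cmod (1 + of_real t * y) \<le> 2" if "0 \<le> t" "t \<le> 1" for t
    proof -
      have "cmod (of_real t * y) \<le> 1 * \<rho>"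
        unfolding norm_mult norm_of_real using that y by (intro mult_mono) auto
      then show ?thesis using norm_triangle_ineq[of 1 "of_real t * y"] \<rho> by simp
    qed
    have sr: "0 \<le> s * r" "s * r \<le> 1" using s r by (auto intro: mult_le_one)
    define P where "P = 1 - of_real r * y"
    define S where "S = 1 - of_real (s * r) * y"
    have P: "cmod P \<ge> 1 - \<rho>" "P \<noteq> 0" using den[of r] r \<rho> by (auto simp: P_def)
    have S: "cmod S \<ge> 1 - \<rho>" "S \<noteq> 0" using den[OF sr] \<rho> by (auto simp: S_def)
    define v where "v = of_real (1 - r) * (1 + y) / P"
    define A where "A = (1 + of_real (s * r) * y) / S"
    define h where "h = compensator s a x - v"
    have bl: "blaschke a x = 1 - v"
    proof -
      have "blaschke a x = (of_real r - y) / P"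
        by (simp add: blaschke_def ax P_def y_def r_def)
      also have "\<dots> = (P - of_real (1 - r) * (1 + y)) / P"
        by (simp add: P_def algebra_simps)
      also have "\<dots> = 1 - v" using P by (simp add: v_def diff_divide_distrib)
      finally show ?thesis .
    qed
    have v: "cmod v \<le> M1 * (1 - r)"
    proof -
      have "cmod v = (1 - r) * cmod (1 + y) / cmod P"
        using r unfolding v_def norm_mult norm_divide norm_of_real by simp
      also have "\<dots> \<le> (1 - r) * 2 / (1 - \<rho>)"
        using num[of 1] P \<rho> r by (intro frac_le mult_left_mono) auto
      finally show ?thesis by (simp add: M1_def mult.commute)
    qed
    have A: "cmod A \<le> 2 / (1 - \<rho>)"
      unfolding A_def norm_divide using num[OF sr] S \<rho> by (intro frac_le) auto
    \<comment> \<open>The two quotients differ because \<open>r\<close> is replaced by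
      \<open>s r\<close>. In the numerator the leading terms cancel, leaving terms of order
      \<open>1 - r\<close> and \<open>1 - s\<close>.\<close>
    have AB: "cmod (A - (1 + y) / P) \<le> 2 * (1 + K) * (1 - r) / (1 - \<rho>)\<^sup>2"
    proof -
      have "A - (1 + y) / P = ((1 + of_real (s * r) * y) * P - (1 + y) * S) / (S * P)"
        unfolding A_def using S P by (simp add: field_simps)
      also have "(1 + of_real (s * r) * y) * P - (1 + y) * S =
          - (of_real ((1 - r) + 2 * r * (1 - s)) * y) + of_real (s * r * (1 - r)) * (y * y)"
        unfolding P_def S_def by (simp add: algebra_simps)
      finally have "cmod (A - (1 + y) / P) =
          cmod (- (of_real ((1 - r) + 2 * r * (1 - s)) * y) + of_real (s * r * (1 - r)) * (y * y)) / (cmod S * cmod P)"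
        by (simp only: norm_divide norm_mult)
      also have "\<dots> \<le> (2 * (1 + K) * (1 - r)) / ((1 - \<rho>) * (1 - \<rho>))"
      proof (intro frac_le mult_mono)
        have y1: "cmod y \<le> 1" using y \<rho> by simp
        have "cmod (- (of_real ((1 - r) + 2 * r * (1 - s)) * y) + of_real (s * r * (1 - r)) * (y * y))
            \<le> cmod (of_real ((1 - r) + 2 * r * (1 - s)) * y) + cmod (of_real (s * r * (1 - r)) * (y * y))"
          using norm_triangle_ineq[of "- (of_real ((1 - r) + 2 * r * (1 - s)) * y)"] by simp
        also have "cmod (of_real ((1 - r) + 2 * r * (1 - s)) * y) = ((1 - r) + 2 * r * (1 - s)) * cmod y"
          unfolding norm_mult norm_of_real using r s by simp
        also have "\<dots> \<le> ((1 - r) + 2 * r * (1 - s)) * 1" using y1 r s by (intro mult_left_mono) auto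
        also have "cmod (of_real (s * r * (1 - r)) * (y * y)) = (s * r * (1 - r)) * (cmod y * cmod y)"
          unfolding norm_mult norm_of_real using r s by simp
        also have "\<dots> \<le> (1 * (1 - r)) * 1"
          using y1 r s sr by (intro mult_mono mult_le_one mult_nonneg_nonneg) auto
        also have "((1 - r) + 2 * r * (1 - s)) * 1 + (1 * (1 - r)) * 1 \<le> 2 * (1 - r) + 2 * (1 - s)"
        proof -
          have "r * (1 - s) \<le> 1 * (1 - s)" using r s by (intro mult_right_mono) auto
          then show ?thesis by simp
        qed
        also have "\<dots> \<le> 2 * (1 + K) * (1 - r)" using Ks by (simp add: r_def algebra_simps)
        finally show "cmod (- (of_real ((1 - r) + 2 * r * (1 - s)) * y) + of_real (s * r * (1 - r)) * (y * y))
            \<le> 2 * (1 + K) * (1 - r)" by simp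
      qed (use P S \<rho> r K in auto)
      finally show ?thesis by (simp add: power2_eq_square)
    qed
    have h: "cmod h \<le> M2 * (1 - r)\<^sup>2"
    proof -
      have "h = of_real (1 - r) * ((A - (1 + y) / P) - of_real ((1 - r) / 2) * A)"
      proof -
        have "compensator s a x = of_real ((1 - r\<^sup>2) / 2) * A"
          by (simp add: compensator_def ax A_def S_def r_def)
        also have "(1 - r\<^sup>2) / 2 = (1 - r) * (1 - (1 - r) / 2)"
          by (simp add: power2_eq_square field_simps)
        finally have "compensator s a x = of_real (1 - r) * ((1 - of_real ((1 - r) / 2)) * A)"
          by (simp only: of_real_mult of_real_diff of_real_1 mult.assoc)
        then show ?thesis
          by (simp add: h_def v_def algebra_simps)
      qed
      then have "cmod h = (1 - r) * cmod ((A - (1 + y) / P) - of_real ((1 - r) / 2) * A)"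
        using r by (simp only: norm_mult norm_of_real)
      also have "\<dots> \<le> (1 - r) * (2 * (1 + K) * (1 - r) / (1 - \<rho>)\<^sup>2 + (1 - r) / 2 * (2 / (1 - \<rho>)))"
      proof (intro mult_left_mono)
        have "cmod (of_real ((1 - r) / 2) * A) \<le> (1 - r) / 2 * (2 / (1 - \<rho>))"
          unfolding norm_mult norm_of_real using A r by (intro mult_mono) auto
        then show "cmod ((A - (1 + y) / P) - of_real ((1 - r) / 2) * A) \<le> 2 * (1 + K) * (1 - r) / (1 - \<rho>)\<^sup>2 + (1 - r) / 2 * (2 / (1 - \<rho>))"
          using AB norm_triangle_ineq4[of "A - (1 + y) / P" "of_real ((1 - r) / 2) * A"] by linarith
      qed (use r in auto)
      also have "\<dots> = M2 * (1 - r)\<^sup>2"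
      proof -
        have "w * (c * w / D + w / 2 * (2 / d)) = (c / D + 1 / d) * w\<^sup>2" for c D d w :: real
          by (simp add: distrib_right distrib_left power2_eq_square)
        then show ?thesis by (simp only: M2_def)
      qed
      finally show ?thesis .
    qed
    have r2: "(1 - r)\<^sup>2 \<le> 1" using r by (intro power_le_one) auto
    have v1: "cmod v \<le> M1" using v r M mult_left_le[of "1 - r" M1] by auto
    have h1: "cmod h \<le> M2" using h r2 M mult_left_le[of "(1 - r)\<^sup>2" M2] by auto
    have "canonical_factor s a x - 1 = ((1 - v) * exp v - 1) * exp h + (exp h - 1)"
    proof -
      have "exp (compensator s a x) = exp v * exp h" by (simp add: h_def flip: exp_add)
      then show ?thesis by (simp add: canonical_factor_def bl algebra_simps)
    qed
    then have "cmod (canonical_factor s a x - 1) \<le> cmod ((1 - v) * exp v - 1) * cmod (exp h) + cmod (exp h - 1)"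
      using norm_triangle_ineq by (metis norm_mult)
    also have "\<dots> \<le> ((M1 * (1 - r))\<^sup>2 * exp M1) * exp M2 + (M2 * (1 - r)\<^sup>2) * exp M2"
    proof (intro add_mono mult_mono)
      have "(cmod v)\<^sup>2 * exp (cmod v) \<le> (M1 * (1 - r))\<^sup>2 * exp M1"
        using v v1 by (intro mult_mono power_mono) auto
      then show "cmod ((1 - v) * exp v - 1) \<le> (M1 * (1 - r))\<^sup>2 * exp M1"
        using norm_primary_factor_minus_one_le[of v] by linarith
      show "cmod (exp h) \<le> exp M2" using norm_exp[of h] h1 by (auto intro: order_trans)
      have "cmod h * exp (cmod h) \<le> (M2 * (1 - r)\<^sup>2) * exp M2"
        using h h1 M by (intro mult_mono) auto
      then show "cmod (exp h - 1) \<le> (M2 * (1 - r)\<^sup>2) * exp M2"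
        using norm_exp_minus_one_le[of h] by linarith
    qed auto
    also have "\<dots> = B * (1 - r)\<^sup>2"
    proof -
      have "(m * w) * e1 * e2 + (n * w) * e2 = (m * e1 * e2 + n * e2) * w" for m w e1 e2 n :: real
        by (simp add: algebra_simps)
      then show ?thesis by (simp only: B_def power_mult_distrib)
    qed
    finally show ?thesis by (simp add: r_def)
  qed
  then show ?thesis by blast
qed


section \<open>The infinite product and its size\<close>

locale swept_sequence = thin_sequence +
  fixes s :: "nat \<Rightarrow> real" and q K C0 \<delta> :: real
  assumes s: "n \<in> I \<Longrightarrow> 0 \<le> s n" "n \<in> I \<Longrightarrow> s n < 1" "n \<in> I \<Longrightarrow> 1 - s n \<le> K * (1 - cmod (z n))"
    and K: "0 \<le> K" and q: "0 < q" "q < 1"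
    and sum_swept_diff: "cmod x < 1 \<Longrightarrow> cmod w < 1 \<Longrightarrow> finite F \<Longrightarrow> F \<subseteq> I \<Longrightarrow>
       (\<Sum>n\<in>F. swept (s n) (z n) x - swept (s n) (z n) w) \<le> q * ln (cmod (1 - cnj w * x) / (1 - cmod x)) + C0"
    and \<delta>: "0 < \<delta>" "\<delta> \<le> 1"
    and far: "n \<in> I \<Longrightarrow> k \<in> I \<Longrightarrow> n \<noteq> k \<Longrightarrow> \<delta> < pseudohyp (z n) (z k)"
begin

definition dev :: "nat \<Rightarrow> complex \<Rightarrow> real" where
  "dev n x = (if n \<in> I then swept (s n) (z n) x else 0)"

text \<open>The weight \<open>\<Phi>\<close> of the overview.\<close>

definition weight :: "complex \<Rightarrow> real" where
  "weight x = (\<Sum>n. dev n x)"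

definition factor :: "nat \<Rightarrow> complex \<Rightarrow> complex" where
  "factor n x = (if n \<in> I then canonical_factor (s n) (z n) x else 1)"

definition can_prod :: "complex \<Rightarrow> complex" where
  "can_prod x = lim (\<lambda>N. \<Prod>n<N. factor n x)"

lemma sum_restrict: "(\<Sum>n<N. if n \<in> I then h n else 0) = (\<Sum>n\<in>I \<inter> {..<N}. h n :: real)"
  by (intro sum.mono_neutral_cong_right) auto

lemma prod_restrict: "(\<Prod>n<N. factor n x) = (\<Prod>n\<in>I \<inter> {..<N}. canonical_factor (s n) (z n) x)"
  by (intro prod.mono_neutral_cong_right) (auto simp: factor_def)

lemma summable_one_minus_sq: "summable (\<lambda>n. if n \<in> I then (1 - cmod (z n))\<^sup>2 else 0)"
proof -
  obtain C where C: "C > 0" "\<forall>w t F. cmod w < 1 \<longrightarrow> 0 < t \<longrightarrow> finite F \<longrightarrow> F \<subseteq> I \<longrightarrow>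
     (\<forall>n\<in>F. cmod (1 - cnj (z n) * w) \<le> t) \<longrightarrow> (\<Sum>n\<in>F. (1 - cmod (z n)) powr 2) \<le> C * t powr 2"
    using sum_near_le[of 2] by auto
  show ?thesis
  proof (rule summableI_nonneg_bounded)
    fix N
    have "(\<Sum>n<N. if n \<in> I then (1 - cmod (z n))\<^sup>2 else 0) = (\<Sum>n\<in>I \<inter> {..<N}. (1 - cmod (z n)) powr 2)"
      unfolding sum_restrict
    proof (intro sum.cong refl)
      fix n assume "n \<in> I \<inter> {..<N}"
      then have "cmod (z n) < 1" using in_disc by auto
      then show "(1 - cmod (z n))\<^sup>2 = (1 - cmod (z n)) powr 2" by simp
    qed
    also have "\<dots> \<le> C * 1 powr 2"
      by (rule C(2)[rule_format, of 0]) auto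
    finally show "(\<Sum>n<N. if n \<in> I then (1 - cmod (z n))\<^sup>2 else 0) \<le> C" by simp
  qed simp
qed

lemma dev_nonneg: "0 \<le> dev n x"
proof (cases "n \<in> I")
  case True
  then show ?thesis
    using s(1,2)[of n] in_disc[of n] swept_nonneg[of "z n" "s n" x] by (simp add: dev_def)
qed (simp add: dev_def)

lemma summable_dev:
  assumes x: "cmod x < 1"
  shows "summable (\<lambda>n. dev n x)"
proof (rule summable_comparison_test')
  show "summable (\<lambda>n. 8 * (K + 1) / (1 - cmod x)\<^sup>2 * (if n \<in> I then (1 - cmod (z n))\<^sup>2 else 0))"
    by (intro summable_mult summable_one_minus_sq)
  show "norm (dev n x) \<le> 8 * (K + 1) / (1 - cmod x)\<^sup>2 * (if n \<in> I then (1 - cmod (z n))\<^sup>2 else 0)" if "n \<ge> 0" for n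
  proof (cases "n \<in> I")
    case True
    have zn: "cmod (z n) < 1" by (rule in_disc[OF True])
    have "swept (s n) (z n) x \<le> 8 * (K + 1) * (1 - cmod (z n))\<^sup>2 / (cmod (1 - cnj (z n) * x))\<^sup>2"
      by (rule swept_le[OF zn x s[OF True]])
    also have "\<dots> \<le> 8 * (K + 1) * (1 - cmod (z n))\<^sup>2 / (1 - cmod x)\<^sup>2"
      using K x zn cmod_one_minus_cnj_mult_ge(2)[of "z n" x] cmod_one_minus_cnj_mult_pos[OF zn x]
      by (intro divide_left_mono mult_pos_pos zero_less_power power_mono) auto
    finally show ?thesis using True dev_nonneg[of n x] by (simp add: dev_def)
  qed (simp add: dev_def)
qed

lemma weight_diff_le:
  assumes x: "cmod x < 1" and w: "cmod w < 1"
  shows "weight x - weight w \<le> q * ln (cmod (1 - cnj w * x) / (1 - cmod x)) + C0"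
proof (rule LIMSEQ_le_const2)
  show "(\<lambda>N. (\<Sum>n<N. dev n x) - (\<Sum>n<N. dev n w)) \<longlonglongrightarrow> weight x - weight w"
    unfolding weight_def by (intro tendsto_diff summable_LIMSEQ summable_dev x w)
  have "(\<Sum>n<N. dev n x) - (\<Sum>n<N. dev n w) \<le> q * ln (cmod (1 - cnj w * x) / (1 - cmod x)) + C0" for N
    unfolding dev_def sum_restrict sum_subtractf[symmetric] by (rule sum_swept_diff[OF x w]) auto
  then show "\<exists>N. \<forall>n\<ge>N. (\<Sum>m<n. dev m x) - (\<Sum>m<n. dev m w) \<le> q * ln (cmod (1 - cnj w * x) / (1 - cmod x)) + C0"
    by blast
qed

lemma uniform_limit_can_prod:
  assumes \<rho>: "\<rho> < 1"
  shows "uniform_limit (cball 0 \<rho>) (\<lambda>N x. \<Prod>n<N. factor n x) can_prod sequentially"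
proof -
  obtain B where B: "\<forall>a x s. cmod a < 1 \<longrightarrow> cmod x \<le> \<rho> \<longrightarrow> 0 \<le> s \<longrightarrow> s < 1 \<longrightarrow> 1 - s \<le> K * (1 - cmod a) \<longrightarrow>
    cmod (canonical_factor s a x - 1) \<le> B * (1 - cmod a)\<^sup>2"
    using canonical_factor_minus_one_le[OF \<rho> K] by blast
  have "uniformly_convergent_on (cball 0 \<rho>) (\<lambda>N x. \<Prod>n<N. factor n x)"
  proof (rule uniformly_convergent_on_prod')
    show "continuous_on (cball 0 \<rho>) (factor n)" for n
    proof (cases "n \<in> I")
      case True
      have "canonical_factor (s n) (z n) holomorphic_on ball 0 1"
        using s[OF True] in_disc[OF True] by (intro holomorphic_canonical_factor) auto
      then have "continuous_on (ball 0 1) (canonical_factor (s n) (z n))"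
        by (rule holomorphic_on_imp_continuous_on)
      then have "continuous_on (cball 0 \<rho>) (canonical_factor (s n) (z n))"
        using \<rho> by (rule_tac continuous_on_subset) auto
      then show ?thesis using True by (simp add: factor_def[abs_def])
    next
      case False
      then show ?thesis by (simp add: factor_def[abs_def])
    qed
    show "uniformly_convergent_on (cball 0 \<rho>) (\<lambda>N x. \<Sum>n<N. norm (factor n x - 1))"
    proof (rule uniformly_convergentI[OF Weierstrass_m_test])
      show "norm (norm (factor n x - 1)) \<le> B * (if n \<in> I then (1 - cmod (z n))\<^sup>2 else 0)" if "x \<in> cball 0 \<rho>" for n x
        using B[rule_format, OF in_disc, of n x "s n"] s[of n] that by (auto simp: factor_def)
      show "summable (\<lambda>n. B * (if n \<in> I then (1 - cmod (z n))\<^sup>2 else 0))"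
        by (intro summable_mult summable_one_minus_sq)
    qed
  qed simp
  then show ?thesis
    unfolding can_prod_def uniformly_convergent_uniform_limit_iff .
qed

lemma holomorphic_can_prod: "can_prod holomorphic_on ball 0 1"
proof (rule holomorphic_uniform_sequence)
  show "(\<lambda>x. \<Prod>n<N. factor n x) holomorphic_on ball 0 1" for N
  proof (rule holomorphic_on_prod)
    show "factor n holomorphic_on ball 0 1" for n
    proof (cases "n \<in> I")
      case True
      then show ?thesis
        using s[OF True] in_disc[OF True] holomorphic_canonical_factor[of "z n" "s n"]
        by (simp add: factor_def[abs_def])
    next
      case False
      then show ?thesis by (simp add: factor_def[abs_def])
    qed
  qed
  fix x :: complex assume "x \<in> ball 0 1"
  then have x: "cmod x < 1" by simp
  define d where "d = (1 - cmod x) / 2"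
  have sub: "cball x d \<subseteq> cball 0 (1 - d)"
  proof
    fix y assume "y \<in> cball x d"
    then have "cmod y \<le> cmod x + d"
      using norm_triangle_sub[of y x] by (simp add: dist_norm norm_minus_commute)
    then show "y \<in> cball 0 (1 - d)" using x by (simp add: d_def field_simps)
  qed
  have d: "d > 0" using x by (simp add: d_def)
  have "uniform_limit (cball x d) (\<lambda>N x. \<Prod>n<N. factor n x) can_prod sequentially"
    using uniform_limit_can_prod[of "1 - d"] d sub by (intro uniform_limit_on_subset[OF _ sub]) auto
  moreover have "cball x d \<subseteq> ball 0 1" using sub d by force
  ultimately show "\<exists>d>0. cball x d \<subseteq> ball 0 1 \<and> uniform_limit (cball x d) (\<lambda>N x. \<Prod>n<N. factor n x) can_prod sequentially"
    using d by blast
qed simp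

lemma tendsto_can_prod:
  assumes x: "cmod x < 1"
  shows "(\<lambda>N. cmod (\<Prod>n<N. factor n x)) \<longlonglongrightarrow> cmod (can_prod x)"
  using tendsto_uniform_limitI[OF uniform_limit_can_prod[OF x], of x] by (intro tendsto_norm) simp

lemma sum_kernel_3:
  "\<exists>C>0. \<forall>x F. cmod x < 1 \<longrightarrow> finite F \<longrightarrow> F \<subseteq> I \<longrightarrow>
     (1 - cmod x) * (\<Sum>n\<in>F. (1 - cmod (z n))\<^sup>2 / cmod (1 - cnj (z n) * x) ^ 3) \<le> C"
proof -
  obtain C where C: "C > 0" "\<forall>w F. cmod w < 1 \<longrightarrow> finite F \<longrightarrow> F \<subseteq> I \<longrightarrow>
     (\<Sum>n\<in>F. (1 - cmod (z n)) powr 2 / cmod (1 - cnj (z n) * w) powr 3) \<le> C * (1 - cmod w) powr (2 - 3)"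
    using sum_kernel_le'[of 2 3] by auto
  have "(1 - cmod x) * (\<Sum>n\<in>F. (1 - cmod (z n))\<^sup>2 / cmod (1 - cnj (z n) * x) ^ 3) \<le> C"
    if x: "cmod x < 1" and F: "finite F" "F \<subseteq> I" for x F
  proof -
    have "(\<Sum>n\<in>F. (1 - cmod (z n))\<^sup>2 / cmod (1 - cnj (z n) * x) ^ 3) =
        (\<Sum>n\<in>F. (1 - cmod (z n)) powr 2 / cmod (1 - cnj (z n) * x) powr 3)"
    proof (intro sum.cong refl)
      fix n assume "n \<in> F"
      then have "cmod (z n) < 1" using F in_disc by auto
      moreover from this have "cmod (1 - cnj (z n) * x) > 0" using x by (rule cmod_one_minus_cnj_mult_pos)
      ultimately show "(1 - cmod (z n))\<^sup>2 / cmod (1 - cnj (z n) * x) ^ 3 =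
          (1 - cmod (z n)) powr 2 / cmod (1 - cnj (z n) * x) powr 3" by simp
    qed
    also have "\<dots> \<le> C * (1 - cmod x) powr (2 - 3)" by (rule C(2)[rule_format, OF x F])
    also have "\<dots> = C / (1 - cmod x)" using x by (simp add: powr_minus divide_inverse)
    finally show ?thesis using x by (simp add: field_simps)
  qed
  then show ?thesis using C(1) by blast
qed

lemma sum_kernel_4:
  "\<exists>C>0. \<forall>x F. cmod x < 1 \<longrightarrow> finite F \<longrightarrow> F \<subseteq> I \<longrightarrow> (\<Sum>n\<in>F. (1 - (pseudohyp x (z n))\<^sup>2)\<^sup>2) \<le> C"
proof -
  obtain C where C: "C > 0" "\<forall>w F. cmod w < 1 \<longrightarrow> finite F \<longrightarrow> F \<subseteq> I \<longrightarrow>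
     (\<Sum>n\<in>F. (1 - cmod (z n)) powr 2 / cmod (1 - cnj (z n) * w) powr 4) \<le> C * (1 - cmod w) powr (2 - 4)"
    using sum_kernel_le'[of 2 4] by auto
  have "(\<Sum>n\<in>F. (1 - (pseudohyp x (z n))\<^sup>2)\<^sup>2) \<le> 16 * C"
    if x: "cmod x < 1" and F: "finite F" "F \<subseteq> I" for x F
  proof -
    have pt: "(1 - (pseudohyp x (z n))\<^sup>2)\<^sup>2 \<le> 16 * (1 - cmod x)\<^sup>2 * ((1 - cmod (z n)) powr 2 / cmod (1 - cnj (z n) * x) powr 4)"
      if n: "n \<in> F" for n
    proof -
      have zn: "cmod (z n) < 1" using in_disc n F by auto
      define y where "y = cmod (1 - cnj (z n) * x)"
      have y: "y > 0" unfolding y_def by (rule cmod_one_minus_cnj_mult_pos[OF zn x])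
      have e: "1 - (pseudohyp x (z n))\<^sup>2 = (1 - (cmod (z n))\<^sup>2) * (1 - (cmod x)\<^sup>2) / y\<^sup>2"
        unfolding pseudohyp_commute[of x] y_def by (rule one_minus_pseudohyp_sq[OF zn x])
      have b: "0 \<le> 1 - (cmod (z n))\<^sup>2" "1 - (cmod (z n))\<^sup>2 \<le> 2 * (1 - cmod (z n))"
        "0 \<le> 1 - (cmod x)\<^sup>2" "1 - (cmod x)\<^sup>2 \<le> 2 * (1 - cmod x)"
        using one_minus_sq_bounds[of "cmod (z n)"] one_minus_sq_bounds[of "cmod x"] x zn by auto
      have "1 - (pseudohyp x (z n))\<^sup>2 \<le> (2 * (1 - cmod (z n))) * (2 * (1 - cmod x)) / y\<^sup>2"
        unfolding e using b y zn by (intro divide_right_mono mult_mono) auto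
      moreover have "0 \<le> 1 - (pseudohyp x (z n))\<^sup>2" unfolding e using b by simp
      ultimately have "(1 - (pseudohyp x (z n))\<^sup>2)\<^sup>2 \<le> ((2 * (1 - cmod (z n))) * (2 * (1 - cmod x)) / y\<^sup>2)\<^sup>2"
        by (intro power_mono)
      also have "\<dots> = 16 * (1 - cmod x)\<^sup>2 * ((1 - cmod (z n))\<^sup>2 / y ^ 4)"
        using y by (simp add: field_simps power2_eq_square power4_eq_xxxx)
      also have "\<dots> = 16 * (1 - cmod x)\<^sup>2 * ((1 - cmod (z n)) powr 2 / y powr 4)"
        using zn y by simp
      finally show ?thesis by (simp only: y_def)
    qed
    have "(\<Sum>n\<in>F. (1 - (pseudohyp x (z n))\<^sup>2)\<^sup>2) \<le>
        (\<Sum>n\<in>F. 16 * (1 - cmod x)\<^sup>2 * ((1 - cmod (z n)) powr 2 / cmod (1 - cnj (z n) * x) powr 4))"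
      by (rule sum_mono[OF pt])
    also have "\<dots> = 16 * (1 - cmod x)\<^sup>2 * (\<Sum>n\<in>F. (1 - cmod (z n)) powr 2 / cmod (1 - cnj (z n) * x) powr 4)"
      by (simp add: sum_distrib_left)
    also have "\<dots> \<le> 16 * (1 - cmod x)\<^sup>2 * (C * (1 - cmod x) powr (2 - 4))"
      by (intro mult_left_mono C(2)[rule_format, OF x F]) auto
    also have "(1 - cmod x) powr (2 - 4) = 1 / (1 - cmod x)\<^sup>2"
      using x by (simp add: powr_minus divide_inverse)
    finally show ?thesis using x by simp
  qed
  moreover have "16 * C > 0" using C(1) by simp
  ultimately show ?thesis by blast
qed

text \<open>The product has size \<open>exp (weight x)\<close> up to constants and the distance to
  the nearest zero. In the lower bound \<open>k\<close> names the only zero that may be near; an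
  index outside \<open>I\<close> expresses that there is none, and then no distance appears.\<close>

lemma can_prod_bounds:
  assumes e: "0 < e"
  shows "\<exists>c C. 0 < c \<and> 0 < C \<and>
    (\<forall>x. cmod x < 1 \<longrightarrow> cmod (can_prod x) \<le> C * exp (weight x)) \<and>
    (\<forall>x k. cmod x < 1 \<longrightarrow> k \<in> I \<longrightarrow> cmod (can_prod x) \<le> C * pseudohyp x (z k) * exp (weight x)) \<and>
    (\<forall>x k. cmod x < 1 \<longrightarrow> (\<forall>n\<in>I - {k}. e \<le> pseudohyp x (z n)) \<longrightarrow>
      c * (if k \<in> I then pseudohyp x (z k) else 1) * exp (weight x) \<le> cmod (can_prod x))"
proof -
  obtain C3 where C3: "C3 > 0" "\<forall>x F. cmod x < 1 \<longrightarrow> finite F \<longrightarrow> F \<subseteq> I \<longrightarrow>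
     (1 - cmod x) * (\<Sum>n\<in>F. (1 - cmod (z n))\<^sup>2 / cmod (1 - cnj (z n) * x) ^ 3) \<le> C3"
    using sum_kernel_3 by blast
  obtain C4 where C4: "C4 > 0" "\<forall>x F. cmod x < 1 \<longrightarrow> finite F \<longrightarrow> F \<subseteq> I \<longrightarrow> (\<Sum>n\<in>F. (1 - (pseudohyp x (z n))\<^sup>2)\<^sup>2) \<le> C4"
    using sum_kernel_4 by blast
  define A where "A = 8 * K * (K + 2) * C3"
  define err where "err = (\<lambda>n x. 8 * K * (K + 2) * (1 - cmod x) * ((1 - cmod (z n))\<^sup>2 / cmod (1 - cnj (z n) * x) ^ 3))"
  have err_nonneg: "0 \<le> err n x" if "cmod x < 1" for n x
    unfolding err_def using that K by simp
  have sum_err: "(\<Sum>n\<in>F. err n x) \<le> A" if x: "cmod x < 1" and F: "finite F" "F \<subseteq> I" for F x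
  proof -
    have "(\<Sum>n\<in>F. err n x) = 8 * K * (K + 2) * ((1 - cmod x) * (\<Sum>n\<in>F. (1 - cmod (z n))\<^sup>2 / cmod (1 - cnj (z n) * x) ^ 3))"
      by (simp add: err_def sum_distrib_left mult_ac)
    also have "\<dots> \<le> 8 * K * (K + 2) * C3"
      using K by (intro mult_left_mono C3(2)[rule_format, OF x F]) auto
    finally show ?thesis by (simp add: A_def)
  qed
  define FN where "FN = (\<lambda>N::nat. I \<inter> {..<N})"
  have FN: "finite (FN N)" "FN N \<subseteq> I" for N by (auto simp: FN_def)
  define V where "V = (\<lambda>N x. \<Sum>n<N. dev n x)"
  have V: "V N x = (\<Sum>n\<in>FN N. swept (s n) (z n) x)" for N x
    unfolding V_def dev_def sum_restrict FN_def ..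
  have V_le: "V N x \<le> weight x" if "cmod x < 1" for N x
    unfolding V_def weight_def by (intro sum_le_suminf summable_dev that) (auto simp: dev_nonneg)
  have P: "cmod (\<Prod>n<N. factor n x) = (\<Prod>n\<in>FN N. cmod (canonical_factor (s n) (z n) x))" for N x
    unfolding prod_restrict FN_def by (rule prod_norm[symmetric])
  have cf: "cmod (canonical_factor (s n) (z n) x) \<le> exp (swept (s n) (z n) x + err n x)"
    "cmod (canonical_factor (s n) (z n) x) \<le> pseudohyp x (z n) * exp (1 / 2 + (swept (s n) (z n) x + err n x))"
    "e \<le> pseudohyp x (z n) \<Longrightarrow> exp (swept (s n) (z n) x - (err n x + (1 - (pseudohyp x (z n))\<^sup>2)\<^sup>2 / (2 * e\<^sup>2)))
      \<le> cmod (canonical_factor (s n) (z n) x)" if n: "n \<in> FN N" and x: "cmod x < 1" for n N x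
  proof -
    have nI: "n \<in> I" using n FN by blast
    note cf = cmod_canonical_factor[OF in_disc[OF nI] x s(1)[OF nI] s(2)[OF nI] K s(3)[OF nI] refl]
    show "cmod (canonical_factor (s n) (z n) x) \<le> exp (swept (s n) (z n) x + err n x)"
      unfolding err_def by (rule cf(1))
    show "cmod (canonical_factor (s n) (z n) x) \<le> pseudohyp x (z n) * exp (1 / 2 + (swept (s n) (z n) x + err n x))"
      unfolding err_def by (rule cf(2))
    show "exp (swept (s n) (z n) x - (err n x + (1 - (pseudohyp x (z n))\<^sup>2)\<^sup>2 / (2 * e\<^sup>2)))
      \<le> cmod (canonical_factor (s n) (z n) x)" if "e \<le> pseudohyp x (z n)"
      unfolding err_def by (rule cf(4)[OF e that])
  qed
  have up: "cmod (\<Prod>n<N. factor n x) \<le> exp (weight x + A)" if x: "cmod x < 1" for N x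
  proof -
    have "(\<Prod>n\<in>FN N. cmod (canonical_factor (s n) (z n) x)) \<le> (\<Prod>n\<in>FN N. exp (swept (s n) (z n) x + err n x))"
      using x by (intro prod_mono conjI cf(1)) auto
    also have "\<dots> = exp (V N x + (\<Sum>n\<in>FN N. err n x))"
      using FN by (simp add: V sum.distrib flip: exp_sum)
    also have "\<dots> \<le> exp (weight x + A)" using V_le[OF x] sum_err[OF x FN] by (simp add: add_mono)
    finally show ?thesis unfolding P .
  qed
  have upk: "cmod (\<Prod>n<N. factor n x) \<le> pseudohyp x (z k) * exp (1 / 2 + (weight x + A))"
    if x: "cmod x < 1" and k: "k \<in> I" "k < N" for N x k
  proof -
    have kN: "k \<in> FN N" using k by (simp add: FN_def)
    have "(\<Prod>n\<in>FN N. cmod (canonical_factor (s n) (z n) x)) =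
        cmod (canonical_factor (s k) (z k) x) * (\<Prod>n\<in>FN N - {k}. cmod (canonical_factor (s n) (z n) x))"
      using FN kN by (intro prod.remove) auto
    also have "\<dots> \<le> (pseudohyp x (z k) * exp (1 / 2 + (swept (s k) (z k) x + err k x))) *
        (\<Prod>n\<in>FN N - {k}. exp (swept (s n) (z n) x + err n x))"
    proof (intro mult_mono prod_mono conjI)
      show "cmod (canonical_factor (s k) (z k) x) \<le> pseudohyp x (z k) * exp (1 / 2 + (swept (s k) (z k) x + err k x))"
        by (rule cf(2)[OF kN x])
      show "cmod (canonical_factor (s n) (z n) x) \<le> exp (swept (s n) (z n) x + err n x)" if "n \<in> FN N - {k}" for n
        using that x by (intro cf(1)) auto
    qed (auto simp: pseudohyp_nonneg intro!: prod_nonneg)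
    also have "\<dots> = pseudohyp x (z k) * exp (1 / 2) *
        (exp (swept (s k) (z k) x + err k x) * (\<Prod>n\<in>FN N - {k}. exp (swept (s n) (z n) x + err n x)))"
      unfolding exp_add[of "1 / 2"] by (simp only: mult.assoc)
    also have "exp (swept (s k) (z k) x + err k x) * (\<Prod>n\<in>FN N - {k}. exp (swept (s n) (z n) x + err n x)) =
        (\<Prod>n\<in>FN N. exp (swept (s n) (z n) x + err n x))"
      using FN kN by (intro prod.remove[symmetric]) auto
    also have "\<dots> = exp (V N x + (\<Sum>n\<in>FN N. err n x))"
      using FN by (simp add: V sum.distrib flip: exp_sum)
    also have "pseudohyp x (z k) * exp (1 / 2) * \<dots> \<le> pseudohyp x (z k) * exp (1 / 2) * exp (weight x + A)"
      using V_le[OF x] sum_err[OF x FN] by (intro mult_left_mono) (auto simp: add_mono pseudohyp_nonneg)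
    finally show ?thesis unfolding P exp_add[of "1 / 2"] by (simp only: mult.assoc)
  qed
  define D where "D = A + C4 / (2 * e\<^sup>2)"
  \<comment> \<open>The factor at \<open>k\<close> uses the bound that is valid even at its zero;
    all others use the one for distant zeros. The two error sums are bounded together by
    \<open>D\<close>.\<close>
  have low: "(if k \<in> I then pseudohyp x (z k) else 1) * exp (V N x - D) \<le> cmod (\<Prod>n<N. factor n x)"
    if x: "cmod x < 1" and k: "\<forall>n\<in>I - {k}. e \<le> pseudohyp x (z n)" for N x k
  proof -
    define \<rho>k where "\<rho>k = (if k \<in> I then pseudohyp x (z k) else 1)"
    have \<rho>k: "0 \<le> \<rho>k" "\<rho>k \<le> 1"
      using pseudohyp_less_1[OF x in_disc, of k] by (auto simp: \<rho>k_def pseudohyp_nonneg)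
    define h where "h = (\<lambda>n. swept (s n) (z n) x - (err n x + (1 - (pseudohyp x (z n))\<^sup>2)\<^sup>2 / (2 * e\<^sup>2)))"
    have hle: "exp (h n) \<le> cmod (canonical_factor (s n) (z n) x)" if "n \<in> FN N" "n \<noteq> k" for n
      unfolding h_def using that FN k by (intro cf(3)[OF that(1) x]) auto
    have hle': "\<rho>k * exp (h n) \<le> cmod (canonical_factor (s n) (z n) x)" if "n \<in> FN N" "n = k" for n
    proof -
      have nI: "n \<in> I" using that FN by auto
      have "exp (h n) \<le> exp (swept (s n) (z n) x)"
      proof -
        define T where "T = (1 - (pseudohyp x (z n))\<^sup>2)\<^sup>2 / (2 * e\<^sup>2)"
        have "0 \<le> T" by (simp add: T_def)
        then show ?thesis unfolding h_def T_def[symmetric] using err_nonneg[OF x, of n] by simp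
      qed
      then have "\<rho>k * exp (h n) \<le> \<rho>k * exp (swept (s n) (z n) x)" using \<rho>k by (intro mult_left_mono)
      also have "\<dots> = pseudohyp x (z n) * exp (swept (s n) (z n) x)" using that nI by (simp add: \<rho>k_def)
      also have "\<dots> \<le> cmod (canonical_factor (s n) (z n) x)"
        by (rule cmod_canonical_factor(3)[OF in_disc[OF nI] x s(1)[OF nI] s(2)[OF nI] K s(3)[OF nI] refl])
      finally show ?thesis .
    qed
    have "(\<Prod>n\<in>FN N. (if n = k then \<rho>k else 1) * exp (h n)) \<le> (\<Prod>n\<in>FN N. cmod (canonical_factor (s n) (z n) x))"
      using hle hle' \<rho>k by (intro prod_mono conjI) auto
    moreover have "(\<Prod>n\<in>FN N. (if n = k then \<rho>k else 1) * exp (h n)) = (if k \<in> FN N then \<rho>k else 1) * exp (\<Sum>n\<in>FN N. h n)"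
      using FN by (simp add: prod.distrib exp_sum)
    moreover have "(\<Sum>n\<in>FN N. h n) \<ge> V N x - D"
    proof -
      have "(\<Sum>n\<in>FN N. h n) = V N x - ((\<Sum>n\<in>FN N. err n x) + (\<Sum>n\<in>FN N. (1 - (pseudohyp x (z n))\<^sup>2)\<^sup>2) / (2 * e\<^sup>2))"
        unfolding V h_def by (simp add: sum_subtractf sum.distrib sum_divide_distrib)
      moreover have "(\<Sum>n\<in>FN N. (1 - (pseudohyp x (z n))\<^sup>2)\<^sup>2) / (2 * e\<^sup>2) \<le> C4 / (2 * e\<^sup>2)"
        using C4(2) x FN by (intro divide_right_mono) auto
      ultimately show ?thesis using sum_err[OF x FN[of N]] by (simp add: D_def)
    qed
    moreover have "\<rho>k \<le> (if k \<in> FN N then \<rho>k else 1)" using \<rho>k by simp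
    ultimately have "\<rho>k * exp (V N x - D) \<le> (\<Prod>n\<in>FN N. cmod (canonical_factor (s n) (z n) x))"
      using mult_mono[of \<rho>k "if k \<in> FN N then \<rho>k else 1" "exp (V N x - D)" "exp (\<Sum>n\<in>FN N. h n)"] \<rho>k by simp
    then show ?thesis unfolding P \<rho>k_def .
  qed
  define C where "C = exp (1 / 2 + A)"
  have A: "A \<ge> 0" using K C3 by (simp add: A_def)
  have "cmod (can_prod x) \<le> C * exp (weight x)" if x: "cmod x < 1" for x
  proof (rule LIMSEQ_le_const2[OF tendsto_can_prod[OF x]], intro exI allI impI)
    fix N
    have "exp (weight x + A) \<le> C * exp (weight x)"
      unfolding C_def exp_add[symmetric] by simp
    then show "cmod (\<Prod>n<N. factor n x) \<le> C * exp (weight x)" using up[OF x, of N] by linarith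
  qed
  moreover have "cmod (can_prod x) \<le> C * pseudohyp x (z k) * exp (weight x)" if x: "cmod x < 1" and k: "k \<in> I" for x k
  proof (rule LIMSEQ_le_const2[OF tendsto_can_prod[OF x]], intro exI allI impI)
    \<comment> \<open>Only partial products that already contain the factor of \<open>z k\<close>
      show its zero.\<close>
    fix N assume "Suc k \<le> N"
    then have "cmod (\<Prod>n<N. factor n x) \<le> pseudohyp x (z k) * exp (1 / 2 + (weight x + A))"
      by (intro upk x k) simp
    also have "\<dots> = C * pseudohyp x (z k) * exp (weight x)"
      by (simp add: C_def exp_add mult_ac)
    finally show "cmod (\<Prod>n<N. factor n x) \<le> C * pseudohyp x (z k) * exp (weight x)" .
  qed
  moreover have "exp (- D) * (if k \<in> I then pseudohyp x (z k) else 1) * exp (weight x) \<le> cmod (can_prod x)"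
    if x: "cmod x < 1" and k: "\<forall>n\<in>I - {k}. e \<le> pseudohyp x (z n)" for x k
  proof (rule LIMSEQ_le[OF _ tendsto_can_prod[OF x]])
    have "(\<lambda>N. V N x) \<longlonglongrightarrow> weight x"
      unfolding V_def weight_def by (intro summable_LIMSEQ summable_dev x)
    then have "(\<lambda>N. (if k \<in> I then pseudohyp x (z k) else 1) * exp (V N x - D)) \<longlonglongrightarrow>
        (if k \<in> I then pseudohyp x (z k) else 1) * exp (weight x - D)"
      by (intro tendsto_intros)
    moreover have "(if k \<in> I then pseudohyp x (z k) else 1) * exp (weight x - D) =
        exp (- D) * (if k \<in> I then pseudohyp x (z k) else 1) * exp (weight x)"
      by (simp add: exp_diff exp_minus field_simps)
    ultimately show "(\<lambda>N. (if k \<in> I then pseudohyp x (z k) else 1) * exp (V N x - D)) \<longlonglongrightarrow>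
        exp (- D) * (if k \<in> I then pseudohyp x (z k) else 1) * exp (weight x)" by simp
    show "\<exists>N. \<forall>n\<ge>N. (if k \<in> I then pseudohyp x (z k) else 1) * exp (V n x - D) \<le> cmod (\<Prod>n<n. factor n x)"
      using low[OF x k] by blast
  qed
  moreover have "0 < C" "0 < exp (- D)" by (simp_all add: C_def)
  ultimately show ?thesis by blast
qed

end

section \<open>Interpolation and the coefficient\<close>

text \<open>At a zero \<open>a\<close> of \<open>g\<close>, numerator and denominator are both
  divided by \<open>x - a\<close>. The difference quotients, continued by the derivatives, are
  analytic and the new denominator does not vanish at \<open>a\<close>.\<close>

lemma holomorphic_quotient_at_simple_zeros:
  assumes S: "open S" and f: "f holomorphic_on S" and g: "g holomorphic_on S"
    and simple: "\<And>a. a \<in> S \<Longrightarrow> g a = 0 \<Longrightarrow> f a = 0 \<and> deriv g a \<noteq> 0"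
  shows "(\<lambda>x. if g x = 0 then deriv f x / deriv g x else f x / g x) holomorphic_on S" (is "?A holomorphic_on S")
  unfolding holomorphic_on_def
proof
  fix a assume a: "a \<in> S"
  have *: "?A field_differentiable at a"
    if F: "F holomorphic_on S" and G: "G holomorphic_on S" and Ga: "G a \<noteq> 0"
      and eq: "\<And>x. x \<in> S \<Longrightarrow> G x \<noteq> 0 \<Longrightarrow> ?A x = F x / G x" for F G
  proof -
    have cont: "continuous_on S G" using G by (rule holomorphic_on_imp_continuous_on)
    define U where "U = S \<inter> G -` (- {0})"
    have U: "open U" unfolding U_def by (intro continuous_open_preimage cont S) auto
    have aU: "a \<in> U" using a Ga by (simp add: U_def)
    have "(\<lambda>x. F x / G x) holomorphic_on U"
      using F G by (intro holomorphic_intros) (auto simp: U_def elim: holomorphic_on_subset)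
    then have "?A holomorphic_on U"
      by (rule holomorphic_transform) (auto simp: U_def eq)
    then show ?thesis using U aU by (simp add: holomorphic_on_imp_differentiable_at)
  qed
  have "?A field_differentiable at a"
  proof (cases "g a = 0")
    case False
    then show ?thesis by (intro *[OF f g]) auto
  next
    case True
    note fa = simple[OF a True]
    show ?thesis
    proof (rule *[OF pole_lemma_open[OF f S, of a] pole_lemma_open[OF g S, of a]])
      fix x assume x: "x \<in> S" "(if x = a then deriv g a else (g x - g a) / (x - a)) \<noteq> 0"
      then show "?A x = (if x = a then deriv f a else (f x - f a) / (x - a)) / (if x = a then deriv g a else (g x - g a) / (x - a))"
        using fa True by auto
    qed (use fa in simp)
  qed
  then show "?A field_differentiable at a within S"
    by (rule field_differentiable_at_within)
qed

text \<open>On a Euclidean disc whose radius is half the distance to the circle, all quantities of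
  the size of \<open>1 - |w|\<close> stay comparable. This is the region on which Cauchy estimates
  are applied and the weight is nearly constant.\<close>

lemma cmod_one_minus_near:
  assumes w: "cmod w < 1" and d: "cmod (x - w) \<le> (1 - cmod w) / 2"
  shows "cmod x < 1" "(1 - cmod w) / 2 \<le> 1 - cmod x" "1 - cmod x \<le> 2 * (1 - cmod w)"
    "cmod (1 - cnj w * x) \<le> 5 / 2 * (1 - cmod w)"
proof -
  have "\<bar>cmod x - cmod w\<bar> \<le> cmod (x - w)" by (rule norm_triangle_ineq3)
  then show 1: "(1 - cmod w) / 2 \<le> 1 - cmod x" "1 - cmod x \<le> 2 * (1 - cmod w)" "cmod x < 1"
    using d w by (auto simp: abs_le_iff field_simps)
  have "1 - cnj w * x = of_real (1 - (cmod w)\<^sup>2) - cnj w * (x - w)"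
    by (simp only: of_real_diff of_real_1 complex_norm_square) (simp add: algebra_simps)
  then have "cmod (1 - cnj w * x) \<le> cmod (complex_of_real (1 - (cmod w)\<^sup>2)) + cmod (cnj w * (x - w))"
    by (metis norm_triangle_ineq4)
  also have "cmod (complex_of_real (1 - (cmod w)\<^sup>2)) = 1 - (cmod w)\<^sup>2"
    unfolding norm_of_real using one_minus_cmod_sq_pos[OF w] by simp
  also have "\<dots> \<le> 2 * (1 - cmod w)" using one_minus_sq_bounds(2)[of "cmod w"] w by simp
  also have "cmod (cnj w * (x - w)) \<le> 1 * ((1 - cmod w) / 2)"
    unfolding norm_mult using w d by (intro mult_mono) auto
  finally show "cmod (1 - cnj w * x) \<le> 5 / 2 * (1 - cmod w)" by linarith
qed

lemma Cauchy_bound_half: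
  assumes f: "f holomorphic_on ball 0 1" and x: "cmod x < 1"
    and B: "\<And>y. cmod (y - x) \<le> (1 - cmod x) / 2 \<Longrightarrow> cmod (f y) \<le> B"
  shows "cmod (deriv f x) \<le> 2 * B / (1 - cmod x)" "cmod (deriv (deriv f) x) \<le> 8 * B / (1 - cmod x)\<^sup>2"
proof -
  define R where "R = (1 - cmod x) / 2"
  have R: "R > 0" using x by (simp add: R_def)
  have sub: "cball x R \<subseteq> ball 0 1"
  proof
    fix y assume "y \<in> cball x R"
    then have "cmod (y - x) \<le> (1 - cmod x) / 2" by (simp add: dist_norm norm_minus_commute R_def)
    then show "y \<in> ball 0 1" using cmod_one_minus_near(1)[OF x] by simp
  qed
  have 1: "f holomorphic_on ball x R" "continuous_on (cball x R) f"
    using f sub ball_subset_cball[of x R]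
    by (blast intro: holomorphic_on_subset continuous_on_subset holomorphic_on_imp_continuous_on)+
  have "cmod ((deriv ^^ n) f x) \<le> fact n * B / R ^ n" for n
    using 1 R B by (intro Cauchy_inequality) (auto simp: R_def norm_minus_commute)
  from this[of 1] this[of 2]
  show "cmod (deriv f x) \<le> 2 * B / (1 - cmod x)" "cmod (deriv (deriv f) x) \<le> 8 * B / (1 - cmod x)\<^sup>2"
    using x by (simp_all add: R_def numeral_2_eq_2 power2_eq_square field_simps)
qed

context swept_sequence
begin

text \<open>The number 5 bounds both \<open>|1 - cnj w x| / (1 - |x|)\<close> and
  \<open>|1 - cnj w x| / (1 - |w|)\<close> for \<open>|x - w| \<le> (1 - |w|) / 2\<close>. The
  absolute value ensures \<open>exp weight_osc \<ge> 1\<close>.\<close>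

definition weight_osc :: real where
  "weight_osc = \<bar>q * ln 5 + C0\<bar>"

lemma weight_near:
  assumes w: "cmod w < 1" and d: "cmod (x - w) \<le> (1 - cmod w) / 2"
  shows "exp (weight x) \<le> exp weight_osc * exp (weight w)" "exp (weight w) \<le> exp weight_osc * exp (weight x)"
proof -
  note n = cmod_one_minus_near[OF w d]
  define t where "t = cmod (1 - cnj w * x)"
  have t: "t > 0" unfolding t_def by (rule cmod_one_minus_cnj_mult_pos[OF w n(1)])
  have "t \<le> 5 * (1 - cmod x)" using n by (simp add: t_def)
  then have "t / (1 - cmod x) \<le> 5" using n(1) by (simp add: divide_le_eq)
  then have "ln (t / (1 - cmod x)) \<le> ln 5" using t n(1) by simp
  then have "q * ln (t / (1 - cmod x)) \<le> q * ln 5" using q by simp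
  then have "weight x - weight w \<le> weight_osc"
    using weight_diff_le[OF n(1) w] by (simp add: t_def weight_osc_def)
  then show "exp (weight x) \<le> exp weight_osc * exp (weight w)" by (simp flip: exp_add)
  have t': "cmod (1 - cnj x * w) = t" unfolding t_def by (rule cmod_one_minus_cnj_mult_commute)
  have "t \<le> 5 * (1 - cmod w)" using n w by (simp add: t_def)
  then have "t / (1 - cmod w) \<le> 5" using w by (simp add: divide_le_eq)
  then have "ln (t / (1 - cmod w)) \<le> ln 5" using t w by simp
  then have "q * ln (t / (1 - cmod w)) \<le> q * ln 5" using q by simp
  then have "weight w - weight x \<le> weight_osc"
    using weight_diff_le[OF w n(1)] by (simp add: t' weight_osc_def)
  then show "exp (weight w) \<le> exp weight_osc * exp (weight x)" by (simp flip: exp_add)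
qed

lemma weight_quotient:
  assumes x: "cmod x < 1" and w: "cmod w < 1"
  shows "exp (weight x) \<le> exp C0 * exp (weight w) * (cmod (1 - cnj w * x) powr q * (1 - cmod x) powr (- q))"
proof -
  define t where "t = cmod (1 - cnj w * x)"
  have t: "t > 0" unfolding t_def by (rule cmod_one_minus_cnj_mult_pos[OF w x])
  have "exp (weight x) \<le> exp (C0 + weight w + q * ln (t / (1 - cmod x)))"
    using weight_diff_le[OF x w] by (simp add: t_def)
  also have "\<dots> = exp C0 * exp (weight w) * (t / (1 - cmod x)) powr q"
    using t x by (simp add: exp_add powr_def)
  also have "(t / (1 - cmod x)) powr q = t powr q * (1 - cmod x) powr (- q)"
    unfolding powr_minus divide_inverse[symmetric] using t x by (intro powr_divide)
  finally show ?thesis by (simp add: t_def)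
qed

text \<open>
  The interpolating function is \<open>g x * (\<Sum>k. w\<^sub>k / (g' z\<^sub>k (x - z\<^sub>k)) * ((1 - |z\<^sub>k|\<^sup>2) / (1 - cnj z\<^sub>k x))\<^sup>2)\<close>
  with \<open>w\<^sub>k = - g'' z\<^sub>k / (2 g' z\<^sub>k)\<close>; the weights of \<open>x\<close> and \<open>z\<^sub>k\<close> differ by less than the extra
  decay of the square.
\<close>

lemma coefficient_exists:
  "\<exists>A\<in>Hinf2. \<exists>f. nontrivial_solution A f \<and> (\<forall>n\<in>I. f (z n) = 0)"
proof -
  \<comment> \<open>If \<open>x\<close> is within \<open>e\<close> of a zero, the circle used for
    \<open>A0\<close> below has distance between \<open>\<delta> / 12\<close> and
    \<open>\<delta> / 4\<close> from \<open>x\<close>. It is then at distance at least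
    \<open>\<delta> / 12 - \<delta> / 24 = e\<close> from that zero, and farther from the
    others.\<close>
  define e where "e = \<delta> / 24"
  have e: "0 < e" "e \<le> 1" using \<delta> by (auto simp: e_def)
  define g where "g = can_prod"
  define W where "W = (\<lambda>x. exp (weight x))"
  have W0: "W x > 0" for x by (simp add: W_def)
  obtain c C where cC: "0 < c" "0 < C"
    and b1: "\<forall>x. cmod x < 1 \<longrightarrow> cmod (can_prod x) \<le> C * exp (weight x)"
    and b2: "\<forall>x k. cmod x < 1 \<longrightarrow> k \<in> I \<longrightarrow> cmod (can_prod x) \<le> C * pseudohyp x (z k) * exp (weight x)"
    and b3: "\<forall>x k. cmod x < 1 \<longrightarrow> (\<forall>n\<in>I - {k}. e \<le> pseudohyp x (z n)) \<longrightarrow>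
      c * (if k \<in> I then pseudohyp x (z k) else 1) * exp (weight x) \<le> cmod (can_prod x)"
    using can_prod_bounds[OF e(1)] by blast
  have up: "cmod (g x) \<le> C * W x" if "cmod x < 1" for x
    unfolding g_def W_def using b1 that by blast
  have upk: "cmod (g x) \<le> C * pseudohyp x (z k) * W x" if "cmod x < 1" "k \<in> I" for x k
    unfolding g_def W_def using b2 that by blast
  have low0: "\<forall>x k. cmod x < 1 \<longrightarrow> (\<forall>n\<in>I - {k}. e \<le> pseudohyp x (z n)) \<longrightarrow>
      c * (if k \<in> I then pseudohyp x (z k) else 1) * W x \<le> cmod (g x)"
    unfolding g_def W_def by (rule b3)
  have hol_g: "g holomorphic_on ball 0 1" unfolding g_def by (rule holomorphic_can_prod)
  have hol_g': "deriv g holomorphic_on ball 0 1" and hol_g'': "deriv (deriv g) holomorphic_on ball 0 1"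
    using hol_g by (auto intro!: holomorphic_deriv)
  have zD: "cmod (z k) < 1" if "k \<in> I" for k by (rule in_disc[OF that])
  have gz: "g (z k) = 0" if k: "k \<in> I" for k
    using upk[OF zD[OF k] k] pseudohyp_eq_0_iff[OF zD[OF k] zD[OF k]] by simp
  have others: "e \<le> pseudohyp x (z n)"
    if x: "cmod x < 1" and k: "k \<in> I" "pseudohyp x (z k) < \<delta> / 2" and n: "n \<in> I - {k}" for x k n
  proof -
    have "\<delta> < pseudohyp (z n) (z k)" using far k n by auto
    also have "\<dots> \<le> pseudohyp (z n) x + pseudohyp x (z k)"
      using zD n k x by (intro pseudohyp_triangle) auto
    finally show ?thesis using k(2) \<delta> by (simp add: e_def pseudohyp_commute[of "z n"])
  qed
  have zero: "\<exists>k\<in>I. x = z k" if x: "cmod x < 1" and gx: "g x = 0" for x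
  proof (rule ccontr)
    assume no: "\<not> ?thesis"
    have pos: "pseudohyp x (z n) > 0" if "n \<in> I" for n
      using no that pseudohyp_eq_0_iff[OF x zD[OF that]] pseudohyp_nonneg[of x "z n"] by force
    have "\<exists>k. \<forall>n\<in>I - {k}. e \<le> pseudohyp x (z n)"
    proof (cases "\<exists>k\<in>I. pseudohyp x (z k) < \<delta> / 2")
      case True
      then show ?thesis using others[OF x] by blast
    next
      case False
      then have "e \<le> pseudohyp x (z n)" if "n \<in> I" for n
        using that \<delta> by (force simp: e_def)
      then show ?thesis by blast
    qed
    then obtain k where k: "\<forall>n\<in>I - {k}. e \<le> pseudohyp x (z n)" by blast
    have "0 < c * (if k \<in> I then pseudohyp x (z k) else 1) * W x"
      using cC W0 pos by simp
    then show False using low0 x k gx by fastforce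
  qed
  have near_up: "cmod (g y) \<le> C * exp weight_osc * W x" if x: "cmod x < 1" and y: "cmod (y - x) \<le> (1 - cmod x) / 2" for x y
  proof -
    have "cmod (g y) \<le> C * W y" by (rule up[OF cmod_one_minus_near(1)[OF x y]])
    also have "\<dots> \<le> C * (exp weight_osc * W x)"
      using weight_near(1)[OF x y] cC by (intro mult_left_mono) (auto simp: W_def)
    finally show ?thesis by simp
  qed
  define M where "M = C * exp weight_osc"
  have M: "M > 0" using cC by (simp add: M_def)
  have g'_le: "cmod (deriv g x) \<le> 2 * (M * W x) / (1 - cmod x)"
    and g''_le: "cmod (deriv (deriv g) x) \<le> 8 * (M * W x) / (1 - cmod x)\<^sup>2" if x: "cmod x < 1" for x
    using Cauchy_bound_half[OF hol_g x, of "M * W x"] near_up[OF x] by (simp_all add: M_def)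
  define m where "m = c * exp (- weight_osc) * (2 / 5)"
  have m: "m > 0" using cC by (simp add: m_def)
  \<comment> \<open>Close to \<open>z k\<close> all other zeros are far, so the lower bound of the
    product applies to each difference quotient and passes to the limit. The factor 2/5 in
    \<open>m\<close> is the reciprocal of the 5/2 in
    \<open>|1 - cnj x z_k| \<le> 5/2 * \<eta>\<close>.\<close>
  have g'_ge: "m * W (z k) / (1 - cmod (z k)) \<le> cmod (deriv g (z k))" if k: "k \<in> I" for k
  proof -
    define \<eta> where "\<eta> = 1 - cmod (z k)"
    have \<eta>: "\<eta> > 0" using zD[OF k] by (simp add: \<eta>_def)
    have "(g has_field_derivative deriv g (z k)) (at (z k))"
      using zD[OF k] by (intro holomorphic_derivI[OF hol_g]) auto
    then have "((\<lambda>x. cmod ((g x - g (z k)) / (x - z k))) \<longlongrightarrow> cmod (deriv g (z k))) (at (z k))"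
      unfolding has_field_derivative_iff by (rule tendsto_norm)
    moreover have "eventually (\<lambda>x. m * W (z k) / \<eta> \<le> cmod ((g x - g (z k)) / (x - z k))) (at (z k))"
      unfolding eventually_at
    proof (intro exI conjI ballI impI)
      show "0 < \<delta> / 4 * \<eta>" using \<delta> \<eta> by simp
      fix x assume "x \<in> UNIV" and x: "x \<noteq> z k \<and> dist x (z k) < \<delta> / 4 * \<eta>"
      have d0: "cmod (x - z k) < \<delta> / 4 * \<eta>" using x by (simp add: dist_norm)
      also have "\<delta> / 4 * \<eta> \<le> 1 / 2 * \<eta>" using \<delta> \<eta> by (intro mult_right_mono) auto
      finally have d: "cmod (x - z k) \<le> (1 - cmod (z k)) / 2" by (simp add: \<eta>_def)
      note n = cmod_one_minus_near[OF zD[OF k] d]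
      define t where "t = cmod (1 - cnj x * z k)"
      have t: "t \<ge> \<eta>" "t \<le> 5 / 2 * \<eta>"
      proof -
        show "t \<ge> \<eta>"
          unfolding t_def \<eta>_def using n(1) zD[OF k] by (intro cmod_one_minus_cnj_mult_ge(2)) auto
        show "t \<le> 5 / 2 * \<eta>"
          unfolding t_def \<eta>_def cmod_one_minus_cnj_mult_commute[of x "z k"] by (rule n(4))
      qed
      have \<rho>: "pseudohyp x (z k) = cmod (x - z k) / t" by (simp add: pseudohyp_def t_def)
      also have "\<dots> \<le> (\<delta> / 4 * \<eta>) / \<eta>" using d0 t \<eta> \<delta> by (intro frac_le) auto
      also have "\<dots> < \<delta> / 2" using \<eta> \<delta> by simp
      finally have "\<forall>n\<in>I - {k}. e \<le> pseudohyp x (z n)" using others[OF n(1) k] by blast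
      then have "c * (cmod (x - z k) / t) * W x \<le> cmod (g x)"
        using low0 n(1) k \<rho> by fastforce
      then have "c * W x / t \<le> cmod (g x) / cmod (x - z k)"
        using x by (simp add: le_divide_eq mult_ac)
      moreover have "m * W (z k) / \<eta> \<le> c * W x / t"
      proof -
        have "exp (- weight_osc) * W (z k) \<le> W x"
          using weight_near(2)[OF zD[OF k] d] by (simp add: W_def exp_minus field_simps)
        then have "c * (exp (- weight_osc) * W (z k)) / (5 / 2 * \<eta>) \<le> c * W x / t"
          using cC t \<eta> W0[of x] by (intro frac_le mult_left_mono) (auto intro!: mult_nonneg_nonneg less_imp_le)
        then show ?thesis by (simp add: m_def mult_ac)
      qed
      ultimately show "m * W (z k) / \<eta> \<le> cmod ((g x - g (z k)) / (x - z k))"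
        using gz[OF k] by (simp add: norm_divide)
    qed
    ultimately show ?thesis
      unfolding \<eta>_def by (rule tendsto_lowerbound) simp
  qed
  have g'_nz: "deriv g (z k) \<noteq> 0" if k: "k \<in> I" for k
  proof -
    have "0 < m * W (z k) / (1 - cmod (z k))" using m W0[of "z k"] zD[OF k] by simp
    then show ?thesis using g'_ge[OF k] by auto
  qed
  define w where "w = (\<lambda>k. - deriv (deriv g) (z k) / (2 * deriv g (z k)))"
  define a where "a = (\<lambda>k. w k / deriv g (z k))"
  define Ca where "Ca = 4 * M / m\<^sup>2"
  have Ca: "Ca > 0" using M m by (simp add: Ca_def)
  have a_le: "cmod (a k) \<le> Ca / W (z k)" if k: "k \<in> I" for k
  proof -
    define \<eta> where "\<eta> = 1 - cmod (z k)"
    have \<eta>: "\<eta> > 0" using zD[OF k] by (simp add: \<eta>_def)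
    have lo: "(m * W (z k) / \<eta>)\<^sup>2 \<le> (cmod (deriv g (z k)))\<^sup>2"
      using g'_ge[OF k] m W0[of "z k"] \<eta> by (intro power_mono) (auto simp: \<eta>_def)
    have "cmod (a k) = cmod (deriv (deriv g) (z k)) / (2 * (cmod (deriv g (z k)))\<^sup>2)"
      by (simp add: a_def w_def norm_divide norm_mult power2_eq_square)
    also have "\<dots> \<le> (8 * (M * W (z k)) / \<eta>\<^sup>2) / (2 * (m * W (z k) / \<eta>)\<^sup>2)"
    proof (intro frac_le mult_left_mono)
      show "cmod (deriv (deriv g) (z k)) \<le> 8 * (M * W (z k)) / \<eta>\<^sup>2"
        unfolding \<eta>_def by (rule g''_le[OF zD[OF k]])
      show "(m * W (z k) / \<eta>)\<^sup>2 \<le> (cmod (deriv g (z k)))\<^sup>2" by (rule lo)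
      have "0 < m * W (z k) / \<eta>" using m W0[of "z k"] \<eta> by simp
      then show "0 < 2 * (m * W (z k) / \<eta>)\<^sup>2" by (metis mult_pos_pos zero_less_numeral zero_less_power)
    qed (use M W0[of "z k"] in \<open>auto simp: less_imp_le\<close>)
    also have "\<dots> = Ca / W (z k)"
      using W0[of "z k"] m \<eta> by (simp add: Ca_def field_simps power2_eq_square)
    finally show ?thesis .
  qed
  define Q where "Q = (\<lambda>k x. if x = z k then deriv g (z k) else (g x - g (z k)) / (x - z k))"
  have hol_Q: "Q k holomorphic_on ball 0 1" for k
    unfolding Q_def by (rule pole_lemma_open[OF hol_g open_ball])
  \<comment> \<open>Away from \<open>z k\<close> the factor \<open>|x - z_k|\<close> cancels against
    the pseudo-hyperbolic distance in the upper bound of the product. At \<open>z k\<close> the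
    bound for \<open>g'\<close> takes over, and \<open>4 * M\<close> covers both cases.\<close>
  have Q_le: "cmod (Q k x) \<le> 4 * M * W x / cmod (1 - cnj (z k) * x)" if k: "k \<in> I" and x: "cmod x < 1" for k x
  proof (cases "x = z k")
    case True
    have "cmod (1 - cnj (z k) * z k) = 1 - (cmod (z k))\<^sup>2"
    proof -
      have "1 - cnj (z k) * z k = of_real (1 - (cmod (z k))\<^sup>2)"
        by (simp only: of_real_diff of_real_1 complex_norm_square mult.commute)
      then show ?thesis using one_minus_cmod_sq_pos[OF zD[OF k]] by (simp only: norm_of_real)
    qed
    then have y: "cmod (1 - cnj (z k) * z k) \<le> 2 * (1 - cmod (z k))" "cmod (1 - cnj (z k) * z k) > 0"
      using one_minus_sq_bounds(2)[of "cmod (z k)"] zD[OF k] one_minus_cmod_sq_pos[OF zD[OF k]] by auto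
    have "cmod (Q k x) \<le> 2 * (M * W (z k)) / (1 - cmod (z k))"
      using g'_le[OF zD[OF k]] True by (simp add: Q_def)
    also have "\<dots> = 4 * M * W (z k) / (2 * (1 - cmod (z k)))"
    proof -
      have "2 * (M * v) / d = 4 * M * v / (2 * d)" for v d :: real by simp
      then show ?thesis by (simp only:)
    qed
    also have "\<dots> \<le> 4 * M * W (z k) / cmod (1 - cnj (z k) * z k)"
      using y M W0[of "z k"] zD[OF k] by (intro divide_left_mono mult_pos_pos) auto
    finally show ?thesis using True by simp
  next
    case False
    have y: "cmod (1 - cnj (z k) * x) > 0" by (rule cmod_one_minus_cnj_mult_pos[OF zD[OF k] x])
    have "cmod (Q k x) = cmod (g x) / cmod (x - z k)"
      using False gz[OF k] by (simp add: Q_def norm_divide)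
    also have "\<dots> \<le> (C * pseudohyp x (z k) * W x) / cmod (x - z k)"
      by (intro divide_right_mono upk x k) simp
    also have "\<dots> = C * W x / cmod (1 - cnj (z k) * x)"
      using False cmod_one_minus_cnj_mult_commute[of x "z k"] by (simp add: pseudohyp_def)
    also have "\<dots> \<le> 4 * M * W x / cmod (1 - cnj (z k) * x)"
    proof (intro divide_right_mono mult_right_mono)
      have "exp 0 \<le> exp weight_osc" by (simp add: weight_osc_def)
      then have "C * 1 \<le> M" unfolding M_def using cC by (intro mult_left_mono) auto
      then show "C \<le> 4 * M" using cC by simp
    qed (use W0[of x] in auto)
    finally show ?thesis .
  qed
  \<comment> \<open>The squared fraction equals 1 at \<open>z k\<close>. It supplies the factor
    \<open>(1 - |z_k|)\<^sup>2\<close> and two further powers of \<open>1 - cnj z_k x\<close> in the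
    denominator.\<close>
  define T where "T = (\<lambda>k x. if k \<in> I then a k * Q k x * (of_real (1 - (cmod (z k))\<^sup>2) / (1 - cnj (z k) * x))\<^sup>2 else 0)"
  have hol_T: "T k holomorphic_on ball 0 1" for k
  proof (cases "k \<in> I")
    case True
    then show ?thesis
      using one_minus_cnj_mult_nonzero[OF zD[OF True]] unfolding T_def by (auto intro!: holomorphic_intros hol_Q)
  qed (simp add: T_def)
  define B where "B = 16 * Ca * M * exp C0"
  have B: "B > 0" using Ca M by (simp add: B_def)
  \<comment> \<open>The quotient of the weights at \<open>x\<close> and \<open>z k\<close> costs
    \<open>|1 - cnj z_k x| powr q\<close>, which lowers the exponent in the denominator from 3 to
    \<open>3 - q\<close>.\<close>
  have T_le: "cmod (T k x) \<le> B * (1 - cmod x) powr (- q) * ((1 - cmod (z k)) powr 2 / cmod (1 - cnj (z k) * x) powr (3 - q))"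
    if k: "k \<in> I" and x: "cmod x < 1" for k x
  proof -
    define y where "y = cmod (1 - cnj (z k) * x)"
    have y: "y > 0" unfolding y_def by (rule cmod_one_minus_cnj_mult_pos[OF zD[OF k] x])
    have "cmod (of_real (1 - (cmod (z k))\<^sup>2) / (1 - cnj (z k) * x)) \<le> 2 * (1 - cmod (z k)) / y"
      unfolding norm_divide norm_of_real y_def[symmetric]
      using one_minus_sq_bounds(2)[of "cmod (z k)"] one_minus_cmod_sq_pos[OF zD[OF k]] zD[OF k] y
      by (intro divide_right_mono) auto
    then have sq: "(cmod (of_real (1 - (cmod (z k))\<^sup>2) / (1 - cnj (z k) * x)))\<^sup>2 \<le> (2 * (1 - cmod (z k)) / y)\<^sup>2"
      by (intro power_mono) auto
    have "cmod (T k x) = cmod (a k) * cmod (Q k x) * (cmod (of_real (1 - (cmod (z k))\<^sup>2) / (1 - cnj (z k) * x)))\<^sup>2"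
      using k by (simp add: T_def norm_mult norm_power)
    also have "\<dots> \<le> (Ca / W (z k)) * (4 * M * W x / y) * (2 * (1 - cmod (z k)) / y)\<^sup>2"
      using a_le[OF k] Q_le[OF k x] sq Ca W0 M y by (intro mult_mono) (auto simp: y_def less_imp_le)
    also have "\<dots> = 16 * Ca * M * (W x / W (z k)) * ((1 - cmod (z k))\<^sup>2 / y ^ 3)"
    proof -
      have "(c1 / v) * (4 * c2 * u / y) * (2 * d / y)\<^sup>2 = 16 * c1 * c2 * (u / v) * (d\<^sup>2 / y ^ 3)" for c1 c2 u v d :: real
        by (simp add: power2_eq_square power3_eq_cube)
      then show ?thesis by (simp only:)
    qed
    also have "\<dots> \<le> 16 * Ca * M * (exp C0 * (y powr q * (1 - cmod x) powr (- q))) * ((1 - cmod (z k))\<^sup>2 / y ^ 3)"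
    proof (intro mult_right_mono mult_left_mono)
      have "W x \<le> exp C0 * W (z k) * (y powr q * (1 - cmod x) powr (- q))"
        using weight_quotient[OF x zD[OF k]] by (simp add: W_def y_def)
      then show "W x / W (z k) \<le> exp C0 * (y powr q * (1 - cmod x) powr (- q))"
        using W0[of "z k"] by (simp add: divide_le_eq mult_ac)
    qed (use Ca M y in auto)
    also have "\<dots> = B * (1 - cmod x) powr (- q) * ((1 - cmod (z k)) powr 2 / y powr (3 - q))"
      using y zD[OF k] by (simp add: B_def powr_diff mult_ac)
    finally show ?thesis by (simp add: y_def)
  qed
  define H where "H = (\<lambda>x. \<Sum>k. T k x)"
  have ulim: "uniform_limit (cball 0 \<rho>) (\<lambda>N x. \<Sum>k<N. T k x) H sequentially" if \<rho>: "\<rho> < 1" for \<rho>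
    unfolding H_def
  proof (rule Weierstrass_m_test)
    define D where "D = B * (1 - \<rho>) powr (- q) * (1 - \<rho>) powr (q - 3)"
    show "summable (\<lambda>k. D * (if k \<in> I then (1 - cmod (z k))\<^sup>2 else 0))"
      by (intro summable_mult summable_one_minus_sq)
    fix k x assume "x \<in> cball (0::complex) \<rho>"
    then have x: "cmod x \<le> \<rho>" "cmod x < 1" using \<rho> by auto
    show "norm (T k x) \<le> D * (if k \<in> I then (1 - cmod (z k))\<^sup>2 else 0)"
    proof (cases "k \<in> I")
      case True
      define y where "y = cmod (1 - cnj (z k) * x)"
      have y: "1 - \<rho> \<le> y" using cmod_one_minus_cnj_mult_ge(2)[of "z k" x] zD[OF True] x by (auto simp: y_def)
      have "cmod (T k x) \<le> B * (1 - cmod x) powr (- q) * ((1 - cmod (z k)) powr 2 / y powr (3 - q))"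
        unfolding y_def by (rule T_le[OF True x(2)])
      also have "\<dots> = B * (1 - cmod x) powr (- q) * ((1 - cmod (z k)) powr 2 * y powr (q - 3))"
        using powr_minus[of y "3 - q"] by (simp add: divide_inverse)
      also have "\<dots> \<le> B * (1 - \<rho>) powr (- q) * ((1 - cmod (z k)) powr 2 * (1 - \<rho>) powr (q - 3))"
        using B x q y \<rho> by (intro mult_mono mult_left_mono powr_mono2') auto
      also have "\<dots> = D * (1 - cmod (z k))\<^sup>2" using zD[OF True] by (simp add: D_def)
      finally show ?thesis using True by simp
    qed (simp add: T_def)
  qed
  have hol_H: "H holomorphic_on ball 0 1"
  proof (rule holomorphic_uniform_sequence)
    show "(\<lambda>x. \<Sum>k<N. T k x) holomorphic_on ball 0 1" for N
      by (intro holomorphic_on_sum hol_T)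
    fix x :: complex assume "x \<in> ball 0 1"
    then have x: "cmod x < 1" by simp
    define d where "d = (1 - cmod x) / 2"
    have sub: "cball x d \<subseteq> cball 0 (1 - d)"
    proof
      fix y assume "y \<in> cball x d"
      then have "cmod y \<le> cmod x + d"
        using norm_triangle_sub[of y x] by (simp add: dist_norm norm_minus_commute)
      then show "y \<in> cball 0 (1 - d)" using x by (simp add: d_def field_simps)
    qed
    have d: "d > 0" using x by (simp add: d_def)
    have "uniform_limit (cball x d) (\<lambda>N x. \<Sum>k<N. T k x) H sequentially"
      using ulim[of "1 - d"] d sub by (intro uniform_limit_on_subset[OF _ sub]) auto
    moreover have "cball x d \<subseteq> ball 0 1" using sub d by force
    ultimately show "\<exists>d>0. cball x d \<subseteq> ball 0 1 \<and> uniform_limit (cball x d) (\<lambda>N x. \<Sum>k<N. T k x) H sequentially"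
      using d by blast
  qed simp
  have H_z: "H (z k) = w k" if k: "k \<in> I" for k
  proof -
    have "T n (z k) = (if n = k then w k else 0)" for n
    proof (cases "n \<in> I")
      case True
      show ?thesis
      proof (cases "n = k")
        case nk: True
        have "1 - cnj (z k) * z k = of_real (1 - (cmod (z k))\<^sup>2)"
          by (simp only: of_real_diff of_real_1 complex_norm_square mult.commute)
        moreover have "1 - (cmod (z k))\<^sup>2 \<noteq> 0" using one_minus_cmod_sq_pos[OF zD[OF k]] by simp
        ultimately have "of_real (1 - (cmod (z k))\<^sup>2) / (1 - cnj (z k) * z k) = 1"
          by (simp only: of_real_eq_0_iff divide_self_if) simp
        then show ?thesis using nk k g'_nz[OF k] by (simp add: T_def Q_def a_def)
      next
        case False
        have "z n \<noteq> z k"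
          using far[OF True k False] pseudohyp_eq_0_iff[OF zD[OF True] zD[OF k]] \<delta> by auto
        then show ?thesis using False True gz[OF k] gz[OF True] by (simp add: T_def Q_def)
      qed
    qed (use k in \<open>auto simp: T_def\<close>)
    then have "H (z k) = (\<Sum>n. if n = k then w k else 0)" by (simp add: H_def)
    also have "\<dots> = w k" using sums_single[of k "\<lambda>_. w k"] by (rule sums_unique[symmetric])
    finally show ?thesis .
  qed
  \<comment> \<open>Here \<open>q < 1\<close> is decisive: the kernel estimate requires
    \<open>3 - q > 2\<close>. The powers of \<open>1 - |x|\<close> then combine to
    \<open>-q + (q - 1) = -1\<close>.\<close>
  obtain CS where CS: "CS > 0" "\<forall>w F. cmod w < 1 \<longrightarrow> finite F \<longrightarrow> F \<subseteq> I \<longrightarrow>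
     (\<Sum>n\<in>F. (1 - cmod (z n)) powr 2 / cmod (1 - cnj (z n) * w) powr (3 - q)) \<le> CS * (1 - cmod w) powr (2 - (3 - q))"
    using sum_kernel_le'[of 2 "3 - q"] q by auto
  define CH where "CH = B * CS"
  have CH: "CH > 0" using B CS by (simp add: CH_def)
  have H_le: "cmod (H x) \<le> CH / (1 - cmod x)" if x: "cmod x < 1" for x
  proof (rule LIMSEQ_le_const2)
    show "(\<lambda>N. cmod (\<Sum>k<N. T k x)) \<longlonglongrightarrow> cmod (H x)"
      using tendsto_uniform_limitI[OF ulim[OF x], of x] by (intro tendsto_norm) simp
    have "cmod (\<Sum>k<N. T k x) \<le> CH / (1 - cmod x)" for N
    proof -
      define F where "F = I \<inter> {..<N}"
      have F: "finite F" "F \<subseteq> I" by (auto simp: F_def)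
      have "(\<Sum>k<N. T k x) = (\<Sum>k\<in>F. T k x)"
        unfolding F_def by (intro sum.mono_neutral_right) (auto simp: T_def)
      then have "cmod (\<Sum>k<N. T k x) \<le> (\<Sum>k\<in>F. cmod (T k x))" by (simp add: norm_sum)
      also have "\<dots> \<le> (\<Sum>k\<in>F. B * (1 - cmod x) powr (- q) * ((1 - cmod (z k)) powr 2 / cmod (1 - cnj (z k) * x) powr (3 - q)))"
        using F x by (intro sum_mono T_le) auto
      also have "\<dots> = B * (1 - cmod x) powr (- q) * (\<Sum>k\<in>F. (1 - cmod (z k)) powr 2 / cmod (1 - cnj (z k) * x) powr (3 - q))"
        by (simp add: sum_distrib_left)
      also have "\<dots> \<le> B * (1 - cmod x) powr (- q) * (CS * (1 - cmod x) powr (2 - (3 - q)))"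
        using B by (intro mult_left_mono CS(2)[rule_format, OF x F]) auto
      also have "\<dots> = CH * ((1 - cmod x) powr (- q) * (1 - cmod x) powr (q - 1))"
        by (simp add: CH_def mult_ac)
      also have "(1 - cmod x) powr (- q) * (1 - cmod x) powr (q - 1) = (1 - cmod x) powr (-1)"
        by (simp flip: powr_add)
      also have "\<dots> = 1 / (1 - cmod x)" using x by (simp add: powr_minus divide_inverse)
      finally show ?thesis by simp
    qed
    then show "\<exists>N. \<forall>n\<ge>N. cmod (\<Sum>k<n. T k x) \<le> CH / (1 - cmod x)" by blast
  qed
  have H'_le: "cmod (deriv H x) \<le> 4 * CH / (1 - cmod x)\<^sup>2" if x: "cmod x < 1" for x
  proof -
    have "cmod (deriv H x) \<le> 2 * (2 * CH / (1 - cmod x)) / (1 - cmod x)"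
    proof (rule Cauchy_bound_half(1)[OF hol_H x])
      fix y assume y: "cmod (y - x) \<le> (1 - cmod x) / 2"
      note n = cmod_one_minus_near[OF x y]
      have "cmod (H y) \<le> CH / (1 - cmod y)" by (rule H_le[OF n(1)])
      also have "\<dots> \<le> CH / ((1 - cmod x) / 2)"
        using n x CH by (intro divide_left_mono mult_pos_pos) auto
      finally show "cmod (H y) \<le> 2 * CH / (1 - cmod x)" by (simp add: mult.commute)
    qed
    then show ?thesis by (simp add: power2_eq_square)
  qed
  \<comment> \<open>\<open>H\<close> is the function \<open>h'\<close> of the overview. Its values
    at the zeros were chosen to make \<open>P\<close> vanish there.\<close>
  define P where "P = (\<lambda>x. deriv (deriv g) x + 2 * deriv g x * H x)"
  have hol_P: "P holomorphic_on ball 0 1"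
    unfolding P_def by (intro holomorphic_intros hol_g' hol_g'' hol_H)
  define A0 where "A0 = (\<lambda>x. if g x = 0 then deriv P x / deriv g x else P x / g x)"
  have P_z: "P (z k) = 0" if "k \<in> I" for k
    using g'_nz[OF that] H_z[OF that] by (simp add: P_def w_def)
  have hol_A0: "A0 holomorphic_on ball 0 1"
    unfolding A0_def
  proof (rule holomorphic_quotient_at_simple_zeros[OF open_ball hol_P hol_g])
    fix x assume "x \<in> ball 0 1" "g x = 0"
    then obtain k where "k \<in> I" "x = z k" using zero[of x] by auto
    then show "P x = 0 \<and> deriv g x \<noteq> 0" using P_z g'_nz by simp
  qed
  have A0_eq: "A0 x * g x = P x" if "cmod x < 1" for x
    using zero[OF that] P_z by (auto simp: A0_def)
  define C5 where "C5 = (8 * M + 4 * M * CH) / (c * e)"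
  have C5: "C5 > 0" using M CH cC e by (auto simp: C5_def intro!: divide_pos_pos add_pos_pos)
  have good: "cmod (A0 x) \<le> C5 / (1 - cmod x)\<^sup>2" if x: "cmod x < 1" and far': "\<forall>n\<in>I. e \<le> pseudohyp x (z n)" for x
  proof -
    define \<eta> where "\<eta> = 1 - cmod x"
    have \<eta>: "\<eta> > 0" using x by (simp add: \<eta>_def)
    \<comment> \<open>With all zeros at distance at least \<open>e\<close>, the exceptional index is
      arbitrary and 0 will do; \<open>e \<le> 1\<close> covers the case that 0 is not in
      \<open>I\<close>.\<close>
    have "c * e * W x \<le> c * (if 0 \<in> I then pseudohyp x (z 0) else 1) * W x"
      using far' e cC W0[of x] by (intro mult_right_mono mult_left_mono) auto
    also have "\<dots> \<le> cmod (g x)" using low0 x far' by blast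
    finally have gx: "c * e * W x \<le> cmod (g x)" .
    have ceW: "0 < c * e * W x" using cC e W0[of x] by simp
    have "cmod (P x) \<le> cmod (deriv (deriv g) x) + cmod (2 * deriv g x * H x)"
      unfolding P_def by (rule norm_triangle_ineq)
    also have "cmod (2 * deriv g x * H x) = 2 * (cmod (deriv g x) * cmod (H x))"
      by (simp add: norm_mult)
    also have "cmod (deriv (deriv g) x) + 2 * (cmod (deriv g x) * cmod (H x)) \<le>
        8 * (M * W x) / \<eta>\<^sup>2 + 2 * (2 * (M * W x) / \<eta> * (CH / \<eta>))"
      using g''_le[OF x] g'_le[OF x] H_le[OF x] M W0[of x] \<eta> unfolding \<eta>_def[symmetric]
      by (intro add_mono mult_left_mono mult_mono) auto
    also have "\<dots> = (8 * M + 4 * M * CH) * W x / \<eta>\<^sup>2"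
    proof -
      have "2 * (2 * (M * W x) / \<eta> * (CH / \<eta>)) = 4 * M * CH * W x / \<eta>\<^sup>2"
        by (simp add: power2_eq_square)
      moreover have "8 * (M * W x) = 8 * M * W x" by simp
      ultimately show ?thesis by (simp only: distrib_right add_divide_distrib)
    qed
    finally have Px: "cmod (P x) \<le> (8 * M + 4 * M * CH) * W x / \<eta>\<^sup>2" .
    have "g x \<noteq> 0" using gx ceW by auto
    then have "cmod (A0 x) = cmod (P x) / cmod (g x)" by (simp add: A0_def norm_divide)
    also have "\<dots> \<le> ((8 * M + 4 * M * CH) * W x / \<eta>\<^sup>2) / (c * e * W x)"
      using Px gx ceW M CH W0[of x] \<eta> by (intro frac_le) auto
    also have "\<dots> = C5 / \<eta>\<^sup>2" using W0[of x] by (simp add: C5_def)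
    finally show ?thesis by (simp add: \<eta>_def)
  qed
  \<comment> \<open>The direct bound for \<open>P / g\<close> fails close to a zero. There the
    estimate is carried over from a circle avoiding all zeros, by the Cauchy inequality of order 0,
    that is, the maximum principle.\<close>
  have A0_le: "cmod (A0 x) \<le> 4 * C5 / (1 - cmod x)\<^sup>2" if x: "cmod x < 1" for x
  proof (cases "\<forall>n\<in>I. e \<le> pseudohyp x (z n)")
    case True
    have "C5 / (1 - cmod x)\<^sup>2 \<le> 4 * C5 / (1 - cmod x)\<^sup>2"
      using C5 by (intro divide_right_mono) auto
    then show ?thesis using good[OF x True] by linarith
  next
    case False
    then obtain k where k: "k \<in> I" "pseudohyp x (z k) < e" by (auto simp: not_le)
    define \<eta> where "\<eta> = 1 - cmod x"
    have \<eta>: "\<eta> > 0" using x by (simp add: \<eta>_def)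
    define R where "R = \<delta> / 4 * \<eta>"
    have R: "0 < R" "R \<le> \<eta> / 4"
      using \<delta> \<eta> mult_right_mono[of "\<delta> / 4" "1 / 4" \<eta>] by (auto simp: R_def)
    have sub: "cball x R \<subseteq> ball 0 1"
    proof
      fix y assume "y \<in> cball x R"
      then have "cmod (y - x) \<le> (1 - cmod x) / 2"
        using R by (simp add: dist_norm norm_minus_commute \<eta>_def)
      then show "y \<in> ball 0 1" using cmod_one_minus_near(1)[OF x] by simp
    qed
    have "cmod ((deriv ^^ 0) A0 x) \<le> fact 0 * (4 * C5 / \<eta>\<^sup>2) / R ^ 0"
    proof (rule Cauchy_inequality)
      show "A0 holomorphic_on ball x R" "continuous_on (cball x R) A0"
        using hol_A0 sub ball_subset_cball[of x R]
        by (blast intro: holomorphic_on_subset continuous_on_subset holomorphic_on_imp_continuous_on)+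
      fix y assume y: "cmod (x - y) = R"
      then have d: "cmod (y - x) \<le> (1 - cmod x) / 2" using R by (simp add: norm_minus_commute \<eta>_def)
      note n = cmod_one_minus_near[OF x d]
      define t where "t = cmod (1 - cnj y * x)"
      have t: "\<eta> \<le> t" "t \<le> 3 * \<eta>"
      proof -
        show "\<eta> \<le> t"
          unfolding t_def \<eta>_def using n(1) x by (intro cmod_one_minus_cnj_mult_ge(2)) auto
        have "t \<le> 5 / 2 * \<eta>"
          unfolding t_def \<eta>_def cmod_one_minus_cnj_mult_commute[of y x] by (rule n(4))
        then show "t \<le> 3 * \<eta>" using \<eta> by simp
      qed
      have yx: "pseudohyp y x = R / t" using y by (simp add: pseudohyp_def t_def norm_minus_commute)
      have "R / (3 * \<eta>) \<le> R / t" "R / t \<le> R / \<eta>"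
        using t R \<eta> by (auto intro!: divide_left_mono mult_pos_pos)
      then have ps: "\<delta> / 12 \<le> pseudohyp y x" "pseudohyp y x \<le> \<delta> / 4"
        using \<eta> by (auto simp: yx R_def)
      have "e \<le> pseudohyp y (z j)" if j: "j \<in> I" for j
      proof (cases "j = k")
        case True
        have "pseudohyp y x \<le> pseudohyp y (z k) + pseudohyp (z k) x"
          by (rule pseudohyp_triangle[OF n(1) x zD[OF k(1)]])
        then show ?thesis using ps k(2) True by (simp add: e_def pseudohyp_commute[of "z k"])
      next
        case False
        have "\<delta> < pseudohyp (z j) (z k)" by (rule far[OF j k(1) False])
        also have "\<dots> \<le> pseudohyp (z j) y + pseudohyp y (z k)"
          by (rule pseudohyp_triangle[OF zD[OF j] zD[OF k(1)] n(1)])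
        also have "pseudohyp y (z k) \<le> pseudohyp y x + pseudohyp x (z k)"
          by (rule pseudohyp_triangle[OF n(1) zD[OF k(1)] x])
        finally show ?thesis using ps k(2) \<delta> by (simp add: e_def pseudohyp_commute[of "z j"])
      qed
      then have "cmod (A0 y) \<le> C5 / (1 - cmod y)\<^sup>2" by (intro good n(1)) auto
      also have "\<dots> \<le> C5 / (\<eta> / 2)\<^sup>2"
        using n \<eta> C5 by (intro divide_left_mono power_mono mult_pos_pos zero_less_power) (auto simp: \<eta>_def)
      finally show "cmod (A0 y) \<le> 4 * C5 / \<eta>\<^sup>2" by (simp add: power_divide mult.commute)
    qed (use R in auto)
    then show ?thesis by (simp add: \<eta>_def)
  qed
  \<comment> \<open>For \<open>f = g exp h\<close> with \<open>h' = H\<close>, division by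
    \<open>f\<close> gives \<open>f'' / f = (g'' + 2 g' H) / g + H' + H\<^sup>2\<close>.\<close>
  define A where "A = (\<lambda>x. - A0 x - deriv H x - (H x)\<^sup>2)"
  have hol_H': "deriv H holomorphic_on ball 0 1" by (intro holomorphic_deriv hol_H open_ball)
  have "A holomorphic_on ball 0 1"
    unfolding A_def by (intro holomorphic_intros hol_A0 hol_H' hol_H)
  moreover have "(1 - (cmod x)\<^sup>2)\<^sup>2 * cmod (A x) \<le> 4 * (4 * C5 + 4 * CH + CH\<^sup>2)" if "x \<in> ball 0 1" for x
  proof -
    have x: "cmod x < 1" using that by simp
    define \<eta> where "\<eta> = 1 - cmod x"
    have \<eta>: "\<eta> > 0" using x by (simp add: \<eta>_def)
    have "cmod (A x) \<le> cmod (A0 x) + cmod (deriv H x) + cmod ((H x)\<^sup>2)"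
      unfolding A_def using norm_triangle_ineq4[of "- A0 x - deriv H x" "(H x)\<^sup>2"] norm_triangle_ineq4[of "- A0 x" "deriv H x"]
      by simp
    also have "cmod ((H x)\<^sup>2) = (cmod (H x))\<^sup>2" by (rule norm_power)
    also have "cmod (A0 x) + cmod (deriv H x) + (cmod (H x))\<^sup>2 \<le> 4 * C5 / \<eta>\<^sup>2 + 4 * CH / \<eta>\<^sup>2 + (CH / \<eta>)\<^sup>2"
      using A0_le[OF x] H'_le[OF x] H_le[OF x] unfolding \<eta>_def by (intro add_mono power_mono) auto
    also have "\<dots> = (4 * C5 + 4 * CH + CH\<^sup>2) / \<eta>\<^sup>2"
      by (simp add: power_divide add_divide_distrib)
    finally have A_le: "cmod (A x) \<le> (4 * C5 + 4 * CH + CH\<^sup>2) / \<eta>\<^sup>2" .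
    have "(1 - (cmod x)\<^sup>2)\<^sup>2 \<le> (2 * \<eta>)\<^sup>2"
      using one_minus_sq_bounds(2)[of "cmod x"] x one_minus_cmod_sq_pos[OF x] unfolding \<eta>_def by (intro power_mono) auto
    then have "(1 - (cmod x)\<^sup>2)\<^sup>2 * cmod (A x) \<le> (2 * \<eta>)\<^sup>2 * ((4 * C5 + 4 * CH + CH\<^sup>2) / \<eta>\<^sup>2)"
      using A_le by (intro mult_mono) auto
    also have "\<dots> = 4 * (4 * C5 + 4 * CH + CH\<^sup>2)"
      using \<eta> by (simp add: power_mult_distrib)
    finally show ?thesis .
  qed
  ultimately have "A \<in> Hinf2"
    unfolding Hinf2_def bdd_above_def by blast
  moreover obtain h where h: "\<And>x. x \<in> ball 0 1 \<Longrightarrow> (h has_field_derivative H x) (at x within ball 0 1)"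
    using holomorphic_convex_primitive'[OF convex_ball open_ball hol_H] by blast
  define f where "f = (\<lambda>x. g x * exp (h x))"
  have dh: "(h has_field_derivative H x) (at x)" if "x \<in> ball 0 1" for x
    using h[OF that] unfolding at_within_open[OF that open_ball] .
  have dg: "(g has_field_derivative deriv g x) (at x)" "(deriv g has_field_derivative deriv (deriv g) x) (at x)"
    "(H has_field_derivative deriv H x) (at x)" if "x \<in> ball 0 1" for x
    using that by (auto intro!: holomorphic_derivI[OF hol_g] holomorphic_derivI[OF hol_g'] holomorphic_derivI[OF hol_H])
  have df: "(f has_field_derivative (deriv g x + g x * H x) * exp (h x)) (at x)" if x: "x \<in> ball 0 1" for x
    unfolding f_def by (rule derivative_eq_intros dg[OF x] dh[OF x] refl)+ (simp add: algebra_simps)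
  have ddf: "((\<lambda>x. (deriv g x + g x * H x) * exp (h x)) has_field_derivative
      (deriv (deriv g) x + 2 * deriv g x * H x + g x * deriv H x + g x * (H x)\<^sup>2) * exp (h x)) (at x)"
    if x: "x \<in> ball 0 1" for x
    by (rule derivative_eq_intros dg[OF x] dh[OF x] refl)+ (simp add: algebra_simps power2_eq_square)
  have deriv_f: "deriv f x = (deriv g x + g x * H x) * exp (h x)" if "x \<in> ball 0 1" for x
    by (rule DERIV_imp_deriv[OF df[OF that]])
  have dderiv_f: "deriv (deriv f) x = (P x + g x * deriv H x + g x * (H x)\<^sup>2) * exp (h x)" if x: "x \<in> ball 0 1" for x
    unfolding P_def
    by (intro DERIV_imp_deriv has_field_derivative_transform_within_open[OF ddf[OF x] open_ball x]) (simp add: deriv_f)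
  have "nontrivial_solution A f"
    unfolding nontrivial_solution_def
  proof (intro conjI ballI)
    show "f holomorphic_on ball 0 1"
      unfolding holomorphic_on_open[OF open_ball] using df by blast
    fix x :: complex assume x: "x \<in> ball 0 1"
    have "P x = A0 x * g x" using A0_eq[of x] x by simp
    then show "deriv (deriv f) x + A x * f x = 0"
      unfolding dderiv_f[OF x] by (simp add: A_def f_def algebra_simps)
  next
    \<comment> \<open>If \<open>f\<close> vanished identically, so would \<open>g\<close>; its zeros
      in the disc, however, are terms of the sequence and thus countable.\<close>
    show "\<exists>x\<in>ball 0 1. f x \<noteq> 0"
    proof (rule ccontr)
      assume "\<not> ?thesis"
      then have "g x = 0" if "x \<in> ball 0 1" for x using that by (auto simp: f_def)
      then have "ball 0 1 \<subseteq> z ` I" using zero by force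
      then have "countable (ball (0::complex) 1)" by (rule countable_subset) simp
      then show False using uncountable_ball[of 1 "0::complex"] by simp
    qed
  qed
  moreover have "f (z n) = 0" if "n \<in> I" for n
    using gz[OF that] by (simp add: f_def)
  ultimately show ?thesis by blast
qed

end

section \<open>From the density condition to a solution\<close>

lemma density_less_one_thin:
  assumes sep: "separated I z" and D: "upper_density I z < 1"
  shows "\<exists>p r0. thin_sequence I z p r0"
proof -
  have z: "z ` I \<subseteq> ball 0 1" using sep by (simp add: separated_def)
  obtain p where p: "upper_density I z < p" "p < 1" using dense[OF D] by blast
  then obtain p' where p': "p = ennreal p'" "0 \<le> p'"
    by (cases p) auto
  have "0 < p" using p(1) by (rule le_less_trans[rotated]) simp
  then have p'01: "0 < p'" "p' < 1" using p(2) p' by auto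
  have "eventually (\<lambda>r::real. (SUP \<zeta>\<in>ball 0 1. \<integral>\<^sup>+ s\<in>{0..r}. disc_count I z \<zeta> s \<partial>lborel) / ennreal (ln (1 / (1 - r))) < p) (at_left 1)"
    using p(1) unfolding upper_density_def by (rule Limsup_lessD)
  then obtain b where b: "b < 1" "\<forall>r. b < r \<longrightarrow> r < 1 \<longrightarrow>
      (SUP \<zeta>\<in>ball 0 1. \<integral>\<^sup>+ s\<in>{0..r}. disc_count I z \<zeta> s \<partial>lborel) / ennreal (ln (1 / (1 - r))) < p"
    by (auto simp: eventually_at_left_field)
  \<comment> \<open>The lower bound 1/2 keeps \<open>r0\<close> positive and makes the logarithm
    positive for all \<open>r > r0\<close>, so that the denominator can be cleared.\<close>
  define r0 where "r0 = max b (1 / 2)"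
  have "thin_sequence I z p' r0"
  proof
    show "cmod (z n) < 1" if "n \<in> I" for n using z that by auto
    show "0 < p'" "p' < 1" "0 < r0" "r0 < 1" using p'01 b(1) by (auto simp: r0_def)
    fix r \<zeta> F assume r: "r0 < r" "r < 1" and \<zeta>: "cmod \<zeta> < 1" and F: "finite F" "F \<subseteq> I"
    define X where "X = (SUP \<zeta>\<in>ball 0 1. \<integral>\<^sup>+ s\<in>{0..r}. disc_count I z \<zeta> s \<partial>lborel)"
    define l where "l = ln (1 / (1 - r))"
    have "1 < 1 / (1 - r)" using r by (simp add: r0_def)
    then have l: "l > 0" unfolding l_def by (rule ln_gt_zero)
    have "X / ennreal l < p" using b(2) r by (auto simp: X_def l_def r0_def)
    then have "X / ennreal l * ennreal l \<le> p * ennreal l" by (intro mult_right_mono) auto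
    also have "X / ennreal l * ennreal l = X" using l by (simp add: ennreal_divide_times)
    finally have X: "X \<le> ennreal (p' * l)" using l p' by (simp add: ennreal_mult)
    have "ennreal (\<Sum>n\<in>F. max 0 (r - pseudohyp (z n) \<zeta>)) = (\<Sum>n\<in>F. ennreal (max 0 (r - pseudohyp (z n) \<zeta>)))"
      by (intro sum_ennreal[symmetric]) simp
    also have "\<dots> = (\<Sum>n\<in>F. if n \<in> I then ennreal (r - pseudohyp (z n) \<zeta>) else 0)"
      using F by (intro sum.cong) (auto simp: max_def ennreal_neg)
    also have "\<dots> \<le> (\<Sum>n. if n \<in> I then ennreal (r - pseudohyp (z n) \<zeta>) else 0)"
      using F by (intro sum_le_suminf) auto
    also have "\<dots> = (\<integral>\<^sup>+ s\<in>{0..r}. disc_count I z \<zeta> s \<partial>lborel)"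
      by (rule nn_integral_disc_count[OF z, symmetric])
    also have "\<dots> \<le> X" unfolding X_def using \<zeta> by (intro SUP_upper) simp
    also note X
    finally show "(\<Sum>n\<in>F. max 0 (r - pseudohyp (z n) \<zeta>)) \<le> p' * ln (1 / (1 - r))"
      using l p'01 by (simp add: l_def)
  qed
  then show ?thesis by blast
qed

lemma separated_thin_vanishing:
  assumes sep: "separated I z" and D: "upper_density I z < 1"
  shows "\<exists>A\<in>Hinf2. \<exists>f. nontrivial_solution A f \<and> (\<forall>n\<in>I. f (z n) = 0)"
proof -
  obtain p r0 where "thin_sequence I z p r0"
    using density_less_one_thin[OF assms] by blast
  then interpret thin_sequence I z p r0 .
  obtain s q K C where s: "0 < q" "q < 1" "0 \<le> K" "\<forall>n\<in>I. 0 \<le> s n \<and> s n < 1 \<and> 1 - s n \<le> K * (1 - cmod (z n))"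
    "\<forall>x w F. cmod x < 1 \<longrightarrow> cmod w < 1 \<longrightarrow> finite F \<longrightarrow> F \<subseteq> I \<longrightarrow>
       (\<Sum>n\<in>F. swept (s n) (z n) x - swept (s n) (z n) w) \<le> q * ln (cmod (1 - cnj w * x) / (1 - cmod x)) + C"
    using sum_swept_diff_le by blast
  obtain \<delta> where \<delta>: "\<delta> > 0" "\<forall>n\<in>I. \<forall>k\<in>I. n \<noteq> k \<longrightarrow> pseudohyp (z n) (z k) > \<delta>"
    using sep by (auto simp: separated_def)
  \<comment> \<open>The minimum with 1 meets the normalisation \<open>\<delta> \<le> 1\<close> and
    keeps the strict separation.\<close>
  interpret swept_sequence I z p r0 s q K C "min \<delta> 1"
  proof
    show "min \<delta> 1 < pseudohyp (z n) (z k)" if "n \<in> I" "k \<in> I" "n \<noteq> k" for n k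
      using \<delta>(2) that by (auto simp: min_less_iff_disj)
  qed (use s \<delta> in auto)
  show ?thesis by (rule coefficient_exists)
qed

section \<open>Zero sequences of solutions\<close>

lemma zero_sequence_far:
  assumes A: "A \<in> Hinf2" and f: "nontrivial_solution A f" and zs: "zero_sequence f I z"
    and N: "N \<ge> 1" "N \<ge> Hinf2_norm A" and ij: "i \<in> I" "j \<in> I" "i \<noteq> j"
  shows "pseudohyp (z i) (z j) \<ge> 2 * sqrt N / (N + 1)"
proof -
  have holA: "A holomorphic_on ball 0 1"
    and bdd: "bdd_above ((\<lambda>z. (1 - (cmod z)\<^sup>2)\<^sup>2 * cmod (A z)) ` ball 0 1)"
    using A by (auto simp: Hinf2_def)
  have holf: "f holomorphic_on ball 0 1" and nz: "\<exists>z\<in>ball 0 1. f z \<noteq> 0"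
    using f by (auto simp: nontrivial_solution_def)
  have ode: "disc_ode N A f"
    unfolding disc_ode_def
  proof (intro conjI ballI)
    fix w :: complex assume "w \<in> ball 0 1"
    then have "(1 - (cmod w)\<^sup>2)\<^sup>2 * cmod (A w) \<le> Hinf2_norm A"
      unfolding Hinf2_norm_def using bdd by (intro cSUP_upper)
    then show "(1 - (cmod w)\<^sup>2)\<^sup>2 * cmod (A w) \<le> N" using N by linarith
  qed (use f in \<open>auto simp: nontrivial_solution_def\<close>)
  have z: "z k \<in> ball 0 1" if "k \<in> I" for k
    using zs that by (auto simp: zero_sequence_def)
  have card: "int (card {n\<in>I. z n = w}) = zorder f w" and fin: "finite {n\<in>I. z n = w}" if "w \<in> ball 0 1" for w
    using zs that unfolding zero_sequence_def by blast+
  have zero: "f (z k) = 0" if k: "k \<in> I" for k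
  proof (rule ccontr)
    assume "f (z k) \<noteq> 0"
    then have "zorder f (z k) = 0"
      using z[OF k] holf by (intro zorder_eq_0I) (auto simp: analytic_on_open intro: analytic_on_subset[of f "ball 0 1"])
    then have "{n\<in>I. z n = z k} = {}"
      using card[OF z[OF k]] fin[OF z[OF k]] by simp
    then show False using k by auto
  qed
  \<comment> \<open>Different indices could name the same zero if it were multiple. Zeros of a
    non-trivial solution are simple, so each is listed exactly once.\<close>
  have "z i \<noteq> z j"
  proof
    assume eq: "z i = z j"
    have "zorder f (z i) = 1"
    proof (rule zorder_zero_eqI'[where n = 1, simplified])
      show "f analytic_on {z i}"
        using z[OF ij(1)] holf by (auto simp: analytic_on_open intro: analytic_on_subset[of f "ball 0 1"])
      show "f (z i) = 0" by (rule zero[OF ij(1)])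
      show "deriv f (z i) \<noteq> 0"
        by (rule disc_ode_zero_simple[OF ode holA nz z[OF ij(1)] zero[OF ij(1)]])
    qed
    then have "card {n\<in>I. z n = z i} = 1"
      using card[OF z[OF ij(1)]] by simp
    then obtain k where "{n\<in>I. z n = z i} = {k}"
      by (auto simp: card_1_singleton_iff)
    moreover have "i \<in> {n\<in>I. z n = z i}" "j \<in> {n\<in>I. z n = z i}"
      using ij eq by simp_all
    ultimately show False using ij(3) by auto
  qed
  then show ?thesis
    using disc_ode_zeros_far[OF ode N(1) nz] z[OF ij(1)] z[OF ij(2)] zero[OF ij(1)] zero[OF ij(2)] by simp
qed

lemma zero_sequence_separated_and_density:
  assumes A: "A \<in> Hinf2" and f: "nontrivial_solution A f" and zs: "zero_sequence f I z"
  shows "separated I z" (is ?sep)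
    "Hinf2_norm A \<le> 1 \<Longrightarrow> finite I \<and> card I \<le> 1" (is "_ \<Longrightarrow> ?card")
    "Hinf2_norm A > 1 \<Longrightarrow> upper_density I z \<le> ennreal
       ((2 * pi + 1) * sqrt (1 - 2 * sqrt (Hinf2_norm A) / (Hinf2_norm A + 1))
         / (1 - sqrt (1 - 2 * sqrt (Hinf2_norm A) / (Hinf2_norm A + 1)))\<^sup>2)" (is "_ \<Longrightarrow> ?density")
proof -
  have z: "z ` I \<subseteq> ball 0 1"
    using zs by (simp add: zero_sequence_def)
  define N where "N = max 1 (Hinf2_norm A)"
  note far = zero_sequence_far[OF A f zs]
  have "2 * sqrt N / (N + 1) > 0"
    by (simp add: N_def add_pos_pos max_def)
  \<comment> \<open>Half of the available distance, since separation asks for a strict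
    inequality.\<close>
  then have "sqrt N / (N + 1) > 0" "sqrt N / (N + 1) < 2 * sqrt N / (N + 1)" by simp_all
  then show ?sep
    unfolding separated_def using z far[of N]
    by (intro conjI exI[of _ "sqrt N / (N + 1)"]) (auto simp: N_def intro: less_le_trans)
  show ?card if "Hinf2_norm A \<le> 1"
  proof -
    have "i = j" if "i \<in> I" "j \<in> I" for i j
    proof (rule ccontr)
      assume "i \<noteq> j"
      \<comment> \<open>For \<open>N = 1\<close> the guaranteed distance
        \<open>2 sqrt N / (N + 1)\<close> is 1, which no two points of the disc attain.\<close>
      then have "pseudohyp (z i) (z j) \<ge> 1"
        using far[of 1 i j] that \<open>Hinf2_norm A \<le> 1\<close> by simp
      moreover have "pseudohyp (z i) (z j) < 1"
        using z that by (intro pseudohyp_less_1) auto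
      ultimately show False by simp
    qed
    then have "I = {} \<or> (\<exists>i. I = {i})" by blast
    then show ?thesis by auto
  qed
  show ?density if N1: "Hinf2_norm A > 1"
  proof (rule upper_density_packing[OF z _ _ _ packing_constant_less[OF N1]])
    let ?q = "1 / sqrt (Hinf2_norm A)"
    show "0 < ?q" "?q < 1" using N1 by simp_all
    \<comment> \<open>The distance is invariant under \<open>x\<close> to \<open>1 / x\<close>, so
      the Sturm bound in \<open>sqrt N\<close> is exactly the separation needed for disjoint discs
      of radius \<open>1 / sqrt N\<close>.\<close>
    have "2 * ?q / (1 + ?q\<^sup>2) = 2 * sqrt (Hinf2_norm A) / (Hinf2_norm A + 1)"
    proof -
      define x where "x = sqrt (Hinf2_norm A)"
      have x: "x > 0" "Hinf2_norm A = x\<^sup>2" using N1 by (simp_all add: x_def)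
      have "2 * (1 / x) / (1 + (1 / x)\<^sup>2) = 2 * x / (x\<^sup>2 + 1)"
        using x(1) by (simp add: power_divide divide_simps add_pos_pos) (simp add: power2_eq_square)
      then show ?thesis unfolding x_def[symmetric] x(2)[symmetric] .
    qed
    then show "2 * ?q / (1 + ?q\<^sup>2) \<le> pseudohyp (z i) (z j)" if "i \<in> I" "j \<in> I" "i \<noteq> j" for i j
      using far[of "Hinf2_norm A" i j] that N1 by simp
  qed
qed

theorem theorem1:
  shows "(\<forall>I z. separated I z \<and> upper_density I z < 1 \<longrightarrow>
           (\<exists>A\<in>Hinf2. \<exists>f. nontrivial_solution A f \<and> (\<forall>n\<in>I. f (z n) = 0)))
       \<and> (\<forall>A\<in>Hinf2. \<forall>f I z. nontrivial_solution A f \<and> zero_sequence f I z \<longrightarrow>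
           separated I z \<and>
           (Hinf2_norm A \<le> 1 \<longrightarrow> finite I \<and> card I \<le> 1) \<and>
           (Hinf2_norm A > 1 \<longrightarrow>
             upper_density I z \<le> ennreal
               ((2 * pi + 1)
                * sqrt (1 - 2 * sqrt (Hinf2_norm A) / (Hinf2_norm A + 1))
                / (1 - sqrt (1 - 2 * sqrt (Hinf2_norm A) / (Hinf2_norm A + 1)))\<^sup>2)))"
proof (intro conjI allI ballI impI)
  show "\<exists>A\<in>Hinf2. \<exists>f. nontrivial_solution A f \<and> (\<forall>n\<in>I. f (z n) = 0)"
    if "separated I z \<and> upper_density I z < 1" for I z
    using separated_thin_vanishing that by blast
next
  fix A f I z
  assume A: "A \<in> Hinf2" and f: "nontrivial_solution A f \<and> zero_sequence f I z"
  note * = zero_sequence_separated_and_density[OF A conjunct1[OF f] conjunct2[OF f]]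
  show "separated I z" by (rule *(1))
  show "finite I" "card I \<le> 1" if "Hinf2_norm A \<le> 1" using *(2)[OF that] by simp_all
  show "upper_density I z \<le> ennreal
      ((2 * pi + 1) * sqrt (1 - 2 * sqrt (Hinf2_norm A) / (Hinf2_norm A + 1))
        / (1 - sqrt (1 - 2 * sqrt (Hinf2_norm A) / (Hinf2_norm A + 1)))\<^sup>2)" if "Hinf2_norm A > 1"
    by (rule *(3)[OF that])
qed

end
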